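(* Let $F\subset\Omega$ be a minimal foam inside a region $\Omega\subset\mathbb{R}^3$, in mechanical equilibrium, with common cell pressure $p_{\rm int}$, exterior pressure $p_{\rm ext}$ and homogeneous surface tension $\sigma$. Then $$p_{\rm int}\ \geq\ p_{\rm ext}+\frac32\,\sigma\,\nu_\Omega\,A_0(d),$$ where $A_0(d)=\theta_v\,\pi\left(\frac d2\right)^2$ and $\theta_v=\frac3\pi\arccos\left(-\frac13\right)$.
   Context: A foam is a cell decomposition into connected three-dimensional chambers (cells) which satisfies the Plateau rules: (1) the interfaces (faces) between neighbouring chambers are smooth orientable embedded surfaces of constant mean curvature; (2) the faces meet in threes, at equal angles $2\pi/3$, along smooth curves called edges; (3) the edges meet four at a time at isolated points called vertices, where the angle between any pair of edges is $\arccos(-1/3)$. The foam is identified with the union $F$ of its faces, edges and vertices. A foam is minimal if all its faces have zero mean curvature; then all cells have the same pressure $p_{\rm int}$. The physical setting is a dry foam with an ideal gas in the chambers, held at constant temperature, with external pressure $p_{\rm ext}$ coming from $\partial\Omega$ and constant surface tension $\sigma>0$; in this setting the pressures are related by the equilibrium law $$p_{\rm int}-p_{\rm ext}=\frac32\,\sigma\,\frac{\mathrm{A}(F)}{\mathrm{V}(\Omega)},$$ which is taken as given ($\mathrm{A}$ is surface area, $\mathrm{V}$ is volume). Here $\nu_\Omega:=v_\Omega/\mathrm{V}(\Omega)$, with $v_\Omega$ the number of vertices inside $\Omega$, and $d$ is the minimal extrinsic (Euclidean) distance between vertices.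
   Formalization: Added: for each vertex the ball of radius d/2 about it lies in Ω; without this the claim fails (thin neighbourhood of an edge joining two vertices). Area, volume and number of vertices are taken finite, and exactly one vertex is excluded since d is then undefined. *)

theory Defs
  imports "HOL-Analysis.Analysis"
begin

type_synonym space = "real ^ 3"
type_synonym plane = "real \<times> real"

section \<open>Smooth maps\<close>

text \<open>\<open>C_k k f U\<close>: on the open set \<open>U\<close> the map \<open>f\<close> is \<open>k\<close> times continuously differentiable.\<close>

primrec C_k :: "nat \<Rightarrow> ('a::euclidean_space \<Rightarrow> 'b::real_normed_vector) \<Rightarrow> 'a set \<Rightarrow> bool" where
  "C_k 0 f U \<longleftrightarrow> continuous_on U f"
| "C_k (Suc k) f U \<longleftrightarrow>
     (\<forall>x\<in>U. f differentiable (at x)) \<and> (\<forall>h. C_k k (\<lambda>x. frechet_derivative f (at x) h) U)"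

definition smooth_on :: "('a::euclidean_space \<Rightarrow> 'b::real_normed_vector) \<Rightarrow> 'a set \<Rightarrow> bool" where
  "smooth_on f U \<longleftrightarrow> (\<forall>k. C_k k f U)"

definition d_x :: "(plane \<Rightarrow> space) \<Rightarrow> plane \<Rightarrow> space" where
  "d_x \<phi> u = frechet_derivative \<phi> (at u) (1, 0)"

definition d_y :: "(plane \<Rightarrow> space) \<Rightarrow> plane \<Rightarrow> space" where
  "d_y \<phi> u = frechet_derivative \<phi> (at u) (0, 1)"

text \<open>The differential is injective exactly when the cross product is nonzero.\<close>

definition immersion_on :: "(plane \<Rightarrow> space) \<Rightarrow> plane set \<Rightarrow> bool" where
  "immersion_on \<phi> U \<longleftrightarrow> (\<forall>u\<in>U. cross3 (d_x \<phi> u) (d_y \<phi> u) \<noteq> 0)"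

definition topological_embedding_on :: "(plane \<Rightarrow> space) \<Rightarrow> plane set \<Rightarrow> bool" where
  "topological_embedding_on \<phi> D \<longleftrightarrow> (\<exists>\<psi>. homeomorphism D (\<phi> ` D) \<phi> \<psi>)"

section \<open>Embedded surfaces\<close>

definition local_param :: "space set \<Rightarrow> (plane \<Rightarrow> space) \<Rightarrow> plane set \<Rightarrow> bool" where
  "local_param S \<phi> U \<longleftrightarrow>
     open U \<and> smooth_on \<phi> U \<and> immersion_on \<phi> U \<and> topological_embedding_on \<phi> U \<and>
     openin (top_of_set S) (\<phi> ` U)"

definition embedded_surface :: "space set \<Rightarrow> bool" where
  "embedded_surface S \<longleftrightarrow> (\<forall>p\<in>S. \<exists>\<phi> U. local_param S \<phi> U \<and> p \<in> \<phi> ` U)"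

definition unit_normal_field :: "space set \<Rightarrow> (space \<Rightarrow> space) \<Rightarrow> bool" where
  "unit_normal_field S n \<longleftrightarrow>
     continuous_on S n \<and> (\<forall>p\<in>S. norm (n p) = 1) \<and>
     (\<forall>\<phi> U. local_param S \<phi> U \<longrightarrow>
        (\<forall>u\<in>U. n (\<phi> u) \<bullet> d_x \<phi> u = 0 \<and> n (\<phi> u) \<bullet> d_y \<phi> u = 0))"

definition orientable :: "space set \<Rightarrow> bool" where
  "orientable S \<longleftrightarrow> (\<exists>n. unit_normal_field S n)"

text \<open>Mean curvature \<open>(e G - 2 f F + g E) / (2 (E G - F\<^sup>2))\<close> in terms of the two fundamental forms,
  the second one taken with respect to the unit normal \<open>\<nu>\<close>.\<close>

definition mean_curvature_param :: "(plane \<Rightarrow> space) \<Rightarrow> space \<Rightarrow> plane \<Rightarrow> real" where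
  "mean_curvature_param \<phi> \<nu> u =
    (let E = d_x \<phi> u \<bullet> d_x \<phi> u; F = d_x \<phi> u \<bullet> d_y \<phi> u; G = d_y \<phi> u \<bullet> d_y \<phi> u;
         e = d_x (d_x \<phi>) u \<bullet> \<nu>; f = d_y (d_x \<phi>) u \<bullet> \<nu>; g = d_y (d_y \<phi>) u \<bullet> \<nu>
     in (e * G - 2 * f * F + g * E) / (2 * (E * G - F\<^sup>2)))"

text \<open>The value does not depend on the local parametrization, so quantifying over all of them
  is the same as choosing one.\<close>

definition has_mean_curvature :: "space set \<Rightarrow> (space \<Rightarrow> space) \<Rightarrow> space \<Rightarrow> real \<Rightarrow> bool" where
  "has_mean_curvature S n p H \<longleftrightarrow>
     (\<forall>\<phi> U u. local_param S \<phi> U \<and> u \<in> U \<and> \<phi> u = p \<longrightarrow> mean_curvature_param \<phi> (n p) u = H)"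

definition constant_mean_curvature :: "space set \<Rightarrow> real \<Rightarrow> bool" where
  "constant_mean_curvature S H \<longleftrightarrow>
     (\<exists>n. unit_normal_field S n \<and> (\<forall>p\<in>S. has_mean_curvature S n p H))"

text \<open>Area: supremum over finite families of disjoint Borel pieces, each lying in one coordinate
  patch and measured there by \<open>\<integral> |\<phi>\<^sub>x \<times> \<phi>\<^sub>y|\<close>. A surface is a countable disjoint union of such
  pieces, so this is the usual surface area.\<close>

definition surface_area :: "space set \<Rightarrow> ennreal" where
  "surface_area S =
     Sup {(\<Sum>i<m. \<integral>\<^sup>+u\<in>K i. ennreal (norm (cross3 (d_x (\<phi> i) u) (d_y (\<phi> i) u))) \<partial>lborel)
          | (m::nat) \<phi> K.
            (\<forall>i<m. K i \<in> sets borel \<and> (\<exists>U. local_param S (\<phi> i) U \<and> K i \<subseteq> U)) \<and>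
            disjoint_family_on (\<lambda>i. \<phi> i ` K i) {..<m}}"

section \<open>Foams\<close>

definition vec_angle :: "space \<Rightarrow> space \<Rightarrow> real" where
  "vec_angle a b = arccos ((a \<bullet> b) / (norm a * norm b))"

text \<open>Along the boundary line \<open>y = 0\<close> of a half-plane patch, the inward pointing vector tangent to
  the patch and orthogonal to its boundary curve.\<close>

definition conormal :: "(plane \<Rightarrow> space) \<Rightarrow> plane \<Rightarrow> space" where
  "conormal \<phi> u =
     d_y \<phi> u - ((d_y \<phi> u \<bullet> d_x \<phi> u) / (d_x \<phi> u \<bullet> d_x \<phi> u)) *\<^sub>R d_x \<phi> u"

record foam =
  faces :: "space set set"
  edges :: "space set set"
  vertices :: "space set"

definition foam_set :: "foam \<Rightarrow> space set" where
  "foam_set F = \<Union> (faces F) \<union> \<Union> (edges F) \<union> vertices F"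

definition chambers :: "space set \<Rightarrow> foam \<Rightarrow> space set set" where
  "chambers \<Omega> F = components (\<Omega> - foam_set F)"

text \<open>Near an edge point the foam consists of three half-plane patches, smooth up to their common
  boundary curve \<open>y = 0\<close>, which is the edge (in particular the edge is a smooth embedded curve);
  the patches meet at angles \<open>2\<pi>/3\<close> all along that curve.\<close>

definition edge_point :: "foam \<Rightarrow> space set \<Rightarrow> space \<Rightarrow> bool" where
  "edge_point F e p \<longleftrightarrow>
     (\<exists>W (\<phi> :: nat \<Rightarrow> plane \<Rightarrow> space) U.
        open W \<and> p \<in> W \<and>
        (\<forall>i<3. open (U i) \<and> smooth_on (\<phi> i) (U i) \<and> immersion_on (\<phi> i) (U i) \<and>
           topological_embedding_on (\<phi> i) (U i \<inter> {(x, y). y \<ge> 0}) \<and>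
           \<phi> i ` (U i \<inter> {(x, y). y = 0}) = e \<inter> W \<and>
           (\<exists>S\<in>faces F. local_param S (\<phi> i) (U i \<inter> {(x, y). y > 0}))) \<and>
        disjoint_family_on (\<lambda>i. \<phi> i ` (U i \<inter> {(x, y). y > 0})) {..<3} \<and>
        foam_set F \<inter> W = (\<Union>i<3. \<phi> i ` (U i \<inter> {(x, y). y \<ge> 0})) \<and>
        (\<forall>i<3. \<forall>j<3. i \<noteq> j \<longrightarrow>
           (\<forall>a b. (a, 0) \<in> U i \<and> (b, 0) \<in> U j \<and> \<phi> i (a, 0) = \<phi> j (b, 0) \<longrightarrow>
              vec_angle (conormal (\<phi> i) (a, 0)) (conormal (\<phi> j) (b, 0)) = 2 * pi / 3)))"

text \<open>Near a vertex the foam is a curved copy of the cone over the edges of a regular tetrahedron: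
  four edge germs \<open>\<Gamma> i\<close> leave \<open>v\<close> with unit tangents \<open>\<tau> i\<close>, and for every pair \<open>i < j\<close> one corner
  patch, parametrized over a quadrant, is spanned by \<open>\<Gamma> i\<close> and \<open>\<Gamma> j\<close>. At the corner itself only
  \<open>C\<^sup>1\<close> regularity is asked for, as one cannot expect more there. The partial derivatives
  at the corner are normalized to be \<open>\<tau> i\<close> and \<open>\<tau> j\<close>, which is achieved by rescaling the
  coordinates. That \<open>v\<close> is the only vertex in \<open>W\<close> follows from the description of the foam
  in \<open>W\<close>, since faces, edges and vertices are disjoint.\<close>

definition vertex_point :: "foam \<Rightarrow> space \<Rightarrow> bool" where
  "vertex_point F v \<longleftrightarrow>
     (\<exists>W (\<phi> :: nat \<Rightarrow> nat \<Rightarrow> plane \<Rightarrow> space) U (\<Gamma> :: nat \<Rightarrow> space set) (\<tau> :: nat \<Rightarrow> space).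
        open W \<and> v \<in> W \<and>
        (\<forall>i<4. norm (\<tau> i) = 1 \<and> (\<exists>e\<in>edges F. \<Gamma> i \<subseteq> e)) \<and>
        disjoint_family_on \<Gamma> {..<4} \<and>
        (\<forall>i<4. \<forall>j<4. i \<noteq> j \<longrightarrow> vec_angle (\<tau> i) (\<tau> j) = arccos (- (1 / 3))) \<and>
        (\<forall>j<4. \<forall>i<j. open (U i j) \<and> C_k 1 (\<phi> i j) (U i j) \<and> immersion_on (\<phi> i j) (U i j) \<and>
           topological_embedding_on (\<phi> i j) (U i j \<inter> {(x, y). x \<ge> 0 \<and> y \<ge> 0}) \<and>
           (0, 0) \<in> U i j \<and> \<phi> i j (0, 0) = v \<and>
           d_x (\<phi> i j) (0, 0) = \<tau> i \<and> d_y (\<phi> i j) (0, 0) = \<tau> j \<and>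
           \<phi> i j ` (U i j \<inter> {(x, y). x > 0 \<and> y = 0}) = \<Gamma> i \<and>
           \<phi> i j ` (U i j \<inter> {(x, y). x = 0 \<and> y > 0}) = \<Gamma> j \<and>
           (\<exists>S\<in>faces F. local_param S (\<phi> i j) (U i j \<inter> {(x, y). x > 0 \<and> y > 0}))) \<and>
        disjoint_family_on (\<lambda>(i, j). \<phi> i j ` (U i j \<inter> {(x, y). x > 0 \<and> y > 0}))
          {(i, j). i < j \<and> j < 4} \<and>
        foam_set F \<inter> W =
          (\<Union>(i, j)\<in>{(i, j). i < j \<and> j < 4}. \<phi> i j ` (U i j \<inter> {(x, y). x \<ge> 0 \<and> y \<ge> 0})))"

text \<open>The foam may run out to the frontier of \<open>\<Omega>\<close>: it is only closed relative to the
  (open) region \<open>\<Omega>\<close>, and nothing is asked of it at the frontier.\<close>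

definition is_foam :: "space set \<Rightarrow> foam \<Rightarrow> bool" where
  "is_foam \<Omega> F \<longleftrightarrow>
     closedin (top_of_set \<Omega>) (foam_set F) \<and>
     pairwise disjnt (faces F) \<and> pairwise disjnt (edges F) \<and>
     disjnt (\<Union> (faces F)) (\<Union> (edges F)) \<and> disjnt (\<Union> (faces F)) (vertices F) \<and>
     disjnt (\<Union> (edges F)) (vertices F) \<and>
     (\<forall>S\<in>faces F. S \<noteq> {} \<and> connected S \<and> openin (top_of_set (foam_set F)) S \<and>
        embedded_surface S \<and> orientable S \<and> (\<exists>H. constant_mean_curvature S H) \<and>
        (\<exists>C\<in>chambers \<Omega> F. \<exists>C'\<in>chambers \<Omega> F. C \<noteq> C' \<and> S \<subseteq> closure C \<inter> closure C')) \<and>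
     (\<forall>e\<in>edges F. e \<noteq> {} \<and> connected e \<and> (\<forall>p\<in>e. edge_point F e p)) \<and>
     (\<forall>v\<in>vertices F. vertex_point F v)"

definition minimal_foam :: "space set \<Rightarrow> foam \<Rightarrow> bool" where
  "minimal_foam \<Omega> F \<longleftrightarrow> is_foam \<Omega> F \<and> (\<forall>S\<in>faces F. constant_mean_curvature S 0)"

text \<open>Edges and vertices do not contribute to the area. The faces are relatively open in the foam
  and disjoint, so their union is again an embedded surface.\<close>

definition foam_area :: "foam \<Rightarrow> ennreal" where
  "foam_area F = surface_area (\<Union> (faces F))"

definition vertex_density :: "space set \<Rightarrow> foam \<Rightarrow> real" where
  "vertex_density \<Omega> F = real (card (vertices F)) / measure lborel \<Omega>"

text \<open>Meaningful only for a finite vertex set with at least two elements.\<close>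

definition min_vertex_dist :: "foam \<Rightarrow> real" where
  "min_vertex_dist F = Min {dist v w | v w. v \<in> vertices F \<and> w \<in> vertices F \<and> v \<noteq> w}"

definition theta_v :: real where
  "theta_v = 3 / pi * arccos (- (1 / 3))"

definition A_0 :: "real \<Rightarrow> real" where
  "A_0 d = theta_v * pi * (d / 2)\<^sup>2"

end

theory Submission
  imports Defs
begin

text \<open>The foam area is carried by a measure \<open>\<mu>\<close> on the union of the faces. Minimality of the faces
  and the \<open>2\<pi>/3\<close> condition along the edges make the foam stationary away from the vertices:
  \<open>\<integral> div\<^sub>F X d\<mu> = 0\<close> for every \<open>C\<^sup>1\<close> field \<open>X\<close> with compact support off the vertices. Testing with radial
  fields \<open>g(|x - v|\<^sup>2) (x - v)\<close> shows that the area in a ball of radius \<open>\<rho>\<close> around a vertex \<open>v\<close>, divided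
  by \<open>\<rho>\<^sup>2\<close>, does not decrease in \<open>\<rho>\<close>; stationarity at \<open>v\<close> itself is not needed, since cutting off near
  \<open>v\<close> only contributes a term of the right sign. As \<open>\<rho> \<rightarrow> 0\<close> the quotient is bounded below by that
  of the tetrahedral cone, six sectors of angle \<open>arccos (-1/3)\<close>. The balls of radius \<open>d/2\<close> around the
  vertices are disjoint, so their areas add up.\<close>

section \<open>Cross products\<close>

text \<open>Stationarity comes down to boundary terms: by the divergence theorem in one chart, a
  minimal patch contributes only the integral of X against its inward conormal along the edge, and
  three unit vectors at mutual angles 2 pi/3 add up to zero. For X = g(t) (x - v) with t = |x - v|^2
  the tangential divergence is 2 (g + g' p), where p, the squared length of the tangential part of x
  - v, satisfies 0 \<le> p \<le> t. The model profile is g(t) = 1/max(\<rho>^2, t) - 1/R^2, set to 0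
  beyond R^2. Then g + g' p equals 1/\<rho>^2 - 1/R^2 inside the radius \<rho> and is at least
  -1/R^2 between \<rho> and R, so a vanishing integral says area(\<rho>)/\<rho>^2 \<le> area(R)/R^2.
  This profile is not C^1 and v has to be avoided, hence the smoothed profiles and the successive
  limits. Up to a vertex the patches are only C^1: enough to compute the density there, but the
  first variation of a patch uses second derivatives. The constant: six sectors of area arccos(-1/3)
  \<rho>^2/2 make 3 arccos(-1/3) \<rho>^2, which is theta_v pi \<rho>^2.\<close>

text \<open>\<open>tdiv n A\<close> is the trace of \<open>A\<close> over the plane orthogonal to the unit vector \<open>n\<close>.\<close>

definition tdiv :: "space \<Rightarrow> (space \<Rightarrow> space) \<Rightarrow> real" where
  "tdiv n A = A (axis 1 1) $ 1 + A (axis 2 1) $ 2 + A (axis 3 1) $ 3 - A n \<bullet> n"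

text \<open>With a and b moving by A, the cross product J changes at the rate (tr A) J - A^T J;
  pairing with J gives the right-hand side. It is a polynomial identity in the coordinates.\<close>

lemma cross3_trace_identity:
  fixes a b :: space
  assumes "linear A"
  defines "J \<equiv> cross3 a b"
  shows "J \<bullet> (cross3 (A a) b + cross3 a (A b))
    = (A (axis 1 1) $ 1 + A (axis 2 1) $ 2 + A (axis 3 1) $ 3) * (J \<bullet> J) - A J \<bullet> J"
proof -
  define M where "M = matrix A"
  have A: "A x = M *v x" for x
    using assms(1) by (simp add: M_def matrix_works)
  show ?thesis
    unfolding A J_def
    by (simp add: matrix_vector_mult_def cross3_def inner_vec_def sum_3 vector_def axis_def)
      algebra
qed

text \<open>A tangent parallelogram moved by A changes its area |J| at the relative rate
  \<open>tdiv N A\<close>. This is how the divergence enters a chart integral.\<close>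

lemma tdiv_area_form:
  fixes a b :: space
  assumes "linear A" "cross3 a b \<noteq> 0"
  defines "N \<equiv> cross3 a b /\<^sub>R norm (cross3 a b)"
  shows "N \<bullet> (cross3 (A a) b + cross3 a (A b)) = norm (cross3 a b) * tdiv N A"
proof -
  define J where "J = cross3 a b"
  define c where "c = norm J"
  have c: "c > 0" "J \<bullet> J = c\<^sup>2" using assms(2) by (auto simp: c_def J_def power2_norm_eq_inner)
  have N: "N = (1/c) *\<^sub>R J" by (simp add: N_def c_def J_def divide_inverse)
  have AN: "A N = (1/c) *\<^sub>R A J" using assms(1) by (simp add: N linear_cmul)
  have "N \<bullet> (cross3 (A a) b + cross3 a (A b)) = (1/c) * (J \<bullet> (cross3 (A a) b + cross3 a (A b)))"
    by (simp add: N)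
  also have "\<dots> = (1/c) * ((A (axis 1 1) $ 1 + A (axis 2 1) $ 2 + A (axis 3 1) $ 3) * c\<^sup>2 - A J \<bullet> J)"
    using cross3_trace_identity[OF assms(1), of a b] c by (simp add: J_def)
  also have "\<dots> = c * tdiv N A"
    using c unfolding tdiv_def AN N[symmetric] by (simp add: N field_simps power2_eq_square)
  finally show ?thesis by (simp add: c_def J_def)
qed

lemma tdiv_minus: "linear A \<Longrightarrow> tdiv (- n) A = tdiv n A"
  by (simp add: tdiv_def linear_neg)

section \<open>Frame identities behind minimality and the edge condition\<close>

lemma cross3_triple_cycle:
  "cross3 a b \<bullet> c = a \<bullet> cross3 b c" "cross3 a b \<bullet> c = b \<bullet> cross3 c a"
  by (simp_all add: cross3_simps)

lemma cross3_cross3: "cross3 a (cross3 b c) = (a \<bullet> c) *\<^sub>R b - (a \<bullet> b) *\<^sub>R c"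
  by (simp add: cross3_simps) (auto simp: algebra_simps forall_3)

lemma cross3_dot_cross3:
  "cross3 a b \<bullet> cross3 c d = (a \<bullet> c) * (b \<bullet> d) - (a \<bullet> d) * (b \<bullet> c)"
  by (simp add: cross3_simps)

text \<open>The cross product of V with J = a x b is a combination of a and b with coefficients V.b
  and -V.a. So V is both parallel and orthogonal to the nonzero J.\<close>

lemma orthogonal_to_frame_eq_0:
  fixes V :: space
  assumes "V \<bullet> a = 0" "V \<bullet> b = 0" "V \<bullet> cross3 a b = 0" "cross3 a b \<noteq> 0"
  shows "V = 0"
proof -
  have "cross3 V (cross3 a b) = 0" using assms by (simp add: cross3_cross3)
  then show ?thesis using assms norm_and_cross_eq_0(1)[of V "cross3 a b"] by auto
qed

text \<open>Here a, b stand for the coordinate tangents of a chart and n1, n2 for the derivatives of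
  its unit normal. Both are tangential, so the sum is normal; by the symmetry \<open>s\<close> of
  the second fundamental form its normal component is, up to sign and scale, the mean curvature
  numerator in \<open>H\<close>.\<close>

lemma minimal_normal_variation:
  fixes a b n1 n2 :: space
  assumes J: "cross3 a b \<noteq> 0" and n: "n1 \<bullet> cross3 a b = 0" "n2 \<bullet> cross3 a b = 0"
    and s: "n2 \<bullet> a = n1 \<bullet> b"
    and H: "(n1 \<bullet> a) * (b \<bullet> b) - 2 * (n1 \<bullet> b) * (a \<bullet> b) + (n2 \<bullet> b) * (a \<bullet> a) = 0"
  shows "cross3 b n1 + cross3 n2 a = 0"
proof (rule orthogonal_to_frame_eq_0[OF _ _ _ J])
  show "(cross3 b n1 + cross3 n2 a) \<bullet> a = 0"
    using n by (simp add: inner_add_left dot_cross_self) (simp add: cross3_simps)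
  show "(cross3 b n1 + cross3 n2 a) \<bullet> b = 0"
    using n by (simp add: inner_add_left dot_cross_self) (simp add: cross3_simps)
  show "(cross3 b n1 + cross3 n2 a) \<bullet> cross3 a b = 0"
    using H s by (simp add: inner_add_left cross3_dot_cross3 inner_commute algebra_simps)
qed

text \<open>The squared length of the sum is 3 + 2 * 3 * (-1/2) = 0.\<close>

lemma three_unit_vectors_sum_0:
  fixes a b c :: space
  assumes "norm a = 1" "norm b = 1" "norm c = 1" "a \<bullet> b = -1/2" "a \<bullet> c = -1/2" "b \<bullet> c = -1/2"
  shows "a + b + c = 0"
proof -
  have 1: "a \<bullet> a = 1" "b \<bullet> b = 1" "c \<bullet> c = 1" using assms(1-3) by (simp_all add: dot_square_norm)
  have "(a + b + c) \<bullet> (a + b + c) = 0"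
    using 1 assms(4-6) by (simp add: inner_add_left inner_add_right inner_commute)
  then show ?thesis by simp
qed

lemma cos_vec_angle:
  assumes "a \<noteq> 0" "b \<noteq> 0"
  shows "cos (vec_angle a b) = a \<bullet> b / (norm a * norm b)"
proof -
  have "\<bar>a \<bullet> b\<bar> \<le> norm a * norm b" by (rule Cauchy_Schwarz_ineq2)
  then have "\<bar>a \<bullet> b / (norm a * norm b)\<bar> \<le> 1" using assms by (simp add: abs_mult)
  then show ?thesis unfolding vec_angle_def by (intro cos_arccos) linarith+
qed

section \<open>Smooth maps of the plane\<close>

lemma smooth_on_C_k: "smooth_on f U \<Longrightarrow> C_k k f U"
  by (simp add: smooth_on_def)

lemma smooth_on_has_derivative:
  assumes "smooth_on f U" "x \<in> U"
  shows "(f has_derivative frechet_derivative f (at x)) (at x)"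
  using smooth_on_C_k[OF assms(1), of 1] assms(2) by (auto simp: frechet_derivative_works)

lemma smooth_on_continuous: "smooth_on f U \<Longrightarrow> continuous_on U f"
  using smooth_on_C_k[of f U 0] by simp

lemma smooth_on_frechet: "smooth_on f U \<Longrightarrow> smooth_on (\<lambda>x. frechet_derivative f (at x) h) U"
  unfolding smooth_on_def by (metis C_k.simps(2))

lemma smooth_on_d_x: "smooth_on f U \<Longrightarrow> smooth_on (d_x f) U"
  and smooth_on_d_y: "smooth_on f U \<Longrightarrow> smooth_on (d_y f) U"
  using smooth_on_frechet[of f U "(1,0)"] smooth_on_frechet[of f U "(0,1)"]
  by (simp_all add: d_x_def[abs_def] d_y_def[abs_def])

lemma C_k_subset: "C_k k f U \<Longrightarrow> V \<subseteq> U \<Longrightarrow> C_k k f V"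
  by (induction k arbitrary: f) (auto intro: continuous_on_subset)

lemma smooth_on_subset: "smooth_on f U \<Longrightarrow> V \<subseteq> U \<Longrightarrow> smooth_on f V"
  unfolding smooth_on_def using C_k_subset by blast

lemma frechet_derivative_plane:
  assumes "f differentiable (at u)"
  shows "frechet_derivative f (at u) h = fst h *\<^sub>R d_x f u + snd h *\<^sub>R d_y f u"
proof -
  have l: "linear (frechet_derivative f (at u))" using assms by (rule linear_frechet_derivative)
  have "h = fst h *\<^sub>R (1,0) + snd h *\<^sub>R (0,1)" by (cases h) simp
  then have "frechet_derivative f (at u) h = frechet_derivative f (at u) (fst h *\<^sub>R (1,0) + snd h *\<^sub>R (0,1))"
    by simp
  then show ?thesis using l unfolding d_x_def d_y_def by (simp only: linear_add linear_cmul)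
qed

lemma smooth_on_has_derivative_plane:
  assumes "smooth_on f U" "u \<in> U"
  shows "(f has_derivative (\<lambda>h. fst h *\<^sub>R d_x f u + snd h *\<^sub>R d_y f u)) (at u)"
  using smooth_on_has_derivative[OF assms] frechet_derivative_plane[of f u]
  by (metis (no_types, lifting) differentiableI has_derivative_eq_rhs ext)

lemma partial_has_vector_derivative:
  fixes f :: "plane \<Rightarrow> 'b::real_normed_vector"
  assumes "(f has_derivative (\<lambda>h. fst h *\<^sub>R a + snd h *\<^sub>R b)) (at (x, y) within S)"
  shows "((\<lambda>s. f (s, y)) has_vector_derivative a) (at x within {s. (s,y) \<in> S})"
    and "((\<lambda>t. f (x, t)) has_vector_derivative b) (at y within {t. (x,t) \<in> S})"
proof -
  have "((\<lambda>s. f (s, y)) has_derivative (\<lambda>h. (\<lambda>h. fst h *\<^sub>R a + snd h *\<^sub>R b) (h, 0))) (at x within {s. (s,y) \<in> S})"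
    by (rule has_derivative_in_compose[of "\<lambda>s. (s,y)" "\<lambda>h. (h,0)" _ _ f])
       (auto intro!: derivative_eq_intros has_derivative_subset[OF assms])
  then show "((\<lambda>s. f (s, y)) has_vector_derivative a) (at x within {s. (s,y) \<in> S})"
    by (simp add: has_vector_derivative_def)
  have "((\<lambda>t. f (x, t)) has_derivative (\<lambda>h. (\<lambda>h. fst h *\<^sub>R a + snd h *\<^sub>R b) (0, h))) (at y within {t. (x,t) \<in> S})"
    by (rule has_derivative_in_compose[of "\<lambda>s. (x,s)" "\<lambda>h. (0,h)" _ _ f])
       (auto intro!: derivative_eq_intros has_derivative_subset[OF assms])
  then show "((\<lambda>t. f (x, t)) has_vector_derivative b) (at y within {t. (x,t) \<in> S})"
    by (simp add: has_vector_derivative_def)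
qed

text \<open>The second difference over a square is a difference in s of differences in t, so two
  uses of the mean value theorem produce one mixed derivative.\<close>

lemma mixed_difference_mvt:
  fixes f fx fxy :: "real \<Rightarrow> real \<Rightarrow> real"
  assumes h: "h > 0"
    and fx: "\<And>s t. x \<le> s \<Longrightarrow> s \<le> x + h \<Longrightarrow> y \<le> t \<Longrightarrow> t \<le> y + h \<Longrightarrow>
        ((\<lambda>s. f s t) has_real_derivative fx s t) (at s)"
    and fxy: "\<And>s t. x \<le> s \<Longrightarrow> s \<le> x + h \<Longrightarrow> y \<le> t \<Longrightarrow> t \<le> y + h \<Longrightarrow>
        ((\<lambda>t. fx s t) has_real_derivative fxy s t) (at t)"
  obtains s t where "x < s" "s < x + h" "y < t" "t < y + h"
    "f (x + h) (y + h) - f (x + h) y - f x (y + h) + f x y = h\<^sup>2 * fxy s t"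
proof -
  have "\<exists>s. x < s \<and> s < x + h \<and> (\<lambda>s. f s (y+h) - f s y) (x + h) - (\<lambda>s. f s (y+h) - f s y) x
      = (x + h - x) * (fx s (y+h) - fx s y)"
    by (rule MVT2) (use h in \<open>auto intro!: DERIV_diff fx\<close>)
  then obtain s where s: "x < s" "s < x + h"
    "f (x + h) (y + h) - f (x + h) y - (f x (y + h) - f x y) = h * (fx s (y+h) - fx s y)" by auto
  have "\<exists>t. y < t \<and> t < y + h \<and> fx s (y+h) - fx s y = (y + h - y) * fxy s t"
    by (rule MVT2) (use h s in \<open>auto intro!: fxy\<close>)
  then obtain t where t: "y < t" "t < y + h" "fx s (y+h) - fx s y = h * fxy s t" by auto
  show ?thesis by (rule that[OF s(1,2) t(1,2)]) (use s(3) t(3) in \<open>simp add: power2_eq_square\<close>)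
qed

text \<open>The second difference over a small square is symmetric in the two variables, and it
  equals h^2 times either mixed derivative at some point of the square. Continuity at u does the
  rest. The inner product with w reduces vectors to reals.\<close>

lemma mixed_partials_eq:
  fixes f :: "plane \<Rightarrow> space"
  assumes sm: "smooth_on f U" and U: "open U" and u: "u \<in> U"
  shows "d_x (d_y f) u = d_y (d_x f) u"
proof (rule vector_eq_rdot[THEN iffD1], rule allI)
  fix w :: space
  let ?P = "\<lambda>u. d_y (d_x f) u \<bullet> w" and ?Q = "\<lambda>u. d_x (d_y f) u \<bullet> w"
  have cont: "continuous (at u) ?P" "continuous (at u) ?Q"
    using smooth_on_continuous[OF smooth_on_d_y[OF smooth_on_d_x[OF sm]]]
      smooth_on_continuous[OF smooth_on_d_x[OF smooth_on_d_y[OF sm]]] U u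
    by (auto simp: continuous_on_eq_continuous_at intro!: continuous_intros)
  have der: "((\<lambda>s. g (s,t) \<bullet> w) has_real_derivative d_x g (s,t) \<bullet> w) (at s)"
     "((\<lambda>t. g (s,t) \<bullet> w) has_real_derivative d_y g (s,t) \<bullet> w) (at t)"
    if "smooth_on g U" "(s,t) \<in> U" for g s t
    using partial_has_vector_derivative[OF smooth_on_has_derivative_plane[OF that]]
    by (auto simp: has_real_derivative_iff_has_vector_derivative intro!: bounded_linear.has_vector_derivative[OF bounded_linear_inner_left])
  have "\<bar>?P u - ?Q u\<bar> \<le> e" if e: "e > 0" for e :: real
  proof -
    obtain d1 where d1: "d1 > 0" "\<And>z. dist z u < d1 \<Longrightarrow> dist (?P z) (?P u) < e/2"
      using cont(1) e unfolding continuous_at_eps_delta by (metis half_gt_zero)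
    obtain d2 where d2: "d2 > 0" "\<And>z. dist z u < d2 \<Longrightarrow> dist (?Q z) (?Q u) < e/2"
      using cont(2) e unfolding continuous_at_eps_delta by (metis half_gt_zero)
    obtain d3 where d3: "d3 > 0" "ball u d3 \<subseteq> U" using U u openE by blast
    \<comment> \<open>The square of side h stays within distance 2 h of u, half of the smallest
      radius.\<close>
    define h where "h = min d1 (min d2 d3) / 4"
    have h: "h > 0" using d1 d2 d3 by (auto simp: h_def)
    obtain x y where xy: "u = (x, y)" by (cases u)
    have near: "dist (s,t) u < min d1 (min d2 d3)" if "x \<le> s" "s \<le> x + h" "y \<le> t" "t \<le> y + h" for s t
    proof -
      have "dist (s,t) (x,y) \<le> \<bar>s - x\<bar> + \<bar>t - y\<bar>"
        using sqrt_sum_squares_le_sum_abs[of "s-x" "t-y"] by (simp add: dist_Pair_Pair dist_real_def)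
      also have "\<dots> \<le> 2 * h" using that by simp
      also have "\<dots> < min d1 (min d2 d3)" using h unfolding h_def by linarith
      finally show ?thesis by (simp add: xy)
    qed
    have inU: "(s,t) \<in> U" if "x \<le> s" "s \<le> x + h" "y \<le> t" "t \<le> y + h" for s t
      using near[OF that] d3 by (auto simp: dist_commute mem_ball subset_iff)
    obtain s t where st: "x < s" "s < x + h" "y < t" "t < y + h"
      "f (x + h, y + h) \<bullet> w - f (x + h, y) \<bullet> w - f (x, y + h) \<bullet> w + f (x, y) \<bullet> w = h\<^sup>2 * (d_y (d_x f) (s,t) \<bullet> w)"
      by (rule mixed_difference_mvt[OF h, of x y "\<lambda>s t. f (s,t) \<bullet> w" "\<lambda>s t. d_x f (s,t) \<bullet> w" "\<lambda>s t. d_y (d_x f) (s,t) \<bullet> w"])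
        (use inU der[OF sm] der[OF smooth_on_d_x[OF sm]] in auto)
    obtain t' s' where st': "y < t'" "t' < y + h" "x < s'" "s' < x + h"
      "f (x + h, y + h) \<bullet> w - f (x, y + h) \<bullet> w - f (x + h, y) \<bullet> w + f (x, y) \<bullet> w = h\<^sup>2 * (d_x (d_y f) (s',t') \<bullet> w)"
      by (rule mixed_difference_mvt[OF h, of y x "\<lambda>t s. f (s,t) \<bullet> w" "\<lambda>t s. d_y f (s,t) \<bullet> w" "\<lambda>t s. d_x (d_y f) (s,t) \<bullet> w"])
        (use inU der[OF sm] der[OF smooth_on_d_y[OF sm]] in auto)
    have "h\<^sup>2 * ?P (s,t) = h\<^sup>2 * ?Q (s',t')" using st(5) st'(5) by linarith
    then have "?P (s,t) = ?Q (s',t')" using h by simp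
    moreover have "dist (?P (s,t)) (?P u) < e/2" using d1 near[of s t] st by auto
    moreover have "dist (?Q (s',t')) (?Q u) < e/2" using d2 near[of s' t'] st' by auto
    ultimately show ?thesis unfolding dist_real_def by linarith
  qed
  then have "\<bar>?P u - ?Q u\<bar> \<le> 0" by (rule field_le_epsilon) simp
  then show "d_x (d_y f) u \<bullet> w = d_y (d_x f) u \<bullet> w" by simp
qed

section \<open>Change of variables in the plane\<close>

text \<open>\<open>has_measure_differentiable_image\<close> is an equivalence between finite measure
  of the image and integrability of the Jacobian. One direction gives the finite case; the other
  shows that an image of infinite measure has an infinite Jacobian integral.\<close>

lemma emeasure_injective_image_real2:
  fixes g :: "real^2 \<Rightarrow> real^2"
  assumes S[measurable]: "S \<in> sets borel"
    and der: "\<And>x. x \<in> S \<Longrightarrow> (g has_derivative g' x) (at x within S)"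
    and inj: "inj_on g S" and gS: "g ` S \<in> sets borel"
    and meas[measurable]: "(\<lambda>x. \<bar>det (matrix (g' x))\<bar> * indicator S x) \<in> borel_measurable borel"
  shows "emeasure lborel (g ` S) = (\<integral>\<^sup>+x\<in>S. ennreal \<bar>det (matrix (g' x))\<bar> \<partial>lborel)"
proof -
  let ?d = "\<lambda>x. \<bar>det (matrix (g' x))\<bar>"
  have Sl: "S \<in> sets lebesgue" using S by auto
  have eqn: "(\<integral>\<^sup>+x\<in>S. ennreal (?d x) \<partial>lborel) = (\<integral>\<^sup>+x. ennreal (?d x * indicator S x) \<partial>lborel)"
    by (intro nn_integral_cong) (auto simp: indicator_def)
  note iff = has_measure_differentiable_image[OF Sl der inj]
  show ?thesis
  proof (cases "g ` S \<in> lmeasurable")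
    case True
    then have "(?d has_integral measure lebesgue (g ` S)) S" using iff by blast
    then have "(\<integral>\<^sup>+x\<in>S. ennreal (?d x) \<partial>lborel) = ennreal (measure lebesgue (g ` S))"
      by (intro nn_integral_has_integral_lebesgue') auto
    also have "\<dots> = emeasure lebesgue (g ` S)" by (rule emeasure_eq_measure2[OF True, symmetric])
    finally show ?thesis using gS by simp
  next
    case False
    then have inf: "emeasure lborel (g ` S) = \<infinity>"
      using gS fmeasurableI[of "g ` S" lebesgue] by (auto simp: less_top[symmetric])
    have "(\<integral>\<^sup>+x. ennreal (?d x * indicator S x) \<partial>lborel) = \<infinity>"
    proof (rule ccontr)
      assume "\<not> ?thesis"
      then obtain m where m: "m \<ge> 0" "(\<integral>\<^sup>+x. ennreal (?d x * indicator S x) \<partial>lborel) = ennreal m"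
        by (cases "(\<integral>\<^sup>+x. ennreal (?d x * indicator S x) \<partial>lborel)") auto
      have "((\<lambda>x. ?d x * indicator S x) has_integral m) UNIV"
        by (rule nn_integral_has_integral[OF _ _ m(2) m(1)]) auto
      then have "(?d has_integral m) S"
      proof -
        have "(\<lambda>x. ?d x * indicator S x) = (\<lambda>x. if x \<in> S then ?d x else 0)" by (auto simp: fun_eq_iff)
        with \<open>((\<lambda>x. ?d x * indicator S x) has_integral m) UNIV\<close> show ?thesis
          by (simp only: has_integral_restrict_UNIV)
      qed
      then show False using iff False by blast
    qed
    then show ?thesis using inf eqn by simp
  qed
qed

text \<open>Determinants are taken on \<open>real ^ 2\<close>, charts live on
  \<open>real \<times> real\<close>; these two maps carry Lebesgue measure and derivatives between
  them.\<close>

definition to_plane :: "real^2 \<Rightarrow> plane" where "to_plane v = (v $ 1, v $ 2)"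
definition of_plane :: "plane \<Rightarrow> real^2" where "of_plane p = vector [fst p, snd p]"

lemma to_of_plane[simp]: "to_plane (of_plane p) = p" "of_plane (to_plane v) = v"
  by (simp_all add: to_plane_def of_plane_def vec_eq_iff forall_2)

lemma bounded_linear_to_plane: "bounded_linear to_plane"
  unfolding to_plane_def by (intro bounded_linear_Pair bounded_linear_vec_nth)

lemma bounded_linear_of_plane: "bounded_linear of_plane"
proof -
  have "linear of_plane" 
    by (rule linearI) (simp_all add: of_plane_def vec_eq_iff forall_2)
  then show ?thesis by (simp add: linear_conv_bounded_linear)
qed

lemma borel_measurable_to_plane[measurable]: "to_plane \<in> borel_measurable borel"
  and borel_measurable_of_plane[measurable]: "of_plane \<in> borel_measurable borel"
  by (intro borel_measurable_continuous_onI linear_continuous_on bounded_linear_to_plane bounded_linear_of_plane)+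

lemma lborel_real2_eq: "(lborel :: (real^2) measure) = distr lborel borel of_plane"
proof (rule lborel_eqI)
  fix l u :: "real^2" assume le: "\<And>b. b \<in> Basis \<Longrightarrow> l \<bullet> b \<le> u \<bullet> b"
  have le': "l $ i \<le> u $ i" for i
    using le[of "axis i 1"] by (simp add: inner_axis)
  have "of_plane -` box l u = box (to_plane l) (to_plane u)"
    by (auto simp: mem_box_cart of_plane_def to_plane_def forall_2 mem_box Basis_prod_def)
  then have "emeasure (distr lborel borel of_plane) (box l u) = emeasure lborel (box (to_plane l) (to_plane u))"
    by (subst emeasure_distr) auto
  also have "\<dots> = (\<Prod>b\<in>Basis. (to_plane u - to_plane l) \<bullet> b)"
    using le' by (intro emeasure_lborel_box) (auto simp: to_plane_def Basis_prod_def)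
  also have "(\<Prod>b\<in>Basis. (to_plane u - to_plane l) \<bullet> b) = (u$1 - l$1) * (u$2 - l$2)"
    by (simp add: to_plane_def Basis_prod_def)
  also have "\<dots> = (\<Prod>b\<in>Basis. (u - l) \<bullet> b)"
  proof -
    have B: "Basis = {axis 1 1, axis 2 1 :: real^2}" by (auto simp: Basis_vec_def UNIV_2)
    have "axis 1 1 \<noteq> (axis 2 1 :: real^2)" by (simp add: axis_eq_axis)
    then have "(\<Prod>b\<in>Basis. (u - l) \<bullet> b) = ((u - l) \<bullet> axis 1 1) * ((u - l) \<bullet> axis 2 1)"
      unfolding B by (subst prod.insert) auto
    then show ?thesis by (simp add: inner_axis)
  qed
  finally show "emeasure (distr lborel borel of_plane) (box l u) = ennreal (\<Prod>b\<in>Basis. (u - l) \<bullet> b)"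
    using le' by simp
qed simp

text \<open>The vectors \<open>a x\<close> and \<open>b x\<close> are the columns of the Jacobian
  matrix, so the integrand is the absolute value of its determinant.\<close>

lemma emeasure_injective_image_plane:
  fixes g :: "plane \<Rightarrow> plane"
  assumes S[measurable]: "S \<in> sets borel"
    and der: "\<And>x. x \<in> S \<Longrightarrow> (g has_derivative (\<lambda>h. fst h *\<^sub>R a x + snd h *\<^sub>R b x)) (at x within S)"
    and inj: "inj_on g S" and gS[measurable]: "g ` S \<in> sets borel"
    and meas[measurable]: "(\<lambda>x. \<bar>fst (a x) * snd (b x) - snd (a x) * fst (b x)\<bar> * indicator S x) \<in> borel_measurable borel"
  shows "emeasure lborel (g ` S) = (\<integral>\<^sup>+x\<in>S. ennreal \<bar>fst (a x) * snd (b x) - snd (a x) * fst (b x)\<bar> \<partial>lborel)"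
proof -
  define S' where "S' = to_plane -` S"
  have [measurable]: "S' \<in> sets borel" unfolding S'_def
    using measurable_sets[OF borel_measurable_to_plane S] by simp
  define G where "G v = of_plane (g (to_plane v))" for v
  define D where "D x = \<bar>fst (a x) * snd (b x) - snd (a x) * fst (b x)\<bar>" for x
  define G' where "G' v = (\<lambda>h. of_plane ((\<lambda>h. fst h *\<^sub>R a (to_plane v) + snd h *\<^sub>R b (to_plane v)) (to_plane h)))" for v
  have S'S: "to_plane ` S' \<subseteq> S" by (auto simp: S'_def)
  have detG: "\<bar>det (matrix (G' v))\<bar> = D (to_plane v)" for v
    by (simp add: det_2 matrix_def G'_def D_def of_plane_def to_plane_def axis_def algebra_simps)
  have G'S: "G ` S' = to_plane -` (g ` S)"
  proof (intro equalityI subsetI)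
    fix v assume "v \<in> G ` S'"
    then show "v \<in> to_plane -` (g ` S)" by (auto simp: G_def S'_def)
  next
    fix v assume "v \<in> to_plane -` (g ` S)"
    then obtain x where vx: "to_plane v = g x" "x \<in> S" by auto
    have "G (of_plane x) = v" unfolding G_def by (simp flip: vx(1))
    moreover have "of_plane x \<in> S'" using vx by (simp add: S'_def)
    ultimately show "v \<in> G ` S'" by blast
  qed
  have GS'm[measurable]: "G ` S' \<in> sets borel" unfolding G'S 
    using measurable_sets[OF borel_measurable_to_plane gS] by simp
  have Dm[measurable]: "(\<lambda>x. D x * indicator S x) \<in> borel_measurable borel" using meas by (simp add: D_def)
  have Dm2: "(\<lambda>v. \<bar>det (matrix (G' v))\<bar> * indicator S' v) = (\<lambda>v. (\<lambda>x. D x * indicator S x) (to_plane v))"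
    by (auto simp: detG S'_def indicator_def)
  have "emeasure lborel (G ` S') = (\<integral>\<^sup>+x\<in>S'. ennreal \<bar>det (matrix (G' x))\<bar> \<partial>lborel)"
  proof (rule emeasure_injective_image_real2)
    show "(G has_derivative G' v) (at v within S')" if "v \<in> S'" for v
    proof -
      have "to_plane v \<in> S" using that S'S by auto
      then have d: "(g has_derivative (\<lambda>h. fst h *\<^sub>R a (to_plane v) + snd h *\<^sub>R b (to_plane v))) (at (to_plane v) within to_plane ` S')"
        by (intro has_derivative_subset[OF der S'S])
      have "((\<lambda>v. g (to_plane v)) has_derivative (\<lambda>h. (\<lambda>h. fst h *\<^sub>R a (to_plane v) + snd h *\<^sub>R b (to_plane v)) (to_plane h))) (at v within S')"
        by (rule has_derivative_in_compose[OF bounded_linear_imp_has_derivative[OF bounded_linear_to_plane] d])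
      from bounded_linear.has_derivative[OF bounded_linear_of_plane this]
      show ?thesis unfolding G_def G'_def .
    qed
    show "inj_on G S'" unfolding inj_on_def G_def
      by (metis S'S image_subset_iff inj inj_onD to_of_plane)
    show "(\<lambda>x. \<bar>det (matrix (G' x))\<bar> * indicator S' x) \<in> borel_measurable borel"
      unfolding Dm2 by measurable
  qed (auto simp: GS'm)
  also have "\<dots> = (\<integral>\<^sup>+v. ennreal ((\<lambda>x. D x * indicator S x) (to_plane v)) \<partial>lborel)"
    by (intro nn_integral_cong) (auto simp: detG S'_def indicator_def)
  also have "\<dots> = (\<integral>\<^sup>+x. ennreal (D x * indicator S x) \<partial>lborel)"
    by (subst lborel_real2_eq, subst nn_integral_distr) auto
  also have "\<dots> = (\<integral>\<^sup>+x\<in>S. ennreal (D x) \<partial>lborel)"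
    by (intro nn_integral_cong) (auto simp: indicator_def)
  finally have "emeasure lborel (G ` S') = (\<integral>\<^sup>+x\<in>S. ennreal (D x) \<partial>lborel)" .
  moreover have "emeasure lborel (G ` S') = emeasure lborel (g ` S)"
    by (subst lborel_real2_eq, subst emeasure_distr) (auto simp: G'S vimage_def intro: arg_cong[where f="emeasure lborel"])
  ultimately show ?thesis by (simp add: D_def)
qed

section \<open>Transition maps\<close>

text \<open>Only continuity of \<open>h\<close> is assumed, and \<psi> may map into a larger space.
  Expanding both sides of \<phi> = \<psi> o h to first order and applying the left inverse
  \<open>l\<close> solves for the increment of \<open>h\<close>. It serves transition maps of charts
  and reparametrizations of edges.\<close>

lemma has_derivative_left_inverse_factor:
  fixes h :: "'a::real_normed_vector \<Rightarrow> 'b::real_normed_vector" and \<psi> :: "'b \<Rightarrow> 'c::real_normed_vector"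
  assumes h: "continuous (at u) h" and \<psi>: "(\<psi> has_derivative \<psi>') (at (h u))"
    and l: "bounded_linear l" "\<And>x. l (\<psi>' x) = x"
    and \<phi>: "(\<phi> has_derivative \<phi>') (at u)" and A: "open A" "u \<in> A" "\<And>z. z \<in> A \<Longrightarrow> \<phi> z = \<psi> (h z)"
  shows "(h has_derivative (\<lambda>x. l (\<phi>' x))) (at u)"
proof -
  obtain K where K: "K > 0" "\<And>x. norm (l x) \<le> norm x * K" using bounded_linear.pos_bounded[OF l(1)] by blast
  have lin': "linear \<psi>'" "bounded_linear \<phi>'" using \<psi> \<phi> has_derivative_bounded_linear
    by (blast dest: bounded_linear.linear)+
  obtain B where B: "B > 0" "\<And>x. norm (\<phi>' x) \<le> norm x * B" using bounded_linear.pos_bounded[OF lin'(2)] by blast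
  have bl: "bounded_linear (\<lambda>x. l (\<phi>' x))" using bounded_linear_compose[OF l(1) lin'(2)] .
  show ?thesis unfolding has_derivative_at_alt
  proof (intro conjI bl allI impI)
    fix e :: real assume e: "e > 0"
    \<comment> \<open>The first bound makes the error e1 K |del| at most half of |del|, so that it
      can be absorbed; the second makes the same error at most e/2 times |z - u| once |del| is
      bounded.\<close>
    define e1 where "e1 = min (1 / (2 * K)) (e / (4 * K * K * (B + 1)))"
    define e2 where "e2 = min 1 (e / (2 * K))"
    have BK: "K * K * (B + 1) > 0" using K B by simp
    have e1: "e1 > 0" using e K BK by (simp add: e1_def zero_less_mult_iff)
    have e2: "e2 > 0" using e K by (simp add: e2_def)
    obtain d1 where d1: "d1 > 0" "\<And>y. norm (y - h u) < d1 \<Longrightarrow> norm (\<psi> y - \<psi> (h u) - \<psi>' (y - h u)) \<le> e1 * norm (y - h u)"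
      using \<psi> e1 unfolding has_derivative_at_alt by blast
    obtain d2 where d2: "d2 > 0" "\<And>z. norm (z - u) < d2 \<Longrightarrow> norm (\<phi> z - \<phi> u - \<phi>' (z - u)) \<le> e2 * norm (z - u)"
      using \<phi> e2 unfolding has_derivative_at_alt by blast
    obtain d3 where d3: "d3 > 0" "\<And>z. norm (z - u) < d3 \<Longrightarrow> norm (h z - h u) < d1"
      using h d1(1) unfolding continuous_at_eps_delta dist_norm by blast
    obtain d4 where d4: "d4 > 0" "\<And>z. norm (z - u) < d4 \<Longrightarrow> z \<in> A"
      using A unfolding open_dist dist_norm by blast
    show "\<exists>d>0. \<forall>y. norm (y - u) < d \<longrightarrow> norm (h y - h u - l (\<phi>' (y - u))) \<le> e * norm (y - u)"
    proof (intro exI conjI allI impI)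
      show "min d2 (min d3 d4) > 0" using d2 d3 d4 by auto
      fix z assume z: "norm (z - u) < min d2 (min d3 d4)"
      define del where "del = h z - h u"
      define r where "r = \<psi> (h z) - \<psi> (h u) - \<psi>' del"
      define r2 where "r2 = \<phi> z - \<phi> u - \<phi>' (z - u)"
      define n where "n = norm (z - u)"
      have n0: "n \<ge> 0" by (simp add: n_def)
      have r: "norm r \<le> e1 * norm del" unfolding r_def del_def using d1 d3 z by auto
      have r2: "norm r2 \<le> e2 * n" unfolding r2_def n_def using d2 z by auto
      have zA: "\<phi> z = \<psi> (h z)" "\<phi> u = \<psi> (h u)" using A d4 z by auto
      have "\<psi>' del = \<phi>' (z - u) + r2 - r" by (simp add: r_def r2_def zA)
      then have "del = l (\<phi>' (z - u) + r2 - r)" using l(2) by metis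
      then have del: "del = l (\<phi>' (z - u)) + l r2 - l r"
        using bounded_linear.linear[OF l(1)] by (simp add: linear_add linear_diff)
      have lr: "norm (l r) \<le> e1 * K * norm del"
      proof -
        have "norm (l r) \<le> norm r * K" by (rule K)
        also have "\<dots> \<le> e1 * norm del * K" using r K by (intro mult_right_mono) auto
        finally show ?thesis by (simp add: ac_simps)
      qed
      have lr2: "norm (l r2) \<le> e2 * K * n"
      proof -
        have "norm (l r2) \<le> norm r2 * K" by (rule K)
        also have "\<dots> \<le> e2 * n * K" using r2 K by (intro mult_right_mono) auto
        finally show ?thesis by (simp add: ac_simps)
      qed
      have lp: "norm (l (\<phi>' (z - u))) \<le> B * K * n"
      proof -
        have "norm (l (\<phi>' (z - u))) \<le> norm (\<phi>' (z - u)) * K" by (rule K)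
        also have "\<dots> \<le> (n * B) * K" using B(2) K unfolding n_def by (intro mult_right_mono) auto
        finally show ?thesis by (simp add: ac_simps)
      qed
      have e1K: "e1 * K \<le> 1/2"
      proof -
        have "e1 * K \<le> 1 / (2 * K) * K" using K by (intro mult_right_mono) (auto simp: e1_def)
        then show ?thesis using K by simp
      qed
      have "norm del \<le> norm (l (\<phi>' (z - u)) + l r2) + norm (l r)" unfolding del by (rule norm_triangle_ineq4)
      also have "\<dots> \<le> norm (l (\<phi>' (z - u))) + norm (l r2) + norm (l r)" using norm_triangle_ineq by simp
      also have "\<dots> \<le> B * K * n + e2 * K * n + e1 * K * norm del" using lr lr2 lp by simp
      also have "\<dots> \<le> B * K * n + 1 * K * n + 1/2 * norm del"
        using e1K K n0 by (intro add_mono mult_right_mono) (auto simp: e2_def)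
      \<comment> \<open>Half of |del| moves to the left: the increment of \<open>h\<close> is
        bounded linearly before its derivative is known.\<close>
      finally have del2: "norm del \<le> 2 * (B + 1) * K * n" by (simp add: algebra_simps)
      have e1e: "e1 * K * (2 * (B + 1) * K) \<le> e / 2"
      proof -
        have "0 < 4 * K * K * (B + 1)" using K B by simp
        then have "e1 * (4 * K * K * (B + 1)) \<le> e" by (simp add: e1_def pos_le_divide_eq[symmetric])
        then show ?thesis by (simp add: algebra_simps)
      qed
      have e2e: "e2 * K \<le> e / 2"
      proof -
        have "e2 * K \<le> e / (2 * K) * K" using K by (intro mult_right_mono) (auto simp: e2_def)
        then show ?thesis using K by simp
      qed
      have "norm (h z - h u - l (\<phi>' (z - u))) = norm (l r2 - l r)" using del by (simp add: del_def)
      also have "\<dots> \<le> norm (l r2) + norm (l r)" by (rule norm_triangle_ineq4)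
      also have "\<dots> \<le> e2 * K * n + e1 * K * norm del" using lr lr2 by simp
      also have "\<dots> \<le> e2 * K * n + e1 * K * (2 * (B + 1) * K * n)"
        using del2 e1 K by (intro add_left_mono mult_left_mono) auto
      also have "\<dots> = (e2 * K) * n + (e1 * K * (2 * (B + 1) * K)) * n" by (simp add: ac_simps)
      also have "\<dots> \<le> e / 2 * n + e / 2 * n" using e1e e2e n0 by (intro add_mono mult_right_mono) auto
      finally show "norm (h z - h u - l (\<phi>' (z - u))) \<le> e * norm (z - u)" by (simp add: n_def)
    qed
  qed
qed

definition jac :: "(plane \<Rightarrow> space) \<Rightarrow> plane \<Rightarrow> space" where
  "jac \<phi> u = cross3 (d_x \<phi> u) (d_y \<phi> u)"

lemma continuous_on_jac:
  assumes "smooth_on \<phi> U" shows "continuous_on U (jac \<phi>)"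
  unfolding jac_def
  by (intro continuous_on_cross smooth_on_continuous smooth_on_d_x smooth_on_d_y assms)

text \<open>The two parametrizations have the same tangent plane, so their normals
  \<open>jac\<close> differ by the determinant of the derivative of the transition map
  \<open>h\<close>.\<close>

lemma transition_derivative:
  fixes \<phi> \<psi> :: "plane \<Rightarrow> space"
  assumes \<phi>: "(\<phi> has_derivative (\<lambda>h. fst h *\<^sub>R d_x \<phi> u + snd h *\<^sub>R d_y \<phi> u)) (at u)"
    and \<psi>: "(\<psi> has_derivative (\<lambda>k. fst k *\<^sub>R d_x \<psi> (h u) + snd k *\<^sub>R d_y \<psi> (h u))) (at (h u))"
    and J: "jac \<psi> (h u) \<noteq> 0"
    and h: "continuous (at u) h" and A: "open A" "u \<in> A" "\<And>z. z \<in> A \<Longrightarrow> \<phi> z = \<psi> (h z)"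
  shows "\<exists>a b. (h has_derivative (\<lambda>k. fst k *\<^sub>R a + snd k *\<^sub>R b)) (at u) \<and>
     jac \<phi> u = (fst a * snd b - snd a * fst b) *\<^sub>R jac \<psi> (h u)"
proof -
  define p where "p = d_x \<psi> (h u)"
  define q where "q = d_y \<psi> (h u)"
  define J where "J = cross3 p q"
  have J0: "J \<bullet> J \<noteq> 0" using J by (simp add: J_def p_def q_def jac_def)
  \<comment> \<open>The coordinates with respect to p and q, read off with the dual basis; J itself
    goes to 0.\<close>
  define l where "l z = ((z \<bullet> cross3 q J) / (J \<bullet> J), (z \<bullet> cross3 J p) / (J \<bullet> J))" for z
  have bl: "bounded_linear l" unfolding l_def
    by (intro bounded_linear_Pair bounded_linear_divide[THEN bounded_linear_compose] bounded_linear_inner_left)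
  have c1: "p \<bullet> cross3 q J = J \<bullet> J" "q \<bullet> cross3 J p = J \<bullet> J"
    unfolding J_def using cross3_triple_cycle[of p q "cross3 p q"] by simp_all
  have c2: "q \<bullet> cross3 q J = 0" "p \<bullet> cross3 J p = 0" by (simp_all add: dot_cross_self)
  have lp: "l (fst k *\<^sub>R p + snd k *\<^sub>R q) = k" for k
    using c1 c2 J0 by (simp add: l_def inner_add_left)
  define a where "a = l (d_x \<phi> u)"
  define b where "b = l (d_y \<phi> u)"
  have "(h has_derivative (\<lambda>x. l (fst x *\<^sub>R d_x \<phi> u + snd x *\<^sub>R d_y \<phi> u))) (at u)"
    by (rule has_derivative_left_inverse_factor[OF h \<psi> bl _ \<phi> A]) (use lp in \<open>simp_all add: p_def q_def\<close>)
  moreover have "l (fst x *\<^sub>R d_x \<phi> u + snd x *\<^sub>R d_y \<phi> u) = fst x *\<^sub>R a + snd x *\<^sub>R b" for x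
    unfolding a_def b_def using bounded_linear.linear[OF bl] by (simp add: linear_add linear_cmul)
  ultimately have h': "(h has_derivative (\<lambda>k. fst k *\<^sub>R a + snd k *\<^sub>R b)) (at u)" by simp
  have "((\<lambda>z. \<psi> (h z)) has_derivative (\<lambda>k. (\<lambda>k. fst k *\<^sub>R p + snd k *\<^sub>R q) (fst k *\<^sub>R a + snd k *\<^sub>R b))) (at u)"
    by (rule has_derivative_compose[OF h']) (use \<psi> in \<open>simp add: p_def q_def\<close>)
  then have "(\<phi> has_derivative (\<lambda>k. (\<lambda>k. fst k *\<^sub>R p + snd k *\<^sub>R q) (fst k *\<^sub>R a + snd k *\<^sub>R b))) (at u)"
    by (rule has_derivative_transform_within_open[OF _ A(1,2)]) (use A in auto)
  from has_derivative_unique[OF \<phi> this]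
  have eq: "fst k *\<^sub>R d_x \<phi> u + snd k *\<^sub>R d_y \<phi> u = (\<lambda>k. fst k *\<^sub>R p + snd k *\<^sub>R q) (fst k *\<^sub>R a + snd k *\<^sub>R b)" for k
    by metis
  have "d_x \<phi> u = fst a *\<^sub>R p + snd a *\<^sub>R q" "d_y \<phi> u = fst b *\<^sub>R p + snd b *\<^sub>R q"
    using eq[of "(1,0)"] eq[of "(0,1)"] by simp_all
  then have "jac \<phi> u = (fst a * snd b - snd a * fst b) *\<^sub>R J"
    by (simp add: jac_def J_def cross_add_left cross_add_right cross_mult_left cross_mult_right)
       (simp add: cross_skew[of q p] scaleR_diff_left algebra_simps)
  with h' show ?thesis unfolding J_def p_def q_def jac_def by blast
qed

section \<open>The area measure of an embedded surface\<close>

definition patch_area :: "(plane \<Rightarrow> space) \<Rightarrow> plane set \<Rightarrow> space set \<Rightarrow> ennreal" where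
  "patch_area \<phi> U B = (\<integral>\<^sup>+u\<in>U. indicator B (\<phi> u) * ennreal (norm (jac \<phi> u)) \<partial>lborel)"

text \<open>Charts are controlled only on their domain; extension by 0 makes Borel functions on the
  whole plane out of them.\<close>

lemma borel_measurable_extend_0:
  fixes f :: "'a::topological_space \<Rightarrow> 'b::real_normed_vector"
  assumes "continuous_on U f" "U \<in> sets borel"
  shows "(\<lambda>u. if u \<in> U then f u else 0) \<in> borel_measurable borel"
  by (rule borel_measurable_continuous_on_if[OF assms(2,1)]) simp

lemma patch_density_measurable:
  assumes "smooth_on \<phi> U" "U \<in> sets borel" and [measurable]: "B \<in> sets borel"
  shows "(\<lambda>u. indicator B (\<phi> u) * ennreal (norm (jac \<phi> u)) * indicator U u) \<in> borel_measurable borel"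
proof -
  have [measurable]: "(\<lambda>u. if u \<in> U then \<phi> u else 0) \<in> borel_measurable borel"
    by (rule borel_measurable_extend_0[OF smooth_on_continuous[OF assms(1)] assms(2)])
  have [measurable]: "(\<lambda>u. if u \<in> U then jac \<phi> u else 0) \<in> borel_measurable borel"
    by (rule borel_measurable_extend_0[OF continuous_on_jac[OF assms(1)] assms(2)])
  have [measurable]: "U \<in> sets borel" by fact
  have "(\<lambda>u. indicator B (\<phi> u) * ennreal (norm (jac \<phi> u)) * indicator U u)
     = (\<lambda>u. indicator B (if u \<in> U then \<phi> u else 0) * ennreal (norm (if u \<in> U then jac \<phi> u else 0)) * indicator U u)"
    by (auto simp: fun_eq_iff)
  also have "\<dots> \<in> borel_measurable borel" by measurable
  finally show ?thesis .
qed

lemma local_param_homeomorphism: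
  assumes "local_param M \<phi> U"
  obtains \<psi> where "homeomorphism U (\<phi> ` U) \<phi> \<psi>"
  using assms unfolding local_param_def topological_embedding_on_def by blast

lemma local_param_inj_on: "local_param M \<phi> U \<Longrightarrow> inj_on \<phi> U"
  by (metis homeomorphism_apply1 inj_on_inverseI local_param_homeomorphism)

text \<open>The image of K is the preimage of K under the continuous inverse \<psi>, taken inside
  the image of U. The latter is Borel because U is a countable union of compact sets.\<close>

lemma homeomorphic_image_borel:
  fixes \<phi> :: "plane \<Rightarrow> space"
  assumes U: "open U" and h: "homeomorphism U (\<phi> ` U) \<phi> \<psi>" and K: "K \<in> sets borel" "K \<subseteq> U"
  shows "\<phi> ` K \<in> sets borel"
proof -
  obtain C where C: "\<And>n. compact (C n)" "\<And>n. C n \<subseteq> U" "\<Union> (range (C :: nat \<Rightarrow> _)) = U"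
    using open_Union_compact_subsets[OF U] by metis
  have "\<phi> ` U = (\<Union>n. \<phi> ` C n)" using C(3) by blast
  moreover have "compact (\<phi> ` C n)" for n
    by (rule compact_continuous_image[OF continuous_on_subset[OF homeomorphism_cont1[OF h] C(2)] C(1)])
  ultimately have [measurable]: "\<phi> ` U \<in> sets borel"
    using borel_compact by (simp, intro sets.countable_UN) blast
  have [measurable]: "(\<lambda>p. if p \<in> \<phi> ` U then \<psi> p else 0) \<in> borel_measurable borel"
    by (rule borel_measurable_extend_0[OF homeomorphism_cont2[OF h]]) simp
  have "\<phi> ` K = \<phi> ` U \<inter> (\<lambda>p. if p \<in> \<phi> ` U then \<psi> p else 0) -` K"
  proof (intro equalityI subsetI)
    fix p assume "p \<in> \<phi> ` K"
    then obtain x where x: "x \<in> K" "x \<in> U" "p = \<phi> x" using K(2) by blast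
    then show "p \<in> \<phi> ` U \<inter> (\<lambda>p. if p \<in> \<phi> ` U then \<psi> p else 0) -` K"
      using homeomorphism_apply1[OF h, of x] by simp
  next
    fix p assume "p \<in> \<phi> ` U \<inter> (\<lambda>p. if p \<in> \<phi> ` U then \<psi> p else 0) -` K"
    then have "p \<in> \<phi> ` U" "\<psi> p \<in> K" by auto
    then show "p \<in> \<phi> ` K" using homeomorphism_apply2[OF h, of p] by (metis imageI)
  qed
  moreover have "(\<lambda>p. if p \<in> \<phi> ` U then \<psi> p else 0) -` K \<in> sets borel"
    using measurable_sets[of "\<lambda>p. if p \<in> \<phi> ` U then \<psi> p else 0" borel borel K] K by simp
  ultimately show ?thesis by simp
qed

lemma local_param_image_borel:
  assumes "local_param M \<phi> U" "K \<in> sets borel" "K \<subseteq> U"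
  shows "\<phi> ` K \<in> sets borel"
  using local_param_homeomorphism[OF assms(1)] homeomorphic_image_borel assms
  unfolding local_param_def by metis

text \<open>Area does not depend on the chart: the transition map \<open>h\<close> carries the
  measure with density \<open>D\<close>, its absolute Jacobian determinant, to Lebesgue measure on
  the other overlap, and |jac \<phi>| is \<open>D\<close> times |jac \<psi>| at
  \<open>h\<close>.\<close>

lemma transition_area:
  assumes \<phi>: "local_param M \<phi> U" and \<psi>: "local_param M \<psi> V" and B[measurable]: "B \<in> sets borel"
  shows "patch_area \<phi> U (B \<inter> \<psi> ` V) = patch_area \<psi> V (B \<inter> \<phi> ` U)"
proof -
  note lp = \<phi>[unfolded local_param_def] \<psi>[unfolded local_param_def]
  obtain \<psi>i where \<psi>i: "homeomorphism V (\<psi> ` V) \<psi> \<psi>i" by (rule local_param_homeomorphism[OF \<psi>])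
  have [measurable]: "U \<in> sets borel" "V \<in> sets borel" using lp by auto
  have [measurable]: "\<phi> ` U \<in> sets borel" "\<psi> ` V \<in> sets borel"
    using local_param_image_borel[OF \<phi>, of U] local_param_image_borel[OF \<psi>, of V] by auto
  have M: "\<phi> ` U \<subseteq> M" "\<psi> ` V \<subseteq> M" using lp openin_imp_subset by blast+
  define A where "A = U \<inter> \<phi> -` (\<psi> ` V)"
  have "openin (top_of_set U) (U \<inter> \<phi> -` (\<psi> ` V))"
    by (rule continuous_openin_preimage[of _ _ M]) (use lp M smooth_on_continuous in auto)
  then have A: "open A" using lp by (auto simp: A_def openin_open_eq)
  define h where "h u = (if u \<in> A then \<psi>i (\<phi> u) else 0)" for u
  have hA: "h u \<in> V" "\<psi> (h u) = \<phi> u" if "u \<in> A" for u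
    using that homeomorphism_apply2[OF \<psi>i, of "\<phi> u"] homeomorphism_image2[OF \<psi>i] by (auto simp: h_def A_def)
  have conth: "continuous_on A h"
  proof -
    have "continuous_on A (\<lambda>u. \<psi>i (\<phi> u))"
      by (rule continuous_on_compose2[OF homeomorphism_cont2[OF \<psi>i]])
        (use lp in \<open>auto simp: A_def intro: continuous_on_subset[OF smooth_on_continuous]\<close>)
    then show ?thesis by (simp add: h_def cong: continuous_on_cong)
  qed
  have [measurable]: "h \<in> borel_measurable borel"
  proof -
    have "(\<lambda>u. if u \<in> A then h u else 0) \<in> borel_measurable borel"
      using borel_measurable_extend_0[OF conth] A by auto
    also have "(\<lambda>u. if u \<in> A then h u else 0) = h" by (auto simp: h_def fun_eq_iff)
    finally show ?thesis .
  qed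
  have [measurable]: "A \<in> sets borel" using A by auto
  have injh: "inj_on h A"
    by (metis (no_types, lifting) A_def IntD1 hA(2) inj_onD inj_onI local_param_inj_on[OF \<phi>])
  define A' where "A' = V \<inter> \<psi> -` (\<phi> ` U)"
  have hA': "h ` A = A'"
  proof (intro equalityI subsetI)
    fix w assume "w \<in> h ` A" then show "w \<in> A'" using hA by (force simp: A'_def A_def)
  next
    fix w assume w: "w \<in> A'"
    then obtain u where u: "u \<in> U" "\<psi> w = \<phi> u" by (auto simp: A'_def)
    then have uA: "u \<in> A" using w by (simp add: A_def A'_def) (metis imageI)
    moreover have "h u = w" using uA u w homeomorphism_apply1[OF \<psi>i, of w] by (simp add: h_def A'_def)
    ultimately show "w \<in> h ` A" by blast
  qed
  have "openin (top_of_set V) (V \<inter> \<psi> -` (\<phi> ` U))"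
    by (rule continuous_openin_preimage[of _ _ M]) (use lp M smooth_on_continuous in auto)
  then have A': "open A'" using lp by (auto simp: A'_def openin_open_eq)
  then have [measurable]: "A' \<in> sets borel" by auto
  have J0: "jac \<psi> w \<noteq> 0" if "w \<in> V" for w using lp that by (auto simp: immersion_on_def jac_def)
  have tr: "\<exists>a b. (h has_derivative (\<lambda>k. fst k *\<^sub>R a + snd k *\<^sub>R b)) (at u) \<and>
     jac \<phi> u = (fst a * snd b - snd a * fst b) *\<^sub>R jac \<psi> (h u)" if u: "u \<in> A" for u
  proof (rule transition_derivative[OF _ _ _ _ A u])
    show "continuous (at u) h" using conth A u by (simp add: continuous_on_eq_continuous_at)
    show "(\<phi> has_derivative (\<lambda>h. fst h *\<^sub>R d_x \<phi> u + snd h *\<^sub>R d_y \<phi> u)) (at u)"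
      by (rule smooth_on_has_derivative_plane) (use lp u in \<open>auto simp: A_def\<close>)
    show "(\<psi> has_derivative (\<lambda>k. fst k *\<^sub>R d_x \<psi> (h u) + snd k *\<^sub>R d_y \<psi> (h u))) (at (h u))"
      by (rule smooth_on_has_derivative_plane) (use lp hA[OF u] in auto)
  qed (use hA J0 u in simp_all)
  define R where "R u p \<longleftrightarrow> (h has_derivative (\<lambda>k. fst k *\<^sub>R fst p + snd k *\<^sub>R snd p)) (at u) \<and>
     jac \<phi> u = (fst (fst p) * snd (snd p) - snd (fst p) * fst (snd p)) *\<^sub>R jac \<psi> (h u)" for u and p :: "plane \<times> plane"
  have "\<exists>p. R u p" if uA: "u \<in> A" for u
  proof -
    obtain a b where "(h has_derivative (\<lambda>k. fst k *\<^sub>R a + snd k *\<^sub>R b)) (at u)"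
      "jac \<phi> u = (fst a * snd b - snd a * fst b) *\<^sub>R jac \<psi> (h u)" using tr[OF uA] by blast
    then have "R u (a, b)" unfolding R_def fst_conv snd_conv by blast
    then show ?thesis ..
  qed
  then have "\<forall>u\<in>A. \<exists>p. R u p" by blast
  from bchoice[OF this] obtain pp where pp: "\<forall>u\<in>A. R u (pp u)" ..
  define a where "a u = fst (pp u)" for u
  define b where "b u = snd (pp u)" for u
  have ab: "(h has_derivative (\<lambda>k. fst k *\<^sub>R a u + snd k *\<^sub>R b u)) (at u)"
     "jac \<phi> u = (fst (a u) * snd (b u) - snd (a u) * fst (b u)) *\<^sub>R jac \<psi> (h u)" if "u \<in> A" for u
    using pp that unfolding R_def a_def b_def by blast+
  define D where "D u = \<bar>fst (a u) * snd (b u) - snd (a u) * fst (b u)\<bar>" for u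
  have D: "norm (jac \<phi> u) = D u * norm (jac \<psi> (h u))" if "u \<in> A" for u using ab(2)[OF that] by (simp only: D_def norm_scaleR)
  \<comment> \<open>\<open>a\<close> and \<open>b\<close> come from a choice, so measurability of
    \<open>D\<close> is read off from this quotient of continuous functions.\<close>
  have "continuous_on A (\<lambda>u. norm (jac \<phi> u) / norm (jac \<psi> (h u)))"
  proof (intro continuous_intros)
    show "continuous_on A (jac \<phi>)" using continuous_on_jac[of \<phi> U] lp by (auto simp: A_def intro: continuous_on_subset)
    show "continuous_on A (\<lambda>u. jac \<psi> (h u))"
      by (rule continuous_on_compose2[OF continuous_on_jac conth]) (use lp hA in auto)
  qed (use J0 hA in auto)
  then have "continuous_on A D"
  proof (rule continuous_on_eq)
    fix u assume u: "u \<in> A"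
    show "norm (jac \<phi> u) / norm (jac \<psi> (h u)) = D u"
      using D[OF u] J0[OF hA(1)[OF u]] by simp
  qed
  then have [measurable]: "(\<lambda>u. D u * indicator A u) \<in> borel_measurable borel"
    using borel_measurable_continuous_on_indicator[of A D] by (simp add: mult.commute)
  have DA[measurable]: "(\<lambda>u. ennreal (D u) * indicator A u) \<in> borel_measurable borel"
  proof -
    have "(\<lambda>u. ennreal (D u) * indicator A u) = (\<lambda>u. ennreal (D u * indicator A u))"
      by (auto simp: indicator_def fun_eq_iff)
    then show ?thesis by simp
  qed
  \<comment> \<open>Change of variables for all Borel sets C at once, stated as an equality of
    measures so that it applies to the integrand \<open>F\<close> below.\<close>
  have eqm: "distr (density lborel (\<lambda>u. ennreal (D u) * indicator A u)) borel h = density lborel (indicator A')"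
  proof (rule measure_eqI)
    fix C assume "C \<in> sets (distr (density lborel (\<lambda>u. ennreal (D u) * indicator A u)) borel h)"
    then have C[measurable]: "C \<in> sets borel" by simp
    define S where "S = A \<inter> h -` C"
    have S[measurable]: "S \<in> sets borel" unfolding S_def using measurable_sets[of h borel borel C] by simp
    have hS: "h ` S = A' \<inter> C" using hA' by (auto simp: S_def)
    have "emeasure (density lborel (indicator A')) C = emeasure lborel (A' \<inter> C)"
      by (subst emeasure_density) (auto simp flip: indicator_inter_arith)
    also have "\<dots> = (\<integral>\<^sup>+u\<in>S. ennreal (D u) \<partial>lborel)"
      unfolding hS[symmetric] D_def
    proof (rule emeasure_injective_image_plane[OF S])
      show "(h has_derivative (\<lambda>k. fst k *\<^sub>R a x + snd k *\<^sub>R b x)) (at x within S)" if "x \<in> S" for x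
        using ab(1)[of x] that by (auto simp: S_def intro: has_derivative_at_withinI)
      show "inj_on h S" using injh by (rule inj_on_subset) (auto simp: S_def)
      show "h ` S \<in> sets borel" unfolding hS by simp
      have "(\<lambda>x. D x * indicator S x) = (\<lambda>x. (D x * indicator A x) * indicator S x)"
        by (auto simp: S_def indicator_def)
      also have "\<dots> \<in> borel_measurable borel" by measurable
      finally show "(\<lambda>x. \<bar>fst (a x) * snd (b x) - snd (a x) * fst (b x)\<bar> * indicator S x) \<in> borel_measurable borel"
        by (simp add: D_def)
    qed
    also have "\<dots> = emeasure (density lborel (\<lambda>u. ennreal (D u) * indicator A u)) (h -` C)"
    proof -
      have "emeasure (density lborel (\<lambda>u. ennreal (D u) * indicator A u)) (h -` C)
        = (\<integral>\<^sup>+u. ennreal (D u) * indicator A u * indicator (h -` C) u \<partial>lborel)"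
        by (rule emeasure_density) (use DA measurable_sets[of h borel borel C] in simp_all)
      also have "\<dots> = (\<integral>\<^sup>+u\<in>S. ennreal (D u) \<partial>lborel)"
        by (intro nn_integral_cong) (auto simp: S_def indicator_def)
      finally show ?thesis ..
    qed
    also have "\<dots> = emeasure (distr (density lborel (\<lambda>u. ennreal (D u) * indicator A u)) borel h) C"
      by (subst emeasure_distr) auto
    finally show "emeasure (distr (density lborel (\<lambda>u. ennreal (D u) * indicator A u)) borel h) C = emeasure (density lborel (indicator A')) C" ..
  qed simp
  define F where "F w = indicator B (\<psi> w) * ennreal (norm (jac \<psi> w)) * indicator V w" for w
  have Fm[measurable]: "F \<in> borel_measurable borel"
    unfolding F_def by (rule patch_density_measurable) (use lp in auto)
  have "patch_area \<psi> V (B \<inter> \<phi> ` U) = (\<integral>\<^sup>+w. indicator A' w * F w \<partial>lborel)"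
    unfolding patch_area_def F_def
    by (intro nn_integral_cong) (auto simp: A'_def indicator_def)
  also have "\<dots> = (\<integral>\<^sup>+w. F w \<partial>density lborel (indicator A'))"
    by (subst nn_integral_density) auto
  also have "\<dots> = (\<integral>\<^sup>+w. F w \<partial>distr (density lborel (\<lambda>u. ennreal (D u) * indicator A u)) borel h)"
    by (simp only: eqm)
  also have "\<dots> = (\<integral>\<^sup>+u. ennreal (D u) * indicator A u * F (h u) \<partial>lborel)"
    by (subst nn_integral_distr) (auto simp: nn_integral_density)
  also have "\<dots> = patch_area \<phi> U (B \<inter> \<psi> ` V)"
    unfolding patch_area_def
  proof (intro nn_integral_cong)
    fix u :: plane
    show "ennreal (D u) * indicator A u * F (h u) = indicator (B \<inter> \<psi> ` V) (\<phi> u) * ennreal (norm (jac \<phi> u)) * indicator U u"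
    proof (cases "u \<in> A")
      case True
      then show ?thesis using hA[OF True] D[OF True]
        by (auto simp: F_def A_def indicator_def ennreal_mult' D_def)
    next
      case False
      then show ?thesis by (auto simp: A_def indicator_def)
    qed
  qed
  finally show ?thesis ..
qed

lemma patch_area_subset_eq:
  assumes "inj_on \<phi> U" "K \<subseteq> U"
  shows "patch_area \<phi> U (B \<inter> \<phi> ` K) = patch_area \<phi> K B"
  unfolding patch_area_def
  by (intro nn_integral_cong) (use assms in \<open>auto simp: indicator_def inj_on_def\<close>)

lemma patch_area_suminf:
  assumes "smooth_on \<phi> U" "U \<in> sets borel" "range A \<subseteq> sets borel" "disjoint_family A"
  shows "(\<Sum>i. patch_area \<phi> U (A i)) = patch_area \<phi> U (\<Union>i. A i)"
proof -
  have "(\<Sum>i. patch_area \<phi> U (A i)) = (\<integral>\<^sup>+u. (\<Sum>i. indicator (A i) (\<phi> u) * ennreal (norm (jac \<phi> u)) * indicator U u) \<partial>lborel)"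
    unfolding patch_area_def
    by (subst nn_integral_suminf) (use patch_density_measurable[OF assms(1,2)] assms(3) in auto)
  also have "\<dots> = patch_area \<phi> U (\<Union>i. A i)"
    unfolding patch_area_def
    by (intro nn_integral_cong) (simp add: suminf_indicator[OF assms(4)])
  finally show ?thesis .
qed

lemma C_k_empty: "C_k k f {}"
  by (induction k arbitrary: f) auto

lemma area_measure_exists:
  assumes M: "embedded_surface M"
  obtains \<mu> where "sets \<mu> = sets borel" "emeasure \<mu> UNIV \<le> surface_area M" "M \<in> sets borel" "emeasure \<mu> (- M) = 0"
    "\<And>\<phi> U B. local_param M \<phi> U \<Longrightarrow> B \<in> sets borel \<Longrightarrow> emeasure \<mu> (B \<inter> \<phi> ` U) = patch_area \<phi> U B"
proof -
  define P where "P = {(\<phi>, U). local_param M \<phi> U}"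
  have empty: "((\<lambda>_. 0), {}) \<in> P"
    by (simp add: P_def local_param_def smooth_on_def immersion_on_def topological_embedding_on_def C_k_empty homeomorphism_def)
  obtain \<F> where \<F>: "\<F> \<subseteq> (\<lambda>(\<phi>,U). \<phi> ` U) ` P" "countable \<F>" "\<Union>\<F> = \<Union>((\<lambda>(\<phi>,U). \<phi> ` U) ` P)"
    by (rule Lindelof_openin[of "(\<lambda>(\<phi>,U). \<phi> ` U) ` P" M]) (auto simp: P_def local_param_def)
  have cov: "\<Union>\<F> = M" unfolding \<F>(3)
  proof (intro equalityI subsetI)
    fix p assume "p \<in> M"
    then obtain \<phi> U where "local_param M \<phi> U" "p \<in> \<phi> ` U" using M unfolding embedded_surface_def by blast
    then show "p \<in> \<Union>((\<lambda>(\<phi>,U). \<phi> ` U) ` P)" by (auto simp: P_def)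
  qed (auto simp: P_def local_param_def dest!: openin_imp_subset)
  \<comment> \<open>The empty chart keeps the family nonempty, so \<open>from_nat_into\<close>
    enumerates it even when M is empty.\<close>
  define G where "G = insert ({}::space set) \<F>"
  have G: "countable G" "G \<noteq> {}" "G \<subseteq> (\<lambda>(\<phi>,U). \<phi> ` U) ` P" using \<F> empty by (auto simp: G_def image_iff)
  define g where "g = from_nat_into G"
  have g: "g k \<in> G" for k unfolding g_def by (rule from_nat_into[OF G(2)])
  have "\<exists>\<phi> U. local_param M \<phi> U \<and> g k = \<phi> ` U" for k
  proof -
    have "g k \<in> (\<lambda>(\<phi>,U). \<phi> ` U) ` P" using g[of k] G(3) by blast
    then show ?thesis by (auto simp: P_def)
  qed
  then obtain \<phi> U where lp: "\<And>k. local_param M (\<phi> k) (U k)" and gk: "\<And>k. g k = \<phi> k ` U k" by metis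
  have "\<Union>(range g) = M" using cov G by (auto simp: g_def range_from_nat_into G_def)
  then have covM: "(\<Union>k. \<phi> k ` U k) = M" using gk by auto
  have Ub[measurable]: "U k \<in> sets borel" for k using lp[of k] by (auto simp: local_param_def)
  have gb[measurable]: "\<phi> k ` U k \<in> sets borel" for k by (rule local_param_image_borel[OF lp]) auto
  have Mb[measurable]: "M \<in> sets borel" unfolding covM[symmetric] by (intro sets.countable_UN) auto
  define Q where "Q k = disjointed (\<lambda>k. \<phi> k ` U k) k" for k
  have Qb[measurable]: "Q k \<in> sets borel" for k
  proof -
    have "range (disjointed (\<lambda>k. \<phi> k ` U k)) \<subseteq> sets borel"
      by (rule sets.range_disjointed_sets) (use gb in blast)
    then show ?thesis unfolding Q_def by blast
  qed
  have Qdisj: "disjoint_family Q" unfolding Q_def by (rule disjoint_family_disjointed)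
  have QM: "(\<Union>k. Q k) = M" unfolding Q_def by (simp add: UN_disjointed_eq covM)
  have Qsub: "Q k \<subseteq> \<phi> k ` U k" for k unfolding Q_def by (rule disjointed_subset)
  define K where "K k = U k \<inter> (\<phi> k) -` Q k" for k
  have KU: "K k \<subseteq> U k" for k by (auto simp: K_def)
  have \<phi>K: "\<phi> k ` K k = Q k" for k using Qsub[of k] by (auto simp: K_def)
  have Kb[measurable]: "K k \<in> sets borel" for k
  proof -
    have "(\<lambda>u. if u \<in> U k then \<phi> k u else 0) \<in> borel_measurable borel"
      by (rule borel_measurable_extend_0[OF smooth_on_continuous]) (use lp in \<open>auto simp: local_param_def\<close>)
    from measurable_sets[OF this Qb[of k]] have "(\<lambda>u. if u \<in> U k then \<phi> k u else 0) -` Q k \<in> sets borel" by simp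
    moreover have "K k = U k \<inter> (\<lambda>u. if u \<in> U k then \<phi> k u else 0) -` Q k" by (auto simp: K_def)
    ultimately show ?thesis by simp
  qed
  have smK: "smooth_on (\<phi> k) (K k)" for k using lp[of k] KU[of k] by (auto simp: local_param_def intro: smooth_on_subset)
  define m where "m B = (\<Sum>k. patch_area (\<phi> k) (K k) B)" for B
  define \<mu> where "\<mu> = measure_of UNIV (sets borel) m"
  have sets\<mu>[simp]: "sets \<mu> = sets borel" and [simp]: "space \<mu> = UNIV"
    using sets.sigma_sets_eq[of borel] by (simp_all add: \<mu>_def sets_measure_of space_measure_of)
  have em: "emeasure \<mu> B = m B" if B: "B \<in> sets borel" for B
  proof (rule emeasure_measure_of[OF \<mu>_def])
    show "positive (sets \<mu>) m" by (simp add: positive_def m_def patch_area_def)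
    show "countably_additive (sets \<mu>) m"
    proof (rule countably_additiveI)
      fix A :: "nat \<Rightarrow> space set" assume A: "range A \<subseteq> sets \<mu>" "disjoint_family A" "\<Union>(range A) \<in> sets \<mu>"
      \<comment> \<open>The two sums are exchanged by reading the one over k as an integral for
        counting measure.\<close>
      have "(\<Sum>i. m (A i)) = (\<Sum>i. \<integral>\<^sup>+k. patch_area (\<phi> k) (K k) (A i) \<partial>count_space UNIV)"
        by (simp add: m_def nn_integral_count_space_nat)
      also have "\<dots> = (\<integral>\<^sup>+k. (\<Sum>i. patch_area (\<phi> k) (K k) (A i)) \<partial>count_space UNIV)"
        by (subst nn_integral_suminf) auto
      also have "\<dots> = (\<integral>\<^sup>+k. patch_area (\<phi> k) (K k) (\<Union>i. A i) \<partial>count_space UNIV)"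
        using A by (intro nn_integral_cong patch_area_suminf smK) auto
      finally show "(\<Sum>i. m (A i)) = m (\<Union>i. A i)" by (simp add: m_def nn_integral_count_space_nat)
    qed
  qed (use B in auto)
  show ?thesis
  proof
    have "emeasure \<mu> UNIV = (\<Sum>k. patch_area (\<phi> k) (K k) UNIV)" by (simp add: em m_def)
    also have "\<dots> = (SUP n. \<Sum>k<n. patch_area (\<phi> k) (K k) UNIV)" by (rule suminf_eq_SUP)
    also have "\<dots> \<le> surface_area M"
    proof (rule SUP_least)
      fix n :: nat
      have "(\<Sum>k<n. patch_area (\<phi> k) (K k) UNIV) = (\<Sum>i<n. \<integral>\<^sup>+u\<in>K i. ennreal (norm (cross3 (d_x (\<phi> i) u) (d_y (\<phi> i) u))) \<partial>lborel)"
        by (simp add: patch_area_def jac_def)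
      also have "\<dots> \<le> surface_area M"
        unfolding surface_area_def
      proof (rule Sup_upper, rule CollectI, intro exI conjI)
        show "\<forall>i<n. K i \<in> sets borel \<and> (\<exists>U. local_param M (\<phi> i) U \<and> K i \<subseteq> U)"
          using Kb lp KU by blast
        show "disjoint_family_on (\<lambda>i. \<phi> i ` K i) {..<n}"
          using Qdisj by (auto simp: \<phi>K disjoint_family_on_def)
      qed simp
      finally show "(\<Sum>k<n. patch_area (\<phi> k) (K k) UNIV) \<le> surface_area M" .
    qed
    finally show "emeasure \<mu> UNIV \<le> surface_area M" .
    have "patch_area (\<phi> k) (K k) (- M) = 0" for k
    proof -
      have "\<phi> k u \<in> M" if "u \<in> K k" for u using that QM by (auto simp: K_def)
      then have z: "indicator (- M) (\<phi> k u) * ennreal (norm (jac (\<phi> k) u)) * indicator (K k) u = 0" for u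
        by (cases "u \<in> K k") simp_all
      show ?thesis unfolding patch_area_def z by simp
    qed
    then show "emeasure \<mu> (- M) = 0" by (simp add: em m_def)
    fix \<psi> V B assume \<psi>: "local_param M \<psi> V" and B[measurable]: "B \<in> sets (borel :: space measure)"
    have Vb[measurable]: "V \<in> sets borel" and \<psi>b[measurable]: "\<psi> ` V \<in> sets borel"
      using \<psi> local_param_image_borel[OF \<psi>, of V] by (auto simp: local_param_def)
    have "emeasure \<mu> (B \<inter> \<psi> ` V) = (\<Sum>k. patch_area (\<phi> k) (K k) (B \<inter> \<psi> ` V))" by (simp add: em m_def)
    also have "\<dots> = (\<Sum>k. patch_area \<psi> V (B \<inter> Q k))"
    proof (intro suminf_cong)
      fix k
      have "patch_area (\<phi> k) (K k) (B \<inter> \<psi> ` V) = patch_area (\<phi> k) (U k) ((B \<inter> Q k) \<inter> \<psi> ` V)"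
        using patch_area_subset_eq[OF local_param_inj_on[OF lp] KU, of k "B \<inter> \<psi> ` V"] by (simp add: \<phi>K Int_ac)
      also have "\<dots> = patch_area \<psi> V ((B \<inter> Q k) \<inter> \<phi> k ` U k)" by (rule transition_area[OF lp \<psi>]) simp
      also have "(B \<inter> Q k) \<inter> \<phi> k ` U k = B \<inter> Q k" using Qsub by blast
      finally show "patch_area (\<phi> k) (K k) (B \<inter> \<psi> ` V) = patch_area \<psi> V (B \<inter> Q k)" .
    qed
    also have "\<dots> = patch_area \<psi> V (\<Union>k. B \<inter> Q k)"
      by (rule patch_area_suminf) (use \<psi> Qdisj in \<open>auto simp: local_param_def disjoint_family_on_def\<close>)
    also have "\<dots> = patch_area \<psi> V B"
    proof -
      have "\<psi> u \<in> (\<Union>k. B \<inter> Q k) \<longleftrightarrow> \<psi> u \<in> B" if "u \<in> V" for u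
        using QM that \<psi> openin_imp_subset unfolding local_param_def by blast
      then show ?thesis unfolding patch_area_def
        by (intro nn_integral_cong) (auto simp: indicator_def)
    qed
    finally show "emeasure \<mu> (B \<inter> \<psi> ` V) = patch_area \<psi> V B" .
  qed (auto)
qed

section \<open>The divergence theorem on a half-plane\<close>

lemma integrable_bounded_support:
  fixes f :: "'a::euclidean_space \<Rightarrow> real"
  assumes [measurable]: "f \<in> borel_measurable borel" and B: "\<And>x. \<bar>f x\<bar> \<le> B" and K: "bounded K" "\<And>x. x \<notin> K \<Longrightarrow> f x = 0"
  shows "integrable lborel f"
proof -
  obtain a b where ab: "K \<subseteq> cbox a b" using K(1) bounded_subset_cbox_symmetric by blast
  show ?thesis
  proof (rule Bochner_Integration.integrable_bound[of _ "\<lambda>x. B * indicator (cbox a b) x"])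
    show "AE x in lborel. norm (f x) \<le> norm (B * indicator (cbox a b) x)"
    proof (rule AE_I2)
      fix x
      have "\<bar>f x\<bar> \<le> \<bar>B\<bar>" using B[of x] by linarith
      then show "norm (f x) \<le> norm (B * indicator (cbox a b) x)"
      proof (cases "x \<in> K")
        case True
        then have "x \<in> cbox a b" using ab by blast
        then show ?thesis using \<open>\<bar>f x\<bar> \<le> \<bar>B\<bar>\<close> by simp
      qed (simp add: K(2))
    qed
  qed (auto intro!: integrable_mult_right integrable_real_indicator emeasure_lborel_cbox_finite)
qed

lemma integral_plane_iterated:
  fixes f :: "plane \<Rightarrow> real"
  assumes "integrable lborel f"
  shows "(\<integral>u. f u \<partial>lborel) = (\<integral>x. (\<integral>y. f (x,y) \<partial>lborel) \<partial>lborel)"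
    and "(\<integral>u. f u \<partial>lborel) = (\<integral>y. (\<integral>x. f (x,y) \<partial>lborel) \<partial>lborel)"
  using lborel_pair.integral_fst'[of f] lborel_pair.integral_snd[of "\<lambda>x y. f (x,y)"] assms
  unfolding case_prod_eta lborel_prod by simp_all

text \<open>Fubini in both orders: a horizontal line contributes nothing because P vanishes at both
  of its ends, and the vertical ray from height c contributes -Q(x, c). The derivative of Q in y is
  taken within {c..}, hence one-sided on the boundary line.\<close>

lemma halfplane_divergence:
  fixes P Q Px Qy :: "plane \<Rightarrow> real" and c :: real
  defines "H \<equiv> {u :: plane. c \<le> snd u}"
  assumes cont: "continuous_on H Px" "continuous_on H Qy"
    and P: "\<And>x y. c \<le> y \<Longrightarrow> ((\<lambda>s. P (s, y)) has_real_derivative Px (x, y)) (at x)"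
    and Q: "\<And>x y. c \<le> y \<Longrightarrow> ((\<lambda>t. Q (x, t)) has_real_derivative Qy (x, y)) (at y within {c..})"
    and K: "compact K" "\<And>u. u \<in> H \<Longrightarrow> u \<notin> K \<Longrightarrow> P u = 0 \<and> Q u = 0 \<and> Px u = 0 \<and> Qy u = 0"
  shows "(\<integral>u. indicator H u * (Px u + Qy u) \<partial>lborel) = - (\<integral>x. Q (x, c) \<partial>lborel)"
proof -
  obtain L where L: "L > 0" "\<And>u. u \<in> K \<Longrightarrow> norm u < L"
    using compact_imp_bounded[OF K(1)] bounded_pos_less by blast
  have Hc: "closed H" unfolding H_def by (intro closed_Collect_le continuous_intros)
  then have [measurable]: "H \<in> sets borel" by auto
  have out: "P (x,y) = 0 \<and> Q (x,y) = 0 \<and> Px (x,y) = 0 \<and> Qy (x,y) = 0" if "c \<le> y" "L \<le> \<bar>x\<bar> \<or> L \<le> \<bar>y\<bar>" for x y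
  proof (rule K(2))
    show "(x,y) \<notin> K"
      using L(2)[of "(x,y)"] norm_fst_le[of x y] norm_snd_le[of y x] that(2) by auto
  qed (use that in \<open>auto simp: H_def\<close>)
  have meas: "(\<lambda>u. indicator H u * f u) \<in> borel_measurable borel" if "continuous_on H f" for f :: "plane \<Rightarrow> real"
    using borel_measurable_continuous_on_indicator[OF _ that] by simp
  have integ: "integrable lborel (\<lambda>u. indicator H u * f u)"
    if f: "continuous_on H f" "\<And>u. u \<in> H \<Longrightarrow> u \<notin> K \<Longrightarrow> f u = 0" for f :: "plane \<Rightarrow> real"
  proof -
    have "compact (f ` (H \<inter> K))"
      by (intro compact_continuous_image continuous_on_subset[OF f(1)] closed_Int_compact Hc K) auto
    then obtain B where B: "B > 0" "\<And>u. u \<in> H \<inter> K \<Longrightarrow> \<bar>f u\<bar> \<le> B"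
      using compact_imp_bounded[of "f ` (H \<inter> K)"] unfolding bounded_pos by auto
    show ?thesis
    proof (rule integrable_bounded_support[OF meas[OF f(1)]])
      show "\<bar>indicator H u * f u\<bar> \<le> B" for u
        using B(1) B(2)[of u] f(2)[of u] by (cases "u \<in> K") (auto simp: indicator_def)
      show "indicator H u * f u = 0" if "u \<notin> K" for u using f(2)[of u] that by (auto simp: indicator_def)
    qed (use K in \<open>simp add: compact_imp_bounded\<close>)
  qed
  have iP: "integrable lborel (\<lambda>u. indicator H u * Px u)" and iQ: "integrable lborel (\<lambda>u. indicator H u * Qy u)"
    by (intro integ cont; use K in auto)+
  have lineP: "(\<integral>x. indicator H (x,y) * Px (x,y) \<partial>lborel) = 0" for y
  proof (cases "c \<le> y")
    case True
    have "(\<integral>x. indicator H (x,y) * Px (x,y) \<partial>lborel) = (\<integral>x. indicator {-L..L} x *\<^sub>R Px (x,y) \<partial>lborel)"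
    proof (intro Bochner_Integration.integral_cong refl)
      fix x
      show "indicator H (x,y) * Px (x,y) = indicator {-L..L} x *\<^sub>R Px (x,y)"
        using out[OF True, of x] True by (cases "L \<le> \<bar>x\<bar>") (auto simp: indicator_def H_def)
    qed
    also have "\<dots> = P (L,y) - P (-L,y)"
    proof (rule integral_FTC_atLeastAtMost)
      show "continuous_on {-L..L} (\<lambda>x. Px (x,y))"
        by (rule continuous_on_compose2[OF cont(1)]) (auto intro!: continuous_intros simp: H_def True)
      show "((\<lambda>x. P (x,y)) has_vector_derivative Px (x,y)) (at x within {-L..L})" for x
        using P[OF True] by (auto simp: has_real_derivative_iff_has_vector_derivative[symmetric] intro: has_field_derivative_at_within)
    qed (use L in auto)
    also have "\<dots> = 0" using out[OF True, of L] out[OF True, of "-L"] L by simp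
    finally show ?thesis .
  qed (simp add: H_def)
  have lineQ: "(\<integral>y. indicator H (x,y) * Qy (x,y) \<partial>lborel) = - Q (x,c)" for x
  proof -
    \<comment> \<open>As c + \<bar>c\<bar> \<ge> 0 and L > 0, b lies above both c and L, whatever
      the sign of c.\<close>
    define b where "b = c + L + \<bar>c\<bar>"
    have b: "c \<le> b" "L \<le> b" using L by (auto simp: b_def)
    have "(\<integral>y. indicator H (x,y) * Qy (x,y) \<partial>lborel) = (\<integral>y. indicator {c..b} y *\<^sub>R Qy (x,y) \<partial>lborel)"
      using out b L by (intro Bochner_Integration.integral_cong refl) (auto simp: indicator_def H_def)
    also have "\<dots> = Q (x,b) - Q (x,c)"
    proof (rule integral_FTC_atLeastAtMost)
      show "continuous_on {c..b} (\<lambda>y. Qy (x,y))"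
        by (rule continuous_on_compose2[OF cont(2)]) (auto intro!: continuous_intros simp: H_def)
      show "((\<lambda>y. Q (x,y)) has_vector_derivative Qy (x,y)) (at y within {c..b})" if "c \<le> y" for y
      proof -
        have "((\<lambda>y. Q (x,y)) has_vector_derivative Qy (x,y)) (at y within {c..})"
          using Q[OF that] by (simp add: has_real_derivative_iff_has_vector_derivative)
        then show ?thesis by (rule has_vector_derivative_within_subset) auto
      qed
    qed (use b in auto)
    also have "\<dots> = - Q (x,c)" using out[of b x] b L by auto
    finally show ?thesis .
  qed
  have "(\<integral>u. indicator H u * Px u \<partial>lborel) = (\<integral>y. (\<integral>x. indicator H (x,y) * Px (x,y) \<partial>lborel) \<partial>lborel)"
    by (rule integral_plane_iterated(2)[OF iP])
  then have 1: "(\<integral>u. indicator H u * Px u \<partial>lborel) = 0" by (simp add: lineP)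
  have "(\<integral>u. indicator H u * Qy u \<partial>lborel) = (\<integral>x. (\<integral>y. indicator H (x,y) * Qy (x,y) \<partial>lborel) \<partial>lborel)"
    by (rule integral_plane_iterated(1)[OF iQ])
  then have 2: "(\<integral>u. indicator H u * Qy u \<partial>lborel) = - (\<integral>x. Q (x,c) \<partial>lborel)" by (simp add: lineQ)
  have "(\<integral>u. indicator H u * (Px u + Qy u) \<partial>lborel) = (\<integral>u. indicator H u * Px u + indicator H u * Qy u \<partial>lborel)"
    by (simp add: algebra_simps)
  also have "\<dots> = - (\<integral>x. Q (x,c) \<partial>lborel)" using 1 2 iP iQ by simp
  finally show ?thesis .
qed

lemma AE_snd_neq: "AE u :: plane in lborel. snd u \<noteq> c"
proof (rule AE_I')
  have "emeasure (lborel \<Otimes>\<^sub>M lborel) (UNIV \<times> {c::real} :: plane set) = 0"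
    by (subst lborel.emeasure_pair_measure_Times) auto
  then show "UNIV \<times> {c} \<in> null_sets (lborel :: plane measure)"
    by (auto simp: lborel_prod null_sets_def borel_prod[symmetric] intro!: pair_measureI)
qed auto

section \<open>First variation of a minimal patch\<close>

text \<open>\<open>C\<close> is an explicit compact set off which the field and its derivative
  vanish, so that localization reads C \<subseteq> W. Continuity of the derivative is stated vector
  by vector.\<close>

definition C1_field :: "(space \<Rightarrow> space) \<Rightarrow> (space \<Rightarrow> space \<Rightarrow> space) \<Rightarrow> space set \<Rightarrow> bool" where
  "C1_field X DX C \<longleftrightarrow> (\<forall>x. (X has_derivative DX x) (at x)) \<and> (\<forall>h. continuous_on UNIV (\<lambda>x. DX x h)) \<and>
     compact C \<and> (\<forall>x. x \<notin> C \<longrightarrow> X x = 0 \<and> DX x = (\<lambda>_. 0))"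

definition unit_normal :: "(plane \<Rightarrow> space) \<Rightarrow> plane \<Rightarrow> space" where
  "unit_normal \<phi> u = jac \<phi> u /\<^sub>R norm (jac \<phi> u)"

text \<open>The derivative of j / |j| when j has velocity j': the part of j' / |j| orthogonal to
  j.\<close>

definition normalize_deriv :: "space \<Rightarrow> space \<Rightarrow> space" where
  "normalize_deriv j j' = j' /\<^sub>R norm j - ((j \<bullet> j') / norm j ^ 3) *\<^sub>R j"

lemma normalize_has_vector_derivative:
  fixes j :: "real \<Rightarrow> space"
  assumes j: "(j has_vector_derivative j') (at s)" and 0: "j s \<noteq> 0"
  shows "((\<lambda>s. j s /\<^sub>R norm (j s)) has_vector_derivative normalize_deriv (j s) j') (at s)"
proof -
  have j1: "(j has_derivative (\<lambda>h. h *\<^sub>R j')) (at s)" using j by (simp add: has_vector_derivative_def)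
  have "((\<lambda>s. norm (j s)) has_derivative (\<lambda>h. sgn (j s) \<bullet> (h *\<^sub>R j'))) (at s)"
    by (rule has_derivative_compose[OF j1, of norm "\<lambda>y. sgn (j s) \<bullet> y"]) (use has_derivative_norm[OF 0] in \<open>simp add: inner_commute\<close>)
  then have n: "((\<lambda>s. norm (j s)) has_real_derivative (j s \<bullet> j') / norm (j s)) (at s)"
    by (rule has_derivative_imp_has_field_derivative) (simp add: sgn_div_norm divide_inverse)
  have "((\<lambda>s. inverse (norm (j s))) has_real_derivative - ((j s \<bullet> j') / norm (j s) ^ 3)) (at s)"
    by (rule DERIV_cong[OF DERIV_inverse'[OF n]]) (use 0 in \<open>auto simp: field_simps power3_eq_cube\<close>)
  from has_vector_derivative_scaleR[OF this j] show ?thesis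
    by (simp add: normalize_deriv_def algebra_simps)
qed

lemma normalize_deriv_orthogonal:
  "j \<noteq> 0 \<Longrightarrow> normalize_deriv j j' \<bullet> j = 0"
  unfolding normalize_deriv_def inner_diff_left inner_scaleR_left dot_square_norm
  by (simp add: power2_eq_square power3_eq_cube inner_commute field_simps)

lemma has_vector_derivative_cross3:
  assumes "(f has_vector_derivative f') (at s)" "(g has_vector_derivative g') (at s)"
  shows "((\<lambda>s. cross3 (f s) (g s)) has_vector_derivative cross3 (f s) g' + cross3 f' (g s)) (at s)"
proof -
  have "bounded_bilinear cross3" by (rule bilinear_conv_bounded_bilinear[THEN iffD1, OF bilinear_cross])
  from bounded_bilinear.has_vector_derivative[OF this assms] show ?thesis .
qed

text \<open>On the boundary of a half-plane patch this is the inward unit conormal times the speed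
  |\<phi>_x|, so integrating it in x is integrating the conormal by arc length.\<close>

definition conormal_term :: "(plane \<Rightarrow> space) \<Rightarrow> plane \<Rightarrow> space" where
  "conormal_term \<phi> u = cross3 (unit_normal \<phi> u) (d_x \<phi> u)"

lemma C1_field_continuous:
  assumes "C1_field X DX C"
  shows "continuous_on S X" "linear (DX x)" "continuous_on UNIV (\<lambda>x. DX x h)"
    "x \<notin> C \<Longrightarrow> X x = 0" "x \<notin> C \<Longrightarrow> DX x = (\<lambda>_. 0)"
proof -
  have d: "(X has_derivative DX y) (at y)" for y using assms by (simp add: C1_field_def)
  show "continuous_on S X" by (rule has_derivative_continuous_on[OF has_derivative_at_withinI[OF d]])
  show "linear (DX x)" by (rule has_derivative_linear[OF d])
qed (use assms in \<open>simp_all add: C1_field_def\<close>)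

text \<open>Continuity of \<open>DX\<close> is known only for fixed vectors, so the moving vector is
  expanded in the basis.\<close>

lemma C1_field_continuous_apply:
  assumes X: "C1_field X DX C" and f: "continuous_on S f" "continuous_on S g"
  shows "continuous_on S (\<lambda>u. DX (f u) (g u))"
proof -
  have e: "(\<lambda>u. DX (f u) (g u)) = (\<lambda>u. \<Sum>b\<in>Basis. (g u \<bullet> b) *\<^sub>R DX (f u) b)"
  proof (rule ext)
    fix u
    have l: "linear (DX (f u))" by (rule C1_field_continuous(2)[OF X])
    have "DX (f u) (g u) = DX (f u) (\<Sum>b\<in>Basis. (g u \<bullet> b) *\<^sub>R b)" by (simp only: euclidean_representation)
    also have "\<dots> = (\<Sum>b\<in>Basis. (g u \<bullet> b) *\<^sub>R DX (f u) b)"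
      by (simp only: linear_sum[OF l] linear_cmul[OF l])
    finally show "DX (f u) (g u) = (\<Sum>b\<in>Basis. (g u \<bullet> b) *\<^sub>R DX (f u) b)" .
  qed
  show ?thesis unfolding e
    by (intro continuous_intros f continuous_on_compose2[OF C1_field_continuous(3)[OF X] f(1)]) auto
qed

text \<open>With \<open>J = \<phi>\<^sub>x \<times> \<phi>\<^sub>y\<close>, \<open>N = J / |J|\<close> and \<open>Y = X \<circ> \<phi>\<close>, the integrand \<open>|J| div X\<close> equals
  \<open>(Y \<bullet> (\<phi>\<^sub>y \<times> N))\<^sub>x + (Y \<bullet> (N \<times> \<phi>\<^sub>x))\<^sub>y - Y \<bullet> (\<phi>\<^sub>y \<times> N\<^sub>x + N\<^sub>y \<times> \<phi>\<^sub>x)\<close>,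
  and the last bracket is the mean curvature vector up to a factor.\<close>

theorem patch_first_variation:
  fixes \<phi> :: "plane \<Rightarrow> space" and c :: real
  assumes U: "open U" and sm: "smooth_on \<phi> U" and im: "immersion_on \<phi> U"
    and X: "C1_field X DX C"
    and K: "compact {u \<in> U. c \<le> snd u \<and> \<phi> u \<in> C}"
    and H: "\<And>u. u \<in> U \<Longrightarrow> c < snd u \<Longrightarrow> mean_curvature_param \<phi> (unit_normal \<phi> u) u = 0"
  shows "(\<integral>u. indicator (U \<inter> {u. c < snd u}) u * (norm (jac \<phi> u) * tdiv (unit_normal \<phi> u) (DX (\<phi> u))) \<partial>lborel)
    = - (\<integral>x. indicator U (x, c) * (X (\<phi> (x, c)) \<bullet> conormal_term \<phi> (x, c)) \<partial>lborel)"
proof -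
  let ?K = "{u \<in> U. c \<le> snd u \<and> \<phi> u \<in> C}"
  define N where "N = unit_normal \<phi>"
  have J0: "jac \<phi> u \<noteq> 0" if "u \<in> U" for u using im that by (auto simp: immersion_on_def jac_def)
  define a where "a = d_x \<phi>"
  define b where "b = d_y \<phi>"
  have sab: "smooth_on a U" "smooth_on b U" using sm by (auto simp: a_def b_def smooth_on_d_x smooth_on_d_y)
  define Jx where "Jx u = cross3 (a u) (d_x b u) + cross3 (d_x a u) (b u)" for u
  define Jy where "Jy u = cross3 (a u) (d_y b u) + cross3 (d_y a u) (b u)" for u
  define Nx where "Nx u = normalize_deriv (jac \<phi> u) (Jx u)" for u
  define Ny where "Ny u = normalize_deriv (jac \<phi> u) (Jy u)" for u
  have J: "jac \<phi> u = cross3 (a u) (b u)" for u by (simp add: jac_def a_def b_def)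
  have dx: "((\<lambda>s. f (s,y)) has_vector_derivative d_x f (x,y)) (at x)"
   and dy: "((\<lambda>t. f (x,t)) has_vector_derivative d_y f (x,y)) (at y)"
    if "smooth_on f U" "(x,y) \<in> U" for f :: "plane \<Rightarrow> space" and x y
    using partial_has_vector_derivative[OF smooth_on_has_derivative_plane[OF that]] by simp_all
  have Nxd: "((\<lambda>s. N (s,y)) has_vector_derivative Nx (x,y)) (at x)"
   and Nyd: "((\<lambda>t. N (x,t)) has_vector_derivative Ny (x,y)) (at y)" if u: "(x,y) \<in> U" for x y
  proof -
    have "((\<lambda>s. jac \<phi> (s,y)) has_vector_derivative Jx (x,y)) (at x)"
      unfolding J Jx_def by (rule has_vector_derivative_cross3 dx sab u)+
    from normalize_has_vector_derivative[OF this J0[OF u]]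
    show "((\<lambda>s. N (s,y)) has_vector_derivative Nx (x,y)) (at x)" by (simp add: N_def unit_normal_def Nx_def)
    have "((\<lambda>t. jac \<phi> (x,t)) has_vector_derivative Jy (x,y)) (at y)"
      unfolding J Jy_def by (rule has_vector_derivative_cross3 dy sab u)+
    from normalize_has_vector_derivative[OF this J0[OF u]]
    show "((\<lambda>t. N (x,t)) has_vector_derivative Ny (x,y)) (at y)" by (simp add: N_def unit_normal_def Ny_def)
  qed
  have Yxd: "((\<lambda>s. X (\<phi> (s,y))) has_vector_derivative DX (\<phi> (x,y)) (a (x,y))) (at x)"
   and Yyd: "((\<lambda>t. X (\<phi> (x,t))) has_vector_derivative DX (\<phi> (x,y)) (b (x,y))) (at y)" if u: "(x,y) \<in> U" for x y
  proof -
    have XD: "(X has_derivative DX (\<phi> (x,y))) (at (\<phi> (x,y)))" using X by (simp add: C1_field_def)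
    show "((\<lambda>s. X (\<phi> (s,y))) has_vector_derivative DX (\<phi> (x,y)) (a (x,y))) (at x)"
      using has_derivative_compose[OF dx[OF sm u, unfolded has_vector_derivative_def] XD]
        linear_cmul[OF C1_field_continuous(2)[OF X]] by (simp add: has_vector_derivative_def a_def)
    show "((\<lambda>t. X (\<phi> (x,t))) has_vector_derivative DX (\<phi> (x,y)) (b (x,y))) (at y)"
      using has_derivative_compose[OF dy[OF sm u, unfolded has_vector_derivative_def] XD]
        linear_cmul[OF C1_field_continuous(2)[OF X]] by (simp add: has_vector_derivative_def b_def)
  qed
  define Pf where "Pf u = X (\<phi> u) \<bullet> cross3 (b u) (N u)" for u
  define Qf where "Qf u = X (\<phi> u) \<bullet> cross3 (N u) (a u)" for u
  define Pfx where "Pfx u = X (\<phi> u) \<bullet> (cross3 (b u) (Nx u) + cross3 (d_x b u) (N u)) + DX (\<phi> u) (a u) \<bullet> cross3 (b u) (N u)" for u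
  define Qfy where "Qfy u = X (\<phi> u) \<bullet> (cross3 (N u) (d_y a u) + cross3 (Ny u) (a u)) + DX (\<phi> u) (b u) \<bullet> cross3 (N u) (a u)" for u
  have Pd: "((\<lambda>s. Pf (s,y)) has_real_derivative Pfx (x,y)) (at x)" 
   and Qd: "((\<lambda>t. Qf (x,t)) has_real_derivative Qfy (x,y)) (at y)" if u: "(x,y) \<in> U" for x y
    unfolding has_real_derivative_iff_has_vector_derivative Pf_def Pfx_def Qf_def Qfy_def
    by (intro bounded_bilinear.has_vector_derivative[OF bounded_bilinear_inner] Yxd Yyd u has_vector_derivative_cross3 dx dy sab Nxd Nyd)+
  note cU = smooth_on_continuous[OF sm] smooth_on_continuous[OF sab(1)] smooth_on_continuous[OF sab(2)]
    smooth_on_continuous[OF smooth_on_d_x[OF sab(1)]] smooth_on_continuous[OF smooth_on_d_x[OF sab(2)]]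
    smooth_on_continuous[OF smooth_on_d_y[OF sab(1)]] smooth_on_continuous[OF smooth_on_d_y[OF sab(2)]]
  have cJ: "continuous_on U (jac \<phi>)" by (rule continuous_on_jac[OF sm])
  have cJxy: "continuous_on U Jx" "continuous_on U Jy"
    unfolding Jx_def Jy_def by (intro continuous_on_add continuous_on_cross cU)+
  have cN: "continuous_on U N" unfolding N_def unit_normal_def
    by (intro continuous_intros cJ) (use J0 in auto)
  have cNxy: "continuous_on U Nx" "continuous_on U Ny"
    unfolding Nx_def Ny_def normalize_deriv_def by (intro continuous_intros cJ cJxy; use J0 in auto)+
  have cX: "continuous_on U (\<lambda>u. X (\<phi> u))"
    by (rule continuous_on_compose2[OF C1_field_continuous(1)[OF X] cU(1)]) auto
  have cDX: "continuous_on U (\<lambda>u. DX (\<phi> u) (a u))" "continuous_on U (\<lambda>u. DX (\<phi> u) (b u))"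
    by (intro C1_field_continuous_apply[OF X] cU)+
  have cP: "continuous_on U Pfx" "continuous_on U Qfy"
    unfolding Pfx_def Qfy_def by (intro continuous_intros continuous_on_cross cU cX cDX cN cNxy)+
  \<comment> \<open>The chart lives on U, the divergence theorem on the whole half-plane. Extension
    by 0 stays regular because the functions already vanish on the part of U outside the compact set
    \<open>?K\<close>.\<close>
  define ex :: "(plane \<Rightarrow> real) \<Rightarrow> plane \<Rightarrow> real" where "ex f u = (if u \<in> U then f u else 0)" for f u
  let ?H = "{u :: plane. c \<le> snd u}"
  have z: "Pf u = 0 \<and> Qf u = 0 \<and> Pfx u = 0 \<and> Qfy u = 0" if "u \<in> U" "c \<le> snd u" "u \<notin> ?K" for u
  proof -
    have "\<phi> u \<notin> C" using that by auto
    then have "X (\<phi> u) = 0" "DX (\<phi> u) = (\<lambda>_. 0)" using C1_field_continuous(4,5)[OF X] by auto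
    then show ?thesis by (simp add: Pf_def Qf_def Pfx_def Qfy_def)
  qed
  have oK: "open (- ?K)" using K compact_imp_closed by auto
  have cex: "continuous_on ?H (ex f)" if f: "continuous_on U f" "\<And>u. u \<in> U \<Longrightarrow> c \<le> snd u \<Longrightarrow> u \<notin> ?K \<Longrightarrow> f u = 0" for f
  proof -
    have eq: "?H = (?H \<inter> U) \<union> (?H \<inter> - ?K)" by auto
    show ?thesis
    proof (subst eq, rule continuous_on_Un_local_open)
      show "openin (top_of_set (?H \<inter> U \<union> ?H \<inter> - ?K)) (?H \<inter> U)"
        unfolding eq[symmetric] using U by (simp add: openin_open_Int)
      show "openin (top_of_set (?H \<inter> U \<union> ?H \<inter> - ?K)) (?H \<inter> - ?K)"
        unfolding eq[symmetric] using oK by (rule openin_open_Int)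
      show "continuous_on (?H \<inter> U) (ex f)"
        by (rule continuous_on_eq[OF continuous_on_subset[OF f(1)]]) (auto simp: ex_def)
      show "continuous_on (?H \<inter> - ?K) (ex f)"
        by (rule continuous_on_eq[OF continuous_on_const[of _ 0]]) (use f(2) in \<open>auto simp: ex_def\<close>)
    qed
  qed
  have main: "(\<integral>u. indicator ?H u * (ex Pfx u + ex Qfy u) \<partial>lborel) = - (\<integral>x. ex Qf (x, c) \<partial>lborel)"
  proof (rule halfplane_divergence)
    show "continuous_on ?H (ex Pfx)" "continuous_on ?H (ex Qfy)" by (intro cex cP; use z in auto)+
    show "compact ?K" by (rule K)
    show "ex Pf u = 0 \<and> ex Qf u = 0 \<and> ex Pfx u = 0 \<and> ex Qfy u = 0" if "u \<in> ?H" "u \<notin> ?K" for u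
      using z[of u] that unfolding ex_def by auto
    fix x y assume y: "c \<le> y"
    show "((\<lambda>s. ex Pf (s, y)) has_real_derivative ex Pfx (x, y)) (at x)"
    proof (cases "(x,y) \<in> U")
      case True
      have "open ((\<lambda>s. (s,y)) -` (U))" by (intro open_vimage U continuous_intros)
      then have "open {s. (s,y) \<in> U}" by (simp only: vimage_def)
      then have "((\<lambda>s. ex Pf (s, y)) has_real_derivative Pfx (x, y)) (at x)"
        by (rule has_field_derivative_transform_within_open[OF Pd[OF True]]) (use True in \<open>auto simp: ex_def\<close>)
      then show ?thesis using True by (simp add: ex_def)
    next
      case False
      have "open ((\<lambda>s. (s,y)) -` (- ?K))" by (intro open_vimage oK continuous_intros)
      then have "open {s. (s,y) \<in> - ?K}" by (simp only: vimage_def)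
      then have "((\<lambda>s. ex Pf (s, y)) has_real_derivative 0) (at x)"
        by (rule has_field_derivative_transform_within_open[OF DERIV_const[of 0]]) (use False z y in \<open>auto simp: ex_def\<close>)
      then show ?thesis using False by (simp add: ex_def)
    qed
    show "((\<lambda>t. ex Qf (x, t)) has_real_derivative ex Qfy (x, y)) (at y within {c..})"
    proof (cases "(x,y) \<in> U")
      case True
      have "open ((\<lambda>t. (x,t)) -` (U))" by (intro open_vimage U continuous_intros)
      then have "open {t. (x,t) \<in> U}" by (simp only: vimage_def)
      then have "((\<lambda>t. ex Qf (x, t)) has_real_derivative Qfy (x, y)) (at y)"
        by (rule has_field_derivative_transform_within_open[OF Qd[OF True]]) (use True in \<open>auto simp: ex_def\<close>)
      then show ?thesis using True by (simp add: ex_def has_field_derivative_at_within)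
    next
      case False
      have "open ((\<lambda>t. (x,t)) -` (- ?K))" by (intro open_vimage oK continuous_intros)
      then have "open {t. (x,t) \<in> - ?K}" by (simp only: vimage_def)
      then obtain d where d: "d > 0" "\<And>t. dist t y < d \<Longrightarrow> (x,t) \<notin> ?K"
        unfolding open_dist using False by auto
      have "((\<lambda>t. 0) has_real_derivative 0) (at y within {c..})" by simp
      then have "((\<lambda>t. ex Qf (x, t)) has_real_derivative 0) (at y within {c..})"
        by (rule has_field_derivative_transform_within[OF _ d(1)]) (use y z d(2) in \<open>auto simp: ex_def\<close>)
      then show ?thesis using False by (simp add: ex_def)
    qed
  qed
  have pt: "Pfx u + Qfy u = norm (jac \<phi> u) * tdiv (N u) (DX (\<phi> u))" if u: "u \<in> U" and c: "c < snd u" for u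
  proof -
    let ?a = "a u" and ?b = "b u" and ?J = "jac \<phi> u" and ?A = "DX (\<phi> u)"
    have n0: "norm ?J > 0" using J0[OF u] by simp
    have mix: "d_x b u = d_y a u" unfolding a_def b_def by (rule mixed_partials_eq[OF sm U u])
    have JxJ: "Jx u \<bullet> ?a = - (d_x a u \<bullet> ?J)" "Jx u \<bullet> ?b = - (d_y a u \<bullet> ?J)"
         "Jy u \<bullet> ?a = - (d_y a u \<bullet> ?J)" "Jy u \<bullet> ?b = - (d_y b u \<bullet> ?J)"
      unfolding Jx_def Jy_def mix J by (simp_all add: cross3_simps)
    have Jab: "?J \<bullet> ?a = 0" "?J \<bullet> ?b = 0" unfolding J by (simp_all add: dot_cross_self)
    have Nw: "N u = (1 / norm ?J) *\<^sub>R ?J" by (simp add: N_def unit_normal_def divide_inverse)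
    \<comment> \<open>The correction term in \<open>normalize_deriv\<close> points along J and is
      invisible to tangent vectors.\<close>
    have nd: "normalize_deriv ?J j' \<bullet> w = (1 / norm ?J) * (j' \<bullet> w)" if "?J \<bullet> w = 0" for j' w
      using that by (simp add: normalize_deriv_def inner_diff_left divide_inverse)
    \<comment> \<open>Weingarten relations: a derivative of N paired with a tangent is minus a
      second derivative of \<phi> paired with N.\<close>
    have e: "Nx u \<bullet> ?a = - (d_x a u \<bullet> N u)" "Nx u \<bullet> ?b = - (d_y a u \<bullet> N u)"
       "Ny u \<bullet> ?a = - (d_y a u \<bullet> N u)" "Ny u \<bullet> ?b = - (d_y b u \<bullet> N u)"
      by (simp_all add: Nx_def Ny_def nd[OF Jab(1)] nd[OF Jab(2)] JxJ Nw)
    have EGF: "(?a \<bullet> ?a) * (?b \<bullet> ?b) - (?a \<bullet> ?b)\<^sup>2 \<noteq> 0"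
    proof -
      have "(?a \<bullet> ?a) * (?b \<bullet> ?b) - (?a \<bullet> ?b)\<^sup>2 = ?J \<bullet> ?J"
        unfolding J by (simp add: cross3_dot_cross3 power2_eq_square inner_commute)
      then show ?thesis using n0 by simp
    qed
    have mc: "(d_x a u \<bullet> N u) * (?b \<bullet> ?b) - 2 * (d_y a u \<bullet> N u) * (?a \<bullet> ?b) + (d_y b u \<bullet> N u) * (?a \<bullet> ?a) = 0"
      using H[OF u c] EGF unfolding mean_curvature_param_def Let_def by (simp add: a_def b_def N_def)
    have V: "cross3 ?b (Nx u) + cross3 (Ny u) ?a = 0"
    proof (rule minimal_normal_variation)
      show "cross3 ?a ?b \<noteq> 0" using J0[OF u] by (simp add: J)
      show "Nx u \<bullet> cross3 ?a ?b = 0" "Ny u \<bullet> cross3 ?a ?b = 0"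
        using normalize_deriv_orthogonal[OF J0[OF u]] by (simp_all add: Nx_def Ny_def J)
      show "Nx u \<bullet> ?a * (?b \<bullet> ?b) - 2 * (Nx u \<bullet> ?b) * (?a \<bullet> ?b) + Ny u \<bullet> ?b * (?a \<bullet> ?a) = 0"
        unfolding e using mc by (simp add: algebra_simps)
    qed (simp add: e)
    have "Pfx u + Qfy u = X (\<phi> u) \<bullet> (cross3 ?b (Nx u) + cross3 (Ny u) ?a)
       + X (\<phi> u) \<bullet> (cross3 (d_y a u) (N u) + cross3 (N u) (d_y a u))
       + (?A ?a \<bullet> cross3 ?b (N u) + ?A ?b \<bullet> cross3 (N u) ?a)"
      unfolding Pfx_def Qfy_def mix by (simp add: inner_add_right)
    \<comment> \<open>The two terms with the mixed derivative cancel by antisymmetry; minimality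
      removes the bracket \<open>V\<close>.\<close>
    also have "\<dots> = ?A ?a \<bullet> cross3 ?b (N u) + ?A ?b \<bullet> cross3 (N u) ?a"
      using cross_skew[of "d_y a u" "N u"] by (simp add: V)
    also have "\<dots> = N u \<bullet> (cross3 (?A ?a) ?b + cross3 ?a (?A ?b))"
      by (simp add: cross3_simps)
    also have "\<dots> = norm ?J * tdiv (N u) ?A"
      using tdiv_area_form[OF C1_field_continuous(2)[OF X, of "\<phi> u"], of ?a ?b] J0[OF u]
      by (simp add: J N_def unit_normal_def)
    finally show ?thesis .
  qed
  have "(\<integral>u. indicator (U \<inter> {u. c < snd u}) u * (norm (jac \<phi> u) * tdiv (unit_normal \<phi> u) (DX (\<phi> u))) \<partial>lborel)
     = (\<integral>u. indicator {u. c < snd u} u * (ex Pfx u + ex Qfy u) \<partial>lborel)"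
  proof (intro Bochner_Integration.integral_cong refl)
    fix u :: plane
    show "indicator (U \<inter> {u. c < snd u}) u * (norm (jac \<phi> u) * tdiv (unit_normal \<phi> u) (DX (\<phi> u)))
      = indicator {u. c < snd u} u * (ex Pfx u + ex Qfy u)"
      using pt[of u] by (cases "u \<in> U"; cases "c < snd u") (simp_all add: ex_def N_def)
  qed
  \<comment> \<open>The open half-plane is replaced by the closed one; they differ by a null
    line.\<close>
  also have "\<dots> = (\<integral>u. indicator ?H u * (ex Pfx u + ex Qfy u) \<partial>lborel)"
  proof (rule integral_cong_AE)
    have "continuous_on ?H (\<lambda>u. ex Pfx u + ex Qfy u)"
      by (intro continuous_intros cex cP; use z in auto)
    moreover have Hb: "?H \<in> sets borel" by (intro borel_closed closed_Collect_le continuous_intros)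
    ultimately have m: "(\<lambda>u. indicator ?H u * (ex Pfx u + ex Qfy u)) \<in> borel_measurable borel"
      using borel_measurable_continuous_on_indicator by fastforce
    then show "(\<lambda>u. indicator ?H u * (ex Pfx u + ex Qfy u)) \<in> borel_measurable lborel" by simp
    have Ob: "{u::plane. c < snd u} \<in> sets borel" by (intro borel_open open_Collect_less continuous_intros)
    have "(\<lambda>u. indicator {u. c < snd u} u * (ex Pfx u + ex Qfy u)) =
      (\<lambda>u. indicator {u. c < snd u} u * (indicator ?H u * (ex Pfx u + ex Qfy u)))"
      by (auto simp: indicator_def fun_eq_iff)
    also have "\<dots> \<in> borel_measurable borel" using m Ob by measurable
    finally show "(\<lambda>u. indicator {u. c < snd u} u * (ex Pfx u + ex Qfy u)) \<in> borel_measurable lborel" by simp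
    show "AE u in lborel. indicator {u. c < snd u} u * (ex Pfx u + ex Qfy u) = indicator ?H u * (ex Pfx u + ex Qfy u)"
      using AE_snd_neq[of c] by eventually_elim (auto simp: indicator_def)
  qed
  also have "\<dots> = - (\<integral>x. ex Qf (x, c) \<partial>lborel)" by (rule main)
  also have "(\<integral>x. ex Qf (x, c) \<partial>lborel) = (\<integral>x. indicator U (x, c) * (X (\<phi> (x, c)) \<bullet> conormal_term \<phi> (x, c)) \<partial>lborel)"
    by (intro Bochner_Integration.integral_cong refl) (auto simp: ex_def Qf_def conormal_term_def N_def a_def)
  finally show ?thesis .
qed

section \<open>Tangential divergence on a surface\<close>

lemma tdiv_sum:
  "tdiv n (\<lambda>h. \<Sum>i\<in>I. D i h) = (\<Sum>i\<in>I. tdiv n (D i))"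
  by (simp add: tdiv_def sum.distrib sum_subtractf inner_sum_left)

lemma tdiv_0: "tdiv n (\<lambda>_. 0) = 0"
  by (simp add: tdiv_def)

lemma C1_field_bounded:
  assumes X: "C1_field X DX C"
  obtains B where "B > 0" "\<And>x h. norm h \<le> 1 \<Longrightarrow> norm (DX x h) \<le> B"
proof -
  have C: "compact C" using X by (simp add: C1_field_def)
  define f where "f x = (\<Sum>b\<in>Basis. norm (DX x b))" for x
  have "continuous_on C f" unfolding f_def
    by (intro continuous_intros continuous_on_subset[OF C1_field_continuous(3)[OF X]]) auto
  then have "bounded (f ` C)" using C by (intro compact_imp_bounded compact_continuous_image)
  then obtain B where B: "B > 0" "\<And>x. x \<in> C \<Longrightarrow> \<bar>f x\<bar> \<le> B" unfolding bounded_pos by auto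
  have "norm (DX x h) \<le> B" if h: "norm h \<le> 1" for x h
  proof (cases "x \<in> C")
    case True
    have l: "linear (DX x)" by (rule C1_field_continuous(2)[OF X])
    have "DX x h = DX x (\<Sum>b\<in>Basis. (h \<bullet> b) *\<^sub>R b)" by (simp only: euclidean_representation)
    also have "\<dots> = (\<Sum>b\<in>Basis. (h \<bullet> b) *\<^sub>R DX x b)" by (simp only: linear_sum[OF l] linear_cmul[OF l])
    also have "norm \<dots> \<le> (\<Sum>b\<in>Basis. norm ((h \<bullet> b) *\<^sub>R DX x b))" by (rule norm_sum)
    also have "\<dots> \<le> f x" unfolding f_def
    proof (rule sum_mono)
      fix b :: space assume "b \<in> Basis"
      then have "\<bar>h \<bullet> b\<bar> \<le> 1" using Basis_le_norm[of b h] h by linarith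
      then show "norm ((h \<bullet> b) *\<^sub>R DX x b) \<le> norm (DX x b)"
        using mult_right_mono[of "\<bar>h \<bullet> b\<bar>" 1 "norm (DX x b)"] by simp
    qed
    also have "\<dots> \<le> B" using B(2)[OF True] by linarith
    finally show ?thesis .
  next
    case False
    then show ?thesis using C1_field_continuous(5)[OF X False] B by simp
  qed
  then show ?thesis using B(1) that by blast
qed

lemma tdiv_bounded:
  assumes "\<And>h. norm h \<le> 1 \<Longrightarrow> norm (D h) \<le> B" "norm n = 1"
  shows "\<bar>tdiv n D\<bar> \<le> 4 * B"
proof -
  have 1: "\<bar>D (axis i 1) $ i\<bar> \<le> B" for i
    using assms(1)[of "axis i 1"] component_le_norm_cart[of "D (axis i 1)" i] by simp
  have "\<bar>D n \<bullet> n\<bar> \<le> norm (D n) * norm n" by (rule Cauchy_Schwarz_ineq2)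
  then have "\<bar>D n \<bullet> n\<bar> \<le> B" using assms(1)[of n] assms(2) by simp
  then show ?thesis using 1[of 1] 1[of 2] 1[of 3] unfolding tdiv_def by linarith
qed

locale surface_measure =
  fixes M :: "space set" and n :: "space \<Rightarrow> space" and \<mu> :: "space measure"
  assumes sets_eq[measurable_cong]: "sets \<mu> = sets borel"
    and finite: "emeasure \<mu> UNIV < \<infinity>"
    and M_borel[measurable]: "M \<in> sets borel"
    and off_M: "emeasure \<mu> (- M) = 0"
    and n_continuous: "continuous_on M n"
    and n_unit: "\<And>x. x \<in> M \<Longrightarrow> norm (n x) = 1"
    and patch: "\<And>\<phi> U B. local_param M \<phi> U \<Longrightarrow> B \<in> sets borel \<Longrightarrow> emeasure \<mu> (B \<inter> \<phi> ` U) = patch_area \<phi> U B"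
begin

lemma space_eq[simp]: "space \<mu> = UNIV"
  using sets_eq_imp_space_eq[OF sets_eq] by simp

lemma finite_measure: "finite_measure \<mu>"
  by (rule finite_measureI) (use finite in auto)

text \<open>The value 0 off M makes this a Borel function on all of space, whatever n is
  there.\<close>

definition divM :: "(space \<Rightarrow> space \<Rightarrow> space) \<Rightarrow> space \<Rightarrow> real" where
  "divM D x = (if x \<in> M then tdiv (n x) (D x) else 0)"

text \<open>A local notion, so that each kind of point can be treated in its own charts; a partition
  of unity then joins the pieces.\<close>

definition locally_stationary :: "space \<Rightarrow> bool" where
  "locally_stationary p \<longleftrightarrow> (\<exists>W. open W \<and> p \<in> W \<and>
     (\<forall>X DX C. C1_field X DX C \<longrightarrow> C \<subseteq> W \<longrightarrow> (\<integral>x. divM DX x \<partial>\<mu>) = 0))"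

lemma divM_measurable:
  assumes X: "C1_field X DX C"
  shows "divM DX \<in> borel_measurable borel"
proof -
  have "continuous_on M (\<lambda>x. tdiv (n x) (DX x))"
    unfolding tdiv_def
    by (intro continuous_intros C1_field_continuous_apply[OF X] n_continuous)
  from borel_measurable_extend_0[OF this M_borel]
  show ?thesis by (simp add: divM_def[abs_def])
qed

lemma divM_integrable:
  assumes X: "C1_field X DX C"
  shows "integrable \<mu> (divM DX)"
proof -
  interpret finite_measure \<mu> by (rule finite_measure)
  obtain B where B: "B > 0" "\<And>x h. norm h \<le> 1 \<Longrightarrow> norm (DX x h) \<le> B" using C1_field_bounded[OF X] by metis
  show ?thesis
  proof (rule integrable_const_bound[where B="4 * B"])
    show "divM DX \<in> borel_measurable \<mu>" using divM_measurable[OF X] by simp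
    show "AE x in \<mu>. norm (divM DX x) \<le> 4 * B"
      using tdiv_bounded[OF B(2) n_unit] B(1) by (auto simp: divM_def)
  qed
qed

text \<open>\<open>patch\<close> speaks of sets. It says that \<mu> restricted to the chart image is
  the push-forward of the area density, and the formula for integrals follows from this equality of
  measures.\<close>

lemma integral_patch:
  assumes lp: "local_param M \<phi> U" and f[measurable]: "f \<in> borel_measurable borel"
  shows "(\<integral>x. indicator (\<phi> ` U) x * f x \<partial>\<mu>) = (\<integral>u. indicator U u * (norm (jac \<phi> u) * f (\<phi> u)) \<partial>lborel)"
proof -
  have Ub[measurable]: "U \<in> sets borel" using lp by (auto simp: local_param_def)
  have \<phi>Ub[measurable]: "\<phi> ` U \<in> sets borel" by (rule local_param_image_borel[OF lp Ub]) simp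
  have sm: "smooth_on \<phi> U" using lp by (simp add: local_param_def)
  define \<phi>' where "\<phi>' u = (if u \<in> U then \<phi> u else 0)" for u
  have \<phi>'[measurable]: "\<phi>' \<in> borel_measurable borel"
    unfolding \<phi>'_def by (rule borel_measurable_extend_0[OF smooth_on_continuous[OF sm] Ub])
  define g where "g u = norm (if u \<in> U then jac \<phi> u else 0)" for u
  have g[measurable]: "g \<in> borel_measurable borel"
    unfolding g_def using borel_measurable_extend_0[OF continuous_on_jac[OF sm] Ub] by measurable
  have eq: "density \<mu> (\<lambda>x. ennreal (indicator (\<phi> ` U) x)) = distr (density lborel (\<lambda>u. ennreal (g u))) borel \<phi>'"
  proof (rule measure_eqI)
    fix B assume "B \<in> sets (density \<mu> (\<lambda>x. ennreal (indicator (\<phi> ` U) x)))"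
    then have B[measurable]: "B \<in> sets borel" by (simp add: sets_eq)
    have "emeasure (density \<mu> (\<lambda>x. ennreal (indicator (\<phi> ` U) x))) B
      = (\<integral>\<^sup>+x. ennreal (indicator (\<phi> ` U) x) * indicator B x \<partial>\<mu>)"
      by (rule emeasure_density) (auto simp: sets_eq)
    also have "\<dots> = (\<integral>\<^sup>+x. indicator (B \<inter> \<phi> ` U) x \<partial>\<mu>)"
      by (intro nn_integral_cong) (auto simp: indicator_def)
    also have "\<dots> = emeasure \<mu> (B \<inter> \<phi> ` U)" by (rule nn_integral_indicator) (simp add: sets_eq)
    also have "\<dots> = patch_area \<phi> U B" by (rule patch[OF lp B])
    also have "\<dots> = (\<integral>\<^sup>+u. ennreal (g u) * indicator (\<phi>' -` B) u \<partial>lborel)"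
      unfolding patch_area_def by (intro nn_integral_cong) (simp add: g_def \<phi>'_def indicator_def)
    also have "\<dots> = emeasure (density lborel (\<lambda>u. ennreal (g u))) (\<phi>' -` B)"
      using measurable_sets[OF \<phi>' B] by (subst emeasure_density) auto
    also have "\<dots> = emeasure (distr (density lborel (\<lambda>u. ennreal (g u))) borel \<phi>') B"
      by (subst emeasure_distr) auto
    finally show "emeasure (density \<mu> (\<lambda>x. ennreal (indicator (\<phi> ` U) x))) B = emeasure (distr (density lborel (\<lambda>u. ennreal (g u))) borel \<phi>') B" .
  qed (simp add: sets_eq)
  have "(\<integral>x. indicator (\<phi> ` U) x * f x \<partial>\<mu>) = (\<integral>x. f x \<partial>density \<mu> (\<lambda>x. ennreal (indicator (\<phi> ` U) x)))"
    by (subst integral_density) auto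
  also have "\<dots> = (\<integral>x. f x \<partial>distr (density lborel (\<lambda>u. ennreal (g u))) borel \<phi>')" by (simp only: eq)
  also have "\<dots> = (\<integral>u. f (\<phi>' u) \<partial>density lborel (\<lambda>u. ennreal (g u)))" by (subst integral_distr) auto
  also have "\<dots> = (\<integral>u. g u * f (\<phi>' u) \<partial>lborel)" by (subst integral_density) (auto simp: g_def)
  also have "\<dots> = (\<integral>u. indicator U u * (norm (jac \<phi> u) * f (\<phi> u)) \<partial>lborel)"
    by (intro Bochner_Integration.integral_cong refl) (simp add: g_def \<phi>'_def indicator_def)
  finally show ?thesis .
qed

end

section \<open>Partition of unity\<close>

text \<open>Squaring the positive part makes it C^1, which is the regularity that
  \<open>C1_field\<close> asks for.\<close>

definition sq_pos :: "real \<Rightarrow> real" where "sq_pos y = (max 0 y)\<^sup>2"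

lemma sq_pos_deriv: "(sq_pos has_real_derivative 2 * max 0 y) (at y)"
proof -
  consider "y < 0" | "y > 0" | "y = 0" by linarith
  then show ?thesis
  proof cases
    case 1
    have "((\<lambda>_. 0) has_real_derivative 0) (at y)" by simp
    then have "(sq_pos has_real_derivative 0) (at y)"
      by (rule has_field_derivative_transform_within_open[of _ _ _ "{..<0}"]) (use 1 in \<open>auto simp: sq_pos_def\<close>)
    then show ?thesis using 1 by simp
  next
    case 2
    have "((\<lambda>y. y\<^sup>2) has_real_derivative 2 * y) (at y)" by (auto intro!: derivative_eq_intros)
    then have "(sq_pos has_real_derivative 2 * y) (at y)"
      by (rule has_field_derivative_transform_within_open[of _ _ _ "{0<..}"]) (use 2 in \<open>auto simp: sq_pos_def\<close>)
    then show ?thesis using 2 by simp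
  next
    case 3
    have "((\<lambda>h. sq_pos h / h) \<longlongrightarrow> 0) (at 0)"
    proof (rule Lim_null_comparison)
      show "\<forall>\<^sub>F h in at 0. norm (sq_pos h / h) \<le> \<bar>h\<bar>"
        by (auto simp: eventually_at_filter sq_pos_def power2_eq_square max_def abs_mult intro!: always_eventually)
      show "((\<lambda>h::real. \<bar>h\<bar>) \<longlongrightarrow> 0) (at 0)" by (rule tendsto_eq_intros refl | simp)+
    qed
    then show ?thesis using 3 by (simp add: DERIV_def sq_pos_def)
  qed
qed

lemma sq_pos_has_derivative[derivative_intros]:
  assumes "(f has_derivative f') (at x within S)"
  shows "((\<lambda>x. sq_pos (f x)) has_derivative (\<lambda>h. 2 * max 0 (f x) * f' h)) (at x within S)"
  using has_derivative_compose[OF assms, of sq_pos "\<lambda>h. 2 * max 0 (f x) * h"] sq_pos_deriv[of "f x"]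
  by (simp add: has_field_derivative_def)

text \<open>Being a function of the squared distance, it has no corner at p; for r > 0 it is C^1 and
  positive exactly on the open ball.\<close>

definition bump :: "space \<Rightarrow> real \<Rightarrow> space \<Rightarrow> real" where
  "bump p r x = sq_pos (r\<^sup>2 - (x - p) \<bullet> (x - p))"

definition bump' :: "space \<Rightarrow> real \<Rightarrow> space \<Rightarrow> space \<Rightarrow> real" where
  "bump' p r x h = 2 * max 0 (r\<^sup>2 - (x - p) \<bullet> (x - p)) * (- 2 * ((x - p) \<bullet> h))"

lemma bump_has_derivative: "(bump p r has_derivative bump' p r x) (at x)"
  unfolding bump_def[abs_def] bump'_def[abs_def]
  by (auto intro!: derivative_eq_intros simp: inner_commute fun_eq_iff)

lemma bump_continuous: "continuous_on UNIV (bump p r)" "continuous_on UNIV (\<lambda>x. bump' p r x h)"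
proof -
  show "continuous_on UNIV (bump p r)"
    by (rule has_derivative_continuous_on[OF has_derivative_at_withinI[OF bump_has_derivative]])
qed (auto simp: bump'_def intro!: continuous_intros)

lemma bump_nonneg: "bump p r x \<ge> 0" by (simp add: bump_def sq_pos_def)

lemma bump_pos: "x \<in> ball p r \<Longrightarrow> bump p r x > 0"
proof -
  assume "x \<in> ball p r"
  then have "norm (x - p) < r" by (simp add: dist_norm norm_minus_commute)
  then have "(norm (x - p))\<^sup>2 < r\<^sup>2" by (intro power_strict_mono) auto
  then show ?thesis by (simp add: bump_def sq_pos_def power2_norm_eq_inner)
qed

lemma bump_outside: assumes "x \<notin> ball p r" "r > 0" shows "bump p r x = 0" "bump' p r x = (\<lambda>_. 0)"
proof -
  have "r \<le> norm (x - p)" using assms by (simp add: dist_norm norm_minus_commute)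
  then have "r\<^sup>2 \<le> (norm (x - p))\<^sup>2" using assms by (intro power_mono) auto
  then show "bump p r x = 0" "bump' p r x = (\<lambda>_. 0)"
    by (auto simp: bump_def bump'_def sq_pos_def power2_norm_eq_inner)
qed

text \<open>Partition of unity: bumps divided by their sum \<open>s\<close>, multiplied by X. Only
  the derivatives are recorded, since \<open>divM\<close> sees nothing else. Outside the balls
  \<open>s\<close> vanishes, but so do X and DX.\<close>

lemma C1_field_split:
  assumes X: "C1_field X DX C" and W: "\<And>p. p \<in> C \<Longrightarrow> open (W p) \<and> p \<in> W p"
  obtains T DY where "finite T" "T \<subseteq> C" "\<And>x. DX x = (\<lambda>h. \<Sum>p\<in>T. DY p x h)"
    "\<And>p. p \<in> T \<Longrightarrow> \<exists>Y C'. C1_field Y (DY p) C' \<and> C' \<subseteq> W p"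
proof -
  have C: "compact C" and XD: "\<And>x. (X has_derivative DX x) (at x)" using X by (auto simp: C1_field_def)
  have "\<exists>r>0. cball p r \<subseteq> W p" if "p \<in> C" for p using W[OF that] open_contains_cball by blast
  then obtain r where r: "\<And>p. p \<in> C \<Longrightarrow> r p > 0" "\<And>p. p \<in> C \<Longrightarrow> cball p (r p) \<subseteq> W p" by metis
  obtain T where T: "finite T" "T \<subseteq> C" "C \<subseteq> (\<Union>p\<in>T. ball p (r p))"
    by (rule compactE_image[OF C, of C "\<lambda>p. ball p (r p)"]) (use r in auto)
  define V where "V = (\<Union>p\<in>T. ball p (r p))"
  have V: "open V" "C \<subseteq> V" using T by (auto simp: V_def)
  let ?e = "\<lambda>p. bump p (r p)" and ?e' = "\<lambda>p. bump' p (r p)"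
  define s where "s x = (\<Sum>p\<in>T. ?e p x)" for x
  define s' where "s' x h = (\<Sum>p\<in>T. ?e' p x h)" for x h
  have spos: "s x > 0" if xV: "x \<in> V" for x
  proof -
    obtain p where p: "p \<in> T" "x \<in> ball p (r p)" using xV unfolding V_def by blast
    show ?thesis unfolding s_def
      by (rule sum_pos2[where i=p]) (use T(1) p bump_pos[OF p(2)] bump_nonneg in auto)
  qed
  define \<theta> where "\<theta> p x = ?e p x / s x" for p x
  define \<theta>' where "\<theta>' p x h = (?e' p x h * s x - ?e p x * s' x h) / (s x * s x)" for p x h
  define Y where "Y p x = \<theta> p x *\<^sub>R X x" for p x
  define DY where "DY p x h = \<theta> p x *\<^sub>R DX x h + \<theta>' p x h *\<^sub>R X x" for p x h
  have sd: "(s has_derivative s' x) (at x)" for x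
    unfolding s_def[abs_def] s'_def[abs_def] by (intro has_derivative_sum bump_has_derivative)
  have cs: "continuous_on S s" "continuous_on S (\<lambda>x. s' x h)" for S h
    unfolding s_def[abs_def] s'_def[abs_def]
    by (intro continuous_on_sum continuous_on_subset[OF bump_continuous(1)] continuous_on_subset[OF bump_continuous(2)] subset_UNIV)+
  have \<theta>d: "(\<theta> p has_derivative \<theta>' p x) (at x)" if "x \<in> V" for p x
  proof -
    have "((\<lambda>x. ?e p x / s x) has_derivative (\<lambda>h. (?e' p x h * s x - ?e p x * s' x h) / (s x * s x))) (at x)"
      by (rule has_derivative_divide'[OF bump_has_derivative sd]) (use spos[OF that] in simp)
    then show ?thesis by (simp add: \<theta>_def[abs_def] \<theta>'_def[abs_def])
  qed
  have Yf: "C1_field (Y p) (DY p) (C \<inter> cball p (r p))" if p: "p \<in> T" for p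
    unfolding C1_field_def
  proof (intro conjI allI impI)
    fix x
    show "(Y p has_derivative DY p x) (at x)"
    proof (cases "x \<in> V")
      case True
      have "((\<lambda>x. \<theta> p x *\<^sub>R X x) has_derivative (\<lambda>h. \<theta> p x *\<^sub>R DX x h + \<theta>' p x h *\<^sub>R X x)) (at x)"
        by (rule has_derivative_scaleR[OF \<theta>d[OF True] XD])
      then show ?thesis by (simp add: Y_def[abs_def] DY_def[abs_def])
    next
      case False
      then have xC: "x \<in> - C" using V by auto
      have "((\<lambda>_. 0) has_derivative (\<lambda>_. 0)) (at x)" by simp
      then have "(Y p has_derivative (\<lambda>_. 0)) (at x)"
        by (rule has_derivative_transform_within_open[of _ _ _ UNIV "- C", simplified])
          (use xC C1_field_continuous(4)[OF X] C compact_imp_closed in \<open>auto simp: Y_def\<close>)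
      moreover have "DY p x = (\<lambda>_. 0)"
        using xC C1_field_continuous(4,5)[OF X, of x] by (simp add: DY_def[abs_def])
      ultimately show ?thesis by simp
    qed
  next
    fix h
    have "continuous_on V (\<lambda>x. DY p x h)"
      unfolding DY_def \<theta>_def \<theta>'_def
      by (intro continuous_intros cs continuous_on_subset[OF bump_continuous(1)] continuous_on_subset[OF bump_continuous(2)]
          C1_field_continuous(1)[OF X] continuous_on_subset[OF C1_field_continuous(3)[OF X]] subset_UNIV ballI)
        (use spos in \<open>auto dest: less_imp_neq[symmetric]\<close>)
    moreover have "continuous_on (- C) (\<lambda>x. DY p x h)"
      by (rule continuous_on_eq[OF continuous_on_const[of _ 0]])
        (use C1_field_continuous(4,5)[OF X] in \<open>auto simp: DY_def\<close>)
    ultimately have "continuous_on (V \<union> - C) (\<lambda>x. DY p x h)"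
      using V C compact_imp_closed by (intro continuous_on_open_Un) auto
    moreover have "V \<union> - C = UNIV" using V by auto
    ultimately show "continuous_on UNIV (\<lambda>x. DY p x h)" by simp
  next
    show "compact (C \<inter> cball p (r p))" using C by (intro compact_Int) auto
  next
    fix x assume x: "x \<notin> C \<inter> cball p (r p)"
    have "Y p x = 0 \<and> DY p x = (\<lambda>_. 0)"
    proof (cases "x \<in> C")
      case False
      then show ?thesis using C1_field_continuous(4,5)[OF X, of x] by (simp add: Y_def DY_def[abs_def])
    next
      case True
      then have "x \<notin> ball p (r p)" using x by auto
      from bump_outside[OF this] have "?e p x = 0" "?e' p x = (\<lambda>_. 0)" using r(1)[of p] p T(2) by auto
      then show ?thesis by (simp add: Y_def DY_def[abs_def] \<theta>_def \<theta>'_def)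
    qed
    then show "Y p x = 0" "DY p x = (\<lambda>_. 0)" by auto
  qed
  show ?thesis
  proof (rule that[OF T(1,2), of DY])
    fix x
    show "DX x = (\<lambda>h. \<Sum>p\<in>T. DY p x h)"
    proof (rule ext)
      fix h
      show "DX x h = (\<Sum>p\<in>T. DY p x h)"
      proof (cases "x \<in> V")
        case True
        have "(\<Sum>p\<in>T. \<theta> p x) = 1"
          using spos[OF True] by (simp add: \<theta>_def flip: sum_divide_distrib s_def)
        moreover have "(\<Sum>p\<in>T. \<theta>' p x h) = 0"
        proof -
          have "(\<Sum>p\<in>T. \<theta>' p x h) = (s' x h * s x - s x * s' x h) / (s x * s x)"
            unfolding \<theta>'_def by (simp add: sum_subtractf s'_def s_def flip: sum_divide_distrib sum_distrib_right)
          then show ?thesis by simp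
        qed
        ultimately show ?thesis
          by (simp add: DY_def sum.distrib flip: scaleR_left.sum)
      next
        case False
        then have "x \<notin> C" using V by auto
        then show ?thesis using C1_field_continuous(4,5)[OF X, of x] by (simp add: DY_def)
      qed
    qed
  next
    fix p assume p: "p \<in> T"
    then have "C \<inter> cball p (r p) \<subseteq> W p" using r T by blast
    then show "\<exists>Y C'. C1_field Y (DY p) C' \<and> C' \<subseteq> W p" using Yf[OF p] by blast
  qed
qed

lemma (in surface_measure) first_variation_local_to_global:
  assumes loc: "\<And>p. p \<in> G \<Longrightarrow> locally_stationary p"
    and X: "C1_field X DX C" "C \<subseteq> G"
  shows "(\<integral>x. divM DX x \<partial>\<mu>) = 0"
proof -
  obtain W where W: "\<And>p. p \<in> C \<Longrightarrow> open (W p) \<and> p \<in> W p"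
    "\<And>p X DX C'. p \<in> C \<Longrightarrow> C1_field X DX C' \<Longrightarrow> C' \<subseteq> W p \<Longrightarrow> (\<integral>x. divM DX x \<partial>\<mu>) = 0"
    using loc X(2) unfolding locally_stationary_def by (metis subsetD)
  obtain T DY where T: "finite T" "T \<subseteq> C" "\<And>x. DX x = (\<lambda>h. \<Sum>p\<in>T. DY p x h)"
    "\<And>p. p \<in> T \<Longrightarrow> \<exists>Y C'. C1_field Y (DY p) C' \<and> C' \<subseteq> W p"
    using C1_field_split[OF X(1) W(1)] by metis
  have "divM DX x = (\<Sum>p\<in>T. divM (DY p) x)" for x
    by (simp add: divM_def T(3) tdiv_sum)
  then have "(\<integral>x. divM DX x \<partial>\<mu>) = (\<integral>x. (\<Sum>p\<in>T. divM (DY p) x) \<partial>\<mu>)" by simp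
  also have "\<dots> = (\<Sum>p\<in>T. \<integral>x. divM (DY p) x \<partial>\<mu>)"
    by (rule Bochner_Integration.integral_sum) (use T(4) divM_integrable in blast)
  also have "\<dots> = 0" using T(2,4) W(2) by (intro sum.neutral) blast
  finally show ?thesis .
qed

section \<open>Balance of conormals along an edge\<close>

text \<open>With N along a x b, the product N x a is a positive multiple of the part of b orthogonal
  to a. Its length is |a| because N is a unit vector orthogonal to a.\<close>

lemma conormal_term_eq:
  assumes "jac \<phi> u \<noteq> 0"
  shows "conormal_term \<phi> u = norm (d_x \<phi> u) *\<^sub>R sgn (conormal \<phi> u)" "conormal \<phi> u \<noteq> 0" "d_x \<phi> u \<noteq> 0"
proof -
  let ?a = "d_x \<phi> u" and ?b = "d_y \<phi> u" and ?J = "jac \<phi> u"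
  show a0: "?a \<noteq> 0" using assms by (auto simp: jac_def)
  then have aa: "?a \<bullet> ?a \<noteq> 0" by simp
  have "cross3 ?J ?a = - cross3 ?a (cross3 ?a ?b)" by (subst cross_skew) (simp add: jac_def)
  also have "\<dots> = (?a \<bullet> ?a) *\<^sub>R conormal \<phi> u"
    using aa by (simp add: cross3_cross3 conormal_def scaleR_diff_right inner_commute)
  finally have ct: "conormal_term \<phi> u = ((?a \<bullet> ?a) / norm ?J) *\<^sub>R conormal \<phi> u"
    by (simp add: conormal_term_def unit_normal_def cross_mult_left divide_inverse_commute)
  have "(norm (conormal_term \<phi> u))\<^sup>2 = (norm ?a)\<^sup>2"
  proof -
    have "unit_normal \<phi> u \<bullet> ?a = 0" by (simp add: unit_normal_def jac_def dot_cross_self)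
    moreover have "norm (unit_normal \<phi> u) = 1" using assms by (simp add: unit_normal_def)
    ultimately show ?thesis using norm_cross_dot[of "unit_normal \<phi> u" ?a] by (simp add: conormal_term_def)
  qed
  then have nct: "norm (conormal_term \<phi> u) = norm ?a" by (simp add: power2_eq_iff_nonneg)
  then show c0: "conormal \<phi> u \<noteq> 0" using a0 ct by auto
  have "sgn ((?a \<bullet> ?a) / norm ?J) = 1" using a0 assms by (intro sgn_pos) simp
  then have "sgn (conormal_term \<phi> u) = sgn (conormal \<phi> u)" unfolding ct by (simp only: sgn_scaleR scaleR_one)
  then show "conormal_term \<phi> u = norm ?a *\<^sub>R sgn (conormal \<phi> u)"
    using nct a0 by (metis (no_types) norm_eq_zero scaleR_right_imp_eq sgn_div_norm scaleR_scaleR right_inverse scaleR_one)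
qed

lemma sgn_inner_eq: "a \<noteq> 0 \<Longrightarrow> b \<noteq> 0 \<Longrightarrow> sgn a \<bullet> sgn b = cos (vec_angle a b)"
  by (simp add: cos_vec_angle sgn_div_norm divide_inverse)

text \<open>Boundary terms are Lebesgue integrals, while the change of variables applied to them
  speaks of absolute integrability and the gauge integral. Compact support links the two.\<close>

lemma integral_compact_support:
  fixes g :: "real \<Rightarrow> real"
  assumes A: "open A" and g: "continuous_on A g" and K: "compact K" "K \<subseteq> A" "\<And>x. x \<in> A \<Longrightarrow> x \<notin> K \<Longrightarrow> g x = 0"
  shows "g absolutely_integrable_on A" "(\<integral>x. indicator A x * g x \<partial>lborel) = integral A g"
proof -
  have "(\<lambda>x. indicator A x *\<^sub>R g x) = (\<lambda>x. indicator K x *\<^sub>R g x)"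
    using K by (auto simp: indicator_def fun_eq_iff)
  then have i: "set_integrable lborel A g" unfolding set_integrable_def
    using borel_integrable_compact[OF K(1) continuous_on_subset[OF g K(2)]] by simp
  then show "g absolutely_integrable_on A"
    unfolding set_integrable_def by (intro integrable_completion[THEN iffD2]) auto
  show "(\<integral>x. indicator A x * g x \<partial>lborel) = integral A g"
    using set_borel_integral_eq_integral(2)[OF i] by (simp add: set_lebesgue_integral_def)
qed

text \<open>Two patches run along the same edge with different parameters. The embeddings up to the
  boundary make the change of parameter \<open>h\<close> continuous, the nonzero edge tangent of
  \<phi>' makes it differentiable, and |h'| is the ratio of the speeds.\<close>

lemma edge_transition:
  fixes \<phi> \<phi>' :: "plane \<Rightarrow> space"
  assumes U: "open U" "smooth_on \<phi> U" "immersion_on \<phi> U"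
    and U': "open U'" "smooth_on \<phi>' U'" "immersion_on \<phi>' U'"
    and top: "topological_embedding_on \<phi> (U \<inter> {(x, y). y \<ge> 0})" "topological_embedding_on \<phi>' (U' \<inter> {(x, y). y \<ge> 0})"
    and eq: "\<phi> ` (U \<inter> {(x, y). y = 0}) = \<phi>' ` (U' \<inter> {(x, y). y = 0})"
  obtains h h' where "\<And>x. (x, 0) \<in> U \<Longrightarrow> (h x, 0) \<in> U' \<and> \<phi>' (h x, 0) = \<phi> (x, 0)"
    "\<And>x. (x, 0) \<in> U \<Longrightarrow> (h has_field_derivative h' x) (at x)"
    "inj_on h {x. (x, 0) \<in> U}" "h ` {x. (x, 0) \<in> U} = {x. (x, 0) \<in> U'}"
    "\<And>x. (x, 0) \<in> U \<Longrightarrow> norm (d_x \<phi> (x, 0)) = \<bar>h' x\<bar> * norm (d_x \<phi>' (h x, 0))"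
proof -
  define A where "A = {x. (x, 0::real) \<in> U}"
  have "open ((\<lambda>x. (x, 0::real)) -` U)" by (intro open_vimage U continuous_intros)
  then have A: "open A" by (simp add: A_def vimage_def)
  obtain \<psi> where \<psi>: "homeomorphism (U \<inter> {(x, y). y \<ge> 0}) (\<phi> ` (U \<inter> {(x, y). y \<ge> 0})) \<phi> \<psi>"
    using top(1) unfolding topological_embedding_on_def by blast
  obtain \<psi>' where \<psi>': "homeomorphism (U' \<inter> {(x, y). y \<ge> 0}) (\<phi>' ` (U' \<inter> {(x, y). y \<ge> 0})) \<phi>' \<psi>'"
    using top(2) unfolding topological_embedding_on_def by blast
  define h where "h x = fst (\<psi>' (\<phi> (x, 0)))" for x
  have ex: "\<exists>t. (t, 0) \<in> U' \<and> \<phi>' (t, 0) = \<phi> (x, 0) \<and> h x = t" if x: "x \<in> A" for x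
  proof -
    have "\<phi> (x, 0) \<in> \<phi>' ` (U' \<inter> {(x, y). y = 0})" unfolding eq[symmetric] using x by (auto simp: A_def)
    then obtain t where t: "(t, 0) \<in> U'" "\<phi>' (t, 0) = \<phi> (x, 0)" by auto
    have "\<psi>' (\<phi>' (t, 0)) = (t, 0)" by (rule homeomorphism_apply1[OF \<psi>']) (use t in auto)
    then show ?thesis using t by (auto simp: h_def)
  qed
  have h: "(h x, 0) \<in> U'" "\<phi>' (h x, 0) = \<phi> (x, 0)" if "x \<in> A" for x using ex[OF that] by auto
  have inj: "inj_on h A"
  proof (rule inj_onI)
    fix x y assume xy: "x \<in> A" "y \<in> A" "h x = h y"
    then have "\<phi> (x, 0) = \<phi> (y, 0)" using h(2)[of x] h(2)[of y] by simp
    moreover have "\<psi> (\<phi> (x, 0)) = (x, 0)" by (rule homeomorphism_apply1[OF \<psi>]) (use xy in \<open>auto simp: A_def\<close>)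
    moreover have "\<psi> (\<phi> (y, 0)) = (y, 0)" by (rule homeomorphism_apply1[OF \<psi>]) (use xy in \<open>auto simp: A_def\<close>)
    ultimately show "x = y" by (metis Pair_inject)
  qed
  have img: "h ` A = {x. (x, 0) \<in> U'}"
  proof (intro equalityI subsetI)
    fix t assume "t \<in> {x. (x, 0) \<in> U'}"
    then have t: "(t, 0) \<in> U'" by simp
    then have "\<phi>' (t, 0) \<in> \<phi> ` (U \<inter> {(x, y). y = 0})" unfolding eq by blast
    then obtain u where u: "u \<in> U" "snd u = 0" "\<phi> u = \<phi>' (t, 0)" by auto
    define x where "x = fst u"
    have x: "(x, 0) \<in> U" "\<phi> (x, 0) = \<phi>' (t, 0)" using u by (simp_all add: x_def flip: u(2))
    have "\<psi>' (\<phi>' (t, 0)) = (t, 0)" by (rule homeomorphism_apply1[OF \<psi>']) (use t in auto)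
    then have "h x = t" using x by (simp add: h_def)
    then show "t \<in> h ` A" using x by (auto simp: A_def)
  qed (use h in auto)
  have conth: "continuous_on A h"
    unfolding h_def
  proof (rule continuous_on_fst, rule continuous_on_compose2[OF homeomorphism_cont2[OF \<psi>']])
    show "continuous_on A (\<lambda>x. \<phi> (x, 0))"
      by (rule continuous_on_compose2[OF smooth_on_continuous[OF U(2)]]) (auto simp: A_def intro!: continuous_intros)
    show "(\<lambda>x. \<phi> (x, 0)) ` A \<subseteq> \<phi>' ` (U' \<inter> {(x, y). y \<ge> 0})"
      using ex by (force simp: image_iff)
  qed
  have dx: "((\<lambda>s. f (s,0)) has_vector_derivative d_x f (x,0)) (at x)"
    if "smooth_on f V" "(x,0) \<in> V" for f :: "plane \<Rightarrow> space" and x V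
    using partial_has_vector_derivative(1)[OF smooth_on_has_derivative_plane[OF that]] by simp
  \<comment> \<open>The coefficient of the projection of one edge tangent onto the other; the two
    turn out to be parallel.\<close>
  define h' where "h' x = (d_x \<phi> (x,0) \<bullet> d_x \<phi>' (h x,0)) / (d_x \<phi>' (h x,0) \<bullet> d_x \<phi>' (h x,0))" for x
  have hd: "(h has_field_derivative h' x) (at x)" and nrm: "norm (d_x \<phi> (x,0)) = \<bar>h' x\<bar> * norm (d_x \<phi>' (h x,0))" if x: "x \<in> A" for x
  proof -
    let ?g = "d_x \<phi>' (h x,0)"
    have g0: "?g \<noteq> 0" using U'(3) h(1)[OF x] by (auto simp: immersion_on_def)
    have d1: "((\<lambda>s. \<phi>' (s,0)) has_vector_derivative ?g) (at (h x))" by (rule dx[OF U'(2) h(1)[OF x]])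
    have d0: "((\<lambda>s. \<phi> (s,0)) has_vector_derivative d_x \<phi> (x,0)) (at x)" by (rule dx[OF U(2)]) (use x in \<open>simp add: A_def\<close>)
    have "(h has_derivative (\<lambda>k. (k *\<^sub>R d_x \<phi> (x,0) \<bullet> ?g) / (?g \<bullet> ?g))) (at x)"
    proof (rule has_derivative_left_inverse_factor[where \<psi>="\<lambda>s. \<phi>' (s,0)" and \<psi>'="\<lambda>k. k *\<^sub>R ?g" and A=A and \<phi>="\<lambda>s. \<phi> (s,0)"
          and \<phi>'="\<lambda>k. k *\<^sub>R d_x \<phi> (x,0)" and l="\<lambda>z. (z \<bullet> ?g) / (?g \<bullet> ?g)"])
      show "continuous (at x) h" using conth A x by (simp add: continuous_on_eq_continuous_at)
      show "bounded_linear (\<lambda>z. (z \<bullet> ?g) / (?g \<bullet> ?g))"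
        by (intro bounded_linear_divide[THEN bounded_linear_compose] bounded_linear_inner_left)
    qed (use d0 d1 g0 A x h(2) in \<open>auto simp: has_vector_derivative_def\<close>)
    then show hd: "(h has_field_derivative h' x) (at x)"
      by (rule has_derivative_imp_has_field_derivative) (simp add: h'_def)
    have "((\<lambda>s. \<phi>' (h s,0)) has_vector_derivative h' x *\<^sub>R ?g) (at x)"
      using vector_diff_chain_at[OF hd[unfolded has_real_derivative_iff_has_vector_derivative] d1] by (simp add: o_def)
    then have "((\<lambda>s. \<phi> (s,0)) has_vector_derivative h' x *\<^sub>R ?g) (at x)"
      by (rule has_vector_derivative_transform_within_open[OF _ A x]) (use h(2) in auto)
    then have "d_x \<phi> (x,0) = h' x *\<^sub>R ?g" using d0 by (rule vector_derivative_unique_at[rotated])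
    then show "norm (d_x \<phi> (x,0)) = \<bar>h' x\<bar> * norm ?g" by simp
  qed
  show ?thesis
    by (rule that[of h h']) (use h hd inj img nrm in \<open>auto simp: A_def\<close>)
qed

text \<open>All three integrals are written in the edge parameter of patch 0. There |h'| and the
  speed of patch i combine to the speed of patch 0, a common factor, and what remains is X paired
  with the sum of three unit conormals at angles 2 pi/3.\<close>

lemma conormal_terms_cancel:
  fixes \<phi> :: "nat \<Rightarrow> plane \<Rightarrow> space"
  assumes U: "\<And>i. i < 3 \<Longrightarrow> open (U i)" "\<And>i. i < 3 \<Longrightarrow> smooth_on (\<phi> i) (U i)" "\<And>i. i < 3 \<Longrightarrow> immersion_on (\<phi> i) (U i)"
      "\<And>i. i < 3 \<Longrightarrow> topological_embedding_on (\<phi> i) (U i \<inter> {(x, y). y \<ge> 0})"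
      "\<And>i. i < 3 \<Longrightarrow> \<phi> i ` (U i \<inter> {(x, y). y = 0}) = E"
    and ang: "\<And>i j a b. i < 3 \<Longrightarrow> j < 3 \<Longrightarrow> i \<noteq> j \<Longrightarrow> (a, 0) \<in> U i \<Longrightarrow> (b, 0) \<in> U j \<Longrightarrow> \<phi> i (a, 0) = \<phi> j (b, 0) \<Longrightarrow>
       vec_angle (conormal (\<phi> i) (a, 0)) (conormal (\<phi> j) (b, 0)) = 2 * pi / 3"
    and X: "C1_field X DX C" and K: "\<And>i. i < 3 \<Longrightarrow> compact {u \<in> U i. 0 \<le> snd u \<and> \<phi> i u \<in> C}"
  shows "(\<Sum>i<3. \<integral>x. indicator (U i) (x, 0) * (X (\<phi> i (x, 0)) \<bullet> conormal_term (\<phi> i) (x, 0)) \<partial>lborel) = 0"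
proof -
  define A where "A i = {x. (x, 0::real) \<in> U i}" for i
  define g where "g i x = X (\<phi> i (x, 0)) \<bullet> conormal_term (\<phi> i) (x, 0)" for i x
  have A: "open (A i)" if "i < 3" for i
  proof -
    have "open ((\<lambda>x. (x, 0::real)) -` U i)" by (intro open_vimage U that continuous_intros)
    then show ?thesis by (simp add: A_def vimage_def)
  qed
  have J0: "jac (\<phi> i) (x,0) \<noteq> 0" if "i < 3" "x \<in> A i" for i x
    using U(3)[OF that(1)] that(2) by (auto simp: immersion_on_def A_def jac_def)
  have gint: "g i absolutely_integrable_on A i"
    "(\<integral>x. indicator (A i) x * g i x \<partial>lborel) = integral (A i) (g i)" if i: "i < 3" for i
  proof -
    let ?K = "fst ` ({u \<in> U i. 0 \<le> snd u \<and> \<phi> i u \<in> C} \<inter> {u. snd u = 0})"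
    have cl: "closed {u::plane. snd u = 0}" by (intro closed_Collect_eq continuous_intros)
    have cK: "compact ?K"
      by (intro compact_continuous_image compact_Int_closed K[OF i] cl continuous_intros)
    have KA: "?K \<subseteq> A i" by (auto simp: A_def)
    have z: "g i x = 0" if "x \<in> A i" "x \<notin> ?K" for x
    proof -
      have "\<phi> i (x,0) \<notin> C" using that by (force simp: A_def image_iff)
      then show ?thesis using C1_field_continuous(4)[OF X] by (simp add: g_def)
    qed
    have cnt: "continuous_on (A i) (\<lambda>x. f (x,0::real))" if "continuous_on (U i) f" for f :: "plane \<Rightarrow> space"
      by (rule continuous_on_compose2[OF that]) (auto simp: A_def intro!: continuous_intros)
    have cJ: "continuous_on (U i) (jac (\<phi> i))" by (rule continuous_on_jac[OF U(2)[OF i]])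
    have "\<forall>u\<in>U i. norm (jac (\<phi> i) u) \<noteq> 0" using U(3)[OF i] by (simp add: immersion_on_def jac_def)
    then have "continuous_on (U i) (\<lambda>u. jac (\<phi> i) u /\<^sub>R norm (jac (\<phi> i) u))"
      by (intro continuous_on_scaleR continuous_on_inverse continuous_on_norm cJ)
    then have "continuous_on (U i) (conormal_term (\<phi> i))"
      unfolding conormal_term_def[abs_def] unit_normal_def
      by (intro continuous_on_cross smooth_on_continuous[OF smooth_on_d_x[OF U(2)[OF i]]])
    then have cg: "continuous_on (A i) (g i)" unfolding g_def[abs_def]
      by (intro continuous_intros cnt continuous_on_compose2[OF C1_field_continuous(1)[OF X] cnt[OF smooth_on_continuous[OF U(2)[OF i]]]]) auto
    show "g i absolutely_integrable_on A i" "(\<integral>x. indicator (A i) x * g i x \<partial>lborel) = integral (A i) (g i)"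
      using integral_compact_support[OF A[OF i] cg cK KA z] by blast+
  qed
  define \<nu> where "\<nu> i x = sgn (conormal (\<phi> i) (x,0))" for i x
  define k where "k i h x = norm (d_x (\<phi> 0) (x,0)) * (X (\<phi> 0 (x,0)) \<bullet> \<nu> i (h x))" for i h x
  have z3: "(0::nat) < 3" by simp
  have tr: "\<exists>h. (\<forall>x\<in>A 0. h x \<in> A i \<and> \<phi> i (h x, 0) = \<phi> 0 (x,0)) \<and>
     (k i h) integrable_on A 0 \<and>
     integral (A i) (g i) = integral (A 0) (k i h)" if i: "i < 3" for i
  proof -
    have eq: "\<phi> 0 ` (U 0 \<inter> {(x, y). y = 0}) = \<phi> i ` (U i \<inter> {(x, y). y = 0})" using U(5)[of 0] U(5)[OF i] by simp
    obtain h h' where h: "\<And>x. (x, 0) \<in> U 0 \<Longrightarrow> (h x, 0) \<in> U i \<and> \<phi> i (h x, 0) = \<phi> 0 (x, 0)"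
      "\<And>x. (x, 0) \<in> U 0 \<Longrightarrow> (h has_field_derivative h' x) (at x)"
      "inj_on h {x. (x, 0) \<in> U 0}" "h ` {x. (x, 0) \<in> U 0} = {x. (x, 0) \<in> U i}"
      "\<And>x. (x, 0) \<in> U 0 \<Longrightarrow> norm (d_x (\<phi> 0) (x, 0)) = \<bar>h' x\<bar> * norm (d_x (\<phi> i) (h x, 0))"
      by (rule edge_transition[OF U(1)[OF z3] U(2)[OF z3] U(3)[OF z3] U(1)[OF i] U(2)[OF i] U(3)[OF i] U(4)[OF z3] U(4)[OF i] eq]) (rule that; blast)
    have img: "h ` A 0 = A i" using h(4) by (simp add: A_def)
    have "(\<lambda>x. \<bar>h' x\<bar> * g i (h x)) absolutely_integrable_on A 0 \<and>
           integral (A 0) (\<lambda>x. \<bar>h' x\<bar> * g i (h x)) = integral (A i) (g i)"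
    proof -
      have "(\<lambda>x. \<bar>h' x\<bar> * g i (h x)) absolutely_integrable_on A 0 \<and>
           integral (A 0) (\<lambda>x. \<bar>h' x\<bar> * g i (h x)) = integral (A i) (g i)
         \<longleftrightarrow> g i absolutely_integrable_on h ` A 0 \<and> integral (h ` A 0) (g i) = integral (A i) (g i)"
      proof (rule has_absolute_integral_change_of_variables_1')
        show "A 0 \<in> sets lebesgue" using A[of 0] by auto
        show "(h has_field_derivative h' x) (at x within A 0)" if "x \<in> A 0" for x
          using h(2)[of x] that by (auto simp: A_def intro: has_field_derivative_at_within)
        show "inj_on h (A 0)" using h(3) by (simp add: A_def)
      qed
      then show ?thesis using gint[OF i] img by simp
    qed
    moreover have "\<bar>h' x\<bar> * g i (h x) = k i h x" if x: "x \<in> A 0" for x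
    proof -
      have x0: "(x,0) \<in> U 0" using x by (simp add: A_def)
      have "h x \<in> A i" using img x by blast
      then have "conormal_term (\<phi> i) (h x,0) = norm (d_x (\<phi> i) (h x, 0)) *\<^sub>R \<nu> i (h x)"
        unfolding \<nu>_def by (intro conormal_term_eq J0 i)
      then show ?thesis using h(1)[OF x0] h(5)[OF x0] by (simp add: g_def k_def)
    qed
    ultimately have "(k i h) absolutely_integrable_on A 0"
      "integral (A i) (g i) = integral (A 0) (k i h)"
      using set_integrable_cong[of lebesgue lebesgue "A 0" "A 0" "\<lambda>x. \<bar>h' x\<bar> * g i (h x)"]
      by (auto cong: Henstock_Kurzweil_Integration.integral_cong)
    then show ?thesis using h(1) by (auto simp: A_def intro!: exI[of _ h] dest: set_lebesgue_integral_eq_integral(1))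
  qed
  obtain h where h: "\<And>i x. i < 3 \<Longrightarrow> x \<in> A 0 \<Longrightarrow> h i x \<in> A i \<and> \<phi> i (h i x, 0) = \<phi> 0 (x,0)"
    "\<And>i. i < 3 \<Longrightarrow> (k i (h i)) integrable_on A 0"
    "\<And>i. i < 3 \<Longrightarrow> integral (A i) (g i) = integral (A 0) (k i (h i))"
  proof -
    have "\<forall>i\<in>{..<3}. \<exists>h. (\<forall>x\<in>A 0. h x \<in> A i \<and> \<phi> i (h x, 0) = \<phi> 0 (x,0)) \<and>
     (k i h) integrable_on A 0 \<and>
     integral (A i) (g i) = integral (A 0) (k i h)"
      using tr by blast
    from bchoice[OF this] obtain h where "\<forall>i\<in>{..<3}. (\<forall>x\<in>A 0. h i x \<in> A i \<and> \<phi> i (h i x, 0) = \<phi> 0 (x,0)) \<and>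
     (k i (h i)) integrable_on A 0 \<and>
     integral (A i) (g i) = integral (A 0) (k i (h i))" ..
    then show ?thesis using that[of h] by blast
  qed
  have bal: "\<nu> 0 (h 0 x) + \<nu> 1 (h 1 x) + \<nu> 2 (h 2 x) = 0" if x: "x \<in> A 0" for x
  proof -
    have c0: "conormal (\<phi> i) (h i x, 0) \<noteq> 0" if "i < 3" for i
      using conormal_term_eq(2)[OF J0[OF that]] h(1)[OF that x] by blast
    have ip: "\<nu> i (h i x) \<bullet> \<nu> j (h j x) = -1/2" if "i < 3" "j < 3" "i \<noteq> j" for i j
    proof -
      have "vec_angle (conormal (\<phi> i) (h i x, 0)) (conormal (\<phi> j) (h j x, 0)) = 2 * pi / 3"
        using h(1)[OF that(1) x] h(1)[OF that(2) x] by (intro ang that) (auto simp: A_def)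
      then show ?thesis unfolding \<nu>_def sgn_inner_eq[OF c0[OF that(1)] c0[OF that(2)]] by (simp only: cos_120)
    qed
    have "norm (\<nu> i (h i x)) = 1" if "i < 3" for i using c0[OF that] by (simp add: \<nu>_def norm_sgn)
    then show ?thesis by (intro three_unit_vectors_sum_0 ip) auto
  qed
  have "(\<Sum>i<3. \<integral>x. indicator (U i) (x, 0) * (X (\<phi> i (x, 0)) \<bullet> conormal_term (\<phi> i) (x, 0)) \<partial>lborel)
     = (\<Sum>i<3. \<integral>x. indicator (A i) x * g i x \<partial>lborel)"
    by (simp add: g_def A_def indicator_def)
  also have "\<dots> = (\<Sum>i<3. integral (A 0) (k i (h i)))"
    using gint h(3) by simp
  also have "\<dots> = integral (A 0) (\<lambda>x. \<Sum>i<3. k i (h i) x)"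
    by (rule integral_sum[symmetric]) (use h(2) in auto)
  also have "\<dots> = integral (A 0) (\<lambda>x. 0)"
  proof (rule Henstock_Kurzweil_Integration.integral_cong)
    fix x assume "x \<in> A 0"
    have "(\<Sum>i<3. k i (h i) x)
       = norm (d_x (\<phi> 0) (x,0)) * (X (\<phi> 0 (x,0)) \<bullet> (\<nu> 0 (h 0 x) + \<nu> 1 (h 1 x) + \<nu> 2 (h 2 x)))"
      unfolding k_def by (simp add: numeral_3_eq_3 inner_add_right algebra_simps numeral_2_eq_2)
    also have "\<dots> = 0" using bal[OF \<open>x \<in> A 0\<close>] by simp
    finally show "(\<Sum>i<3. k i (h i) x) = 0" .
  qed
  finally show ?thesis by simp
qed

section \<open>First variation of a minimal foam\<close>

lemma mean_curvature_param_minus: "mean_curvature_param \<phi> (- \<nu>) u = - mean_curvature_param \<phi> \<nu> u"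
  by (simp add: mean_curvature_param_def Let_def minus_divide_left algebra_simps)

lemma unit_orthogonal_eq:
  fixes a b m :: space
  assumes m: "norm m = 1" "m \<bullet> a = 0" "m \<bullet> b = 0" and J: "cross3 a b \<noteq> 0"
  shows "m = cross3 a b /\<^sub>R norm (cross3 a b) \<or> m = - (cross3 a b /\<^sub>R norm (cross3 a b))"
proof -
  define N where "N = cross3 a b /\<^sub>R norm (cross3 a b)"
  have NN: "N \<bullet> N = 1" using J by (simp add: N_def dot_square_norm power2_eq_square)
  have ab: "cross3 a b \<bullet> a = 0" "cross3 a b \<bullet> b = 0" by (simp_all add: dot_cross_self)
  have Nab: "N \<bullet> a = 0" "N \<bullet> b = 0" by (simp_all add: N_def ab)
  have JN: "cross3 a b = norm (cross3 a b) *\<^sub>R N" using J by (simp add: N_def)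
  have "m - (m \<bullet> N) *\<^sub>R N = 0"
  proof (rule orthogonal_to_frame_eq_0[OF _ _ _ J])
    have "(m - (m \<bullet> N) *\<^sub>R N) \<bullet> N = 0" using NN by (simp add: inner_diff_left)
    then show "(m - (m \<bullet> N) *\<^sub>R N) \<bullet> cross3 a b = 0" by (subst JN) (simp only: inner_scaleR_right mult_zero_right)
  qed (use Nab m in \<open>simp_all add: inner_diff_left\<close>)
  then have mN: "m = (m \<bullet> N) *\<^sub>R N" by simp
  then have "norm m = \<bar>m \<bullet> N\<bar> * norm N" by (metis norm_scaleR)
  moreover have "norm N = 1" using J by (simp add: N_def)
  ultimately have "m \<bullet> N = 1 \<or> m \<bullet> N = -1" using m(1) by (auto simp: abs_if split: if_splits)
  then show ?thesis using mN by (auto simp flip: N_def)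
qed

lemma half_plane_sets:
  "{(x, y). 0 < y} = {u :: plane. 0 < snd u}" "{(x, y). 0 \<le> y} = {u :: plane. 0 \<le> snd u}" "{(x, y). y = 0} = {u :: plane. snd u = 0}"
  by auto

locale minimal_foam_measure = surface_measure "\<Union> (faces F)" n \<mu>
  for F :: foam and n \<mu> +
  fixes \<Omega> :: "space set"
  assumes \<Omega>: "open \<Omega>" and foam: "is_foam \<Omega> F"
    and normals: "\<And>S. S \<in> faces F \<Longrightarrow> unit_normal_field S n \<and> (\<forall>p\<in>S. has_mean_curvature S n p 0)"
begin

abbreviation "M \<equiv> \<Union> (faces F)"

lemma face_openin_foam: "S \<in> faces F \<Longrightarrow> openin (top_of_set (foam_set F)) S"
  using foam by (simp add: is_foam_def)

lemma face_openin: "S \<in> faces F \<Longrightarrow> openin (top_of_set M) S"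
  by (rule openin_subset_trans[OF face_openin_foam]) (auto simp: foam_set_def)

text \<open>The field n and the normal of a chart agree up to sign at each point. Vanishing mean
  curvature and \<open>tdiv\<close> do not see that sign, so chart orientations need no
  matching.\<close>

lemma face_patch:
  assumes S: "S \<in> faces F" and lp: "local_param S \<phi> U"
  shows "local_param M \<phi> U" "openin (top_of_set (foam_set F)) (\<phi> ` U)" "\<phi> ` U \<subseteq> M"
    "\<And>u. u \<in> U \<Longrightarrow> mean_curvature_param \<phi> (unit_normal \<phi> u) u = 0"
    "\<And>u A. u \<in> U \<Longrightarrow> linear A \<Longrightarrow> tdiv (n (\<phi> u)) A = tdiv (unit_normal \<phi> u) A"
proof -
  have o: "openin (top_of_set S) (\<phi> ` U)" using lp by (simp add: local_param_def)
  show "local_param M \<phi> U" using lp openin_trans[OF o face_openin[OF S]] by (simp add: local_param_def)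
  show "openin (top_of_set (foam_set F)) (\<phi> ` U)" by (rule openin_trans[OF o face_openin_foam[OF S]])
  have sub: "\<phi> ` U \<subseteq> S" using openin_imp_subset[OF o] .
  then show "\<phi> ` U \<subseteq> M" using S by auto
  fix u assume u: "u \<in> U"
  have "norm (n (\<phi> u)) = 1" "n (\<phi> u) \<bullet> d_x \<phi> u = 0" "n (\<phi> u) \<bullet> d_y \<phi> u = 0"
    using normals[OF S] lp u sub unfolding unit_normal_field_def by blast+
  moreover have "cross3 (d_x \<phi> u) (d_y \<phi> u) \<noteq> 0" using lp u by (auto simp: local_param_def immersion_on_def)
  ultimately have n: "n (\<phi> u) = unit_normal \<phi> u \<or> n (\<phi> u) = - unit_normal \<phi> u"
    unfolding unit_normal_def jac_def by (rule unit_orthogonal_eq)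
  have "mean_curvature_param \<phi> (n (\<phi> u)) u = 0"
    using normals[OF S] lp u sub unfolding has_mean_curvature_def by blast
  then show "mean_curvature_param \<phi> (unit_normal \<phi> u) u = 0"
    using n by (auto simp: mean_curvature_param_minus)
  show "tdiv (n (\<phi> u)) A = tdiv (unit_normal \<phi> u) A" if "linear A" for A
    using n tdiv_minus[OF that] by auto
qed

lemma integral_div_patch:
  assumes S: "S \<in> faces F" and lp: "local_param S \<phi> U" and X: "C1_field X DX C"
  shows "(\<integral>x. indicator (\<phi> ` U) x * divM DX x \<partial>\<mu>)
    = (\<integral>u. indicator U u * (norm (jac \<phi> u) * tdiv (unit_normal \<phi> u) (DX (\<phi> u))) \<partial>lborel)"
proof -
  have "(\<integral>x. indicator (\<phi> ` U) x * divM DX x \<partial>\<mu>) = (\<integral>u. indicator U u * (norm (jac \<phi> u) * divM DX (\<phi> u)) \<partial>lborel)"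
    by (rule integral_patch[OF face_patch(1)[OF S lp] divM_measurable[OF X]])
  also have "\<dots> = (\<integral>u. indicator U u * (norm (jac \<phi> u) * tdiv (unit_normal \<phi> u) (DX (\<phi> u))) \<partial>lborel)"
  proof (intro Bochner_Integration.integral_cong refl)
    fix u :: plane
    show "indicator U u * (norm (jac \<phi> u) * divM DX (\<phi> u)) = indicator U u * (norm (jac \<phi> u) * tdiv (unit_normal \<phi> u) (DX (\<phi> u)))"
    proof (cases "u \<in> U")
      case True
      then have "\<phi> u \<in> M" using face_patch(3)[OF S lp] by blast
      then show ?thesis using face_patch(5)[OF S lp True C1_field_continuous(2)[OF X]] by (simp add: divM_def)
    qed simp
  qed
  finally show ?thesis .
qed

lemma divM_outside: "C1_field X DX C \<Longrightarrow> x \<notin> C \<Longrightarrow> divM DX x = 0"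
  using C1_field_continuous(5)[of X DX C x] by (simp add: divM_def tdiv_0)

lemma divM_off_M: "x \<notin> M \<Longrightarrow> divM D x = 0"
  unfolding divM_def by (rule if_not_P)

lemma foam_set_closed_in: obtains T where "closed T" "foam_set F = \<Omega> \<inter> T"
  using foam by (auto simp: is_foam_def closedin_closed)

section \<open>Local stationarity off the foam, on faces and on edges\<close>

lemma off_foam_first_variation:
  assumes "p \<in> \<Omega> - foam_set F"
  shows "locally_stationary p"
proof -
  obtain T where T: "closed T" "foam_set F = \<Omega> \<inter> T" by (rule foam_set_closed_in)
  show ?thesis unfolding locally_stationary_def
  proof (intro exI conjI allI impI)
    show "open (\<Omega> - T)" using T \<Omega> by auto
    show "p \<in> \<Omega> - T" using assms T by auto
    fix X DX C assume X: "C1_field X DX C" and C: "C \<subseteq> \<Omega> - T"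
    have "M \<subseteq> foam_set F" by (auto simp: foam_set_def)
    then have "divM DX x = 0" for x
      using divM_outside[OF X, of x] divM_off_M[of x DX] C T by blast
    then show "(\<integral>x. divM DX x \<partial>\<mu>) = 0" by simp
  qed
qed

text \<open>The continuous inverse \<psi> carries compactness from space to the parameter domain, as
  the hypothesis \<open>K\<close> of \<open>patch_first_variation\<close> demands.\<close>

lemma homeomorphism_preimage_compact:
  assumes "homeomorphism D (\<phi> ` D) \<phi> \<psi>" "compact (C \<inter> \<phi> ` D)"
  shows "compact {u \<in> D. \<phi> u \<in> C}"
proof -
  have "{u \<in> D. \<phi> u \<in> C} = \<psi> ` (C \<inter> \<phi> ` D)"
  proof (intro equalityI subsetI)
    fix u assume u: "u \<in> {u \<in> D. \<phi> u \<in> C}"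
    then have "u = \<psi> (\<phi> u)" using homeomorphism_apply1[OF assms(1), of u] by simp
    then show "u \<in> \<psi> ` (C \<inter> \<phi> ` D)" using u by blast
  next
    fix u assume "u \<in> \<psi> ` (C \<inter> \<phi> ` D)"
    then obtain v where "v \<in> D" "\<phi> v \<in> C" "u = \<psi> (\<phi> v)" by blast
    then show "u \<in> {u \<in> D. \<phi> u \<in> C}" using homeomorphism_apply1[OF assms(1), of v] by simp
  qed
  moreover have "compact (\<psi> ` (C \<inter> \<phi> ` D))"
    by (rule compact_continuous_image[OF continuous_on_subset[OF homeomorphism_cont2[OF assms(1)]] assms(2)]) auto
  ultimately show ?thesis by simp
qed

lemma face_first_variation:
  assumes S: "S \<in> faces F" and p: "p \<in> S"
  shows "locally_stationary p"
proof -
  obtain T where T: "closed T" "foam_set F = \<Omega> \<inter> T" by (rule foam_set_closed_in)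
  have "embedded_surface S" using foam S by (auto simp: is_foam_def)
  then obtain \<phi> U where lp: "local_param S \<phi> U" "p \<in> \<phi> ` U" using p unfolding embedded_surface_def by blast
  note lp' = lp(1)[unfolded local_param_def]
  obtain \<psi> where \<psi>: "homeomorphism U (\<phi> ` U) \<phi> \<psi>" by (rule local_param_homeomorphism[OF lp(1)])
  obtain W0 where W0: "open W0" "\<phi> ` U = foam_set F \<inter> W0"
    using face_patch(2)[OF S lp(1)] by (auto simp: openin_open)
  have MF: "M \<subseteq> foam_set F" by (auto simp: foam_set_def)
  show ?thesis unfolding locally_stationary_def
  proof (intro exI conjI allI impI)
    show "open (W0 \<inter> \<Omega>)" using W0 \<Omega> by auto
    show "p \<in> W0 \<inter> \<Omega>" using lp W0 T by auto
    fix X DX C assume X: "C1_field X DX C" and C: "C \<subseteq> W0 \<inter> \<Omega>"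
    have cC: "compact C" using X by (simp add: C1_field_def)
    \<comment> \<open>Inside W0 the chart image is the whole foam, and the foam is closed relative
      to \<Omega>; so C meets it in a closed set.\<close>
    have "C \<inter> \<phi> ` U = C \<inter> T" using W0 T C by auto
    then have K: "compact {u \<in> U. \<phi> u \<in> C}"
      using homeomorphism_preimage_compact[OF \<psi>, of C] cC T by (simp add: compact_Int_closed)
    then obtain L where "\<forall>u\<in>{u \<in> U. \<phi> u \<in> C}. norm u < L"
      using compact_imp_bounded[OF K] unfolding bounded_pos_less by (elim exE conjE)
    then have L: "norm u < L" if "u \<in> U" "\<phi> u \<in> C" for u using that by blast
    \<comment> \<open>The line y = c lies below the support, so the half-plane theorem yields no
      boundary term here.\<close>
    define c where "c = - L"
    have c: "c < snd u" if "u \<in> U" "\<phi> u \<in> C" for u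
      using L[OF that] norm_snd_le[of "snd u" "fst u"] by (simp add: c_def)
    have Kc: "{u \<in> U. c \<le> snd u \<and> \<phi> u \<in> C} = {u \<in> U. \<phi> u \<in> C}" using c by force
    have "(\<integral>x. divM DX x \<partial>\<mu>) = (\<integral>x. indicator (\<phi> ` U) x * divM DX x \<partial>\<mu>)"
    proof (intro Bochner_Integration.integral_cong refl)
      fix x
      show "divM DX x = indicator (\<phi> ` U) x * divM DX x"
      proof (cases "x \<in> \<phi> ` U")
        case False
        then have "x \<notin> M \<or> x \<notin> C" using MF W0 C by blast
        then have "divM DX x = 0" using divM_outside[OF X, of x] divM_off_M[of x DX] by blast
        then show ?thesis by simp
      qed simp
    qed
    also have "\<dots> = (\<integral>u. indicator U u * (norm (jac \<phi> u) * tdiv (unit_normal \<phi> u) (DX (\<phi> u))) \<partial>lborel)"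
      by (rule integral_div_patch[OF S lp(1) X])
    also have "\<dots> = (\<integral>u. indicator (U \<inter> {u. c < snd u}) u * (norm (jac \<phi> u) * tdiv (unit_normal \<phi> u) (DX (\<phi> u))) \<partial>lborel)"
    proof (intro Bochner_Integration.integral_cong refl)
      fix u :: plane
      show "indicator U u * (norm (jac \<phi> u) * tdiv (unit_normal \<phi> u) (DX (\<phi> u))) =
        indicator (U \<inter> {u. c < snd u}) u * (norm (jac \<phi> u) * tdiv (unit_normal \<phi> u) (DX (\<phi> u)))"
      proof (cases "u \<in> U \<and> \<phi> u \<in> C")
        case True
        then have "c < snd u" by (intro c) auto
        then show ?thesis using True by simp
      next
        case False
        then show ?thesis
          using C1_field_continuous(5)[OF X, of "\<phi> u"] by (cases "u \<in> U") (simp_all add: tdiv_0)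
      qed
    qed
    also have "\<dots> = - (\<integral>x. indicator U (x, c) * (X (\<phi> (x, c)) \<bullet> conormal_term \<phi> (x, c)) \<partial>lborel)"
      by (rule patch_first_variation[OF _ _ _ X]) (use lp' K Kc face_patch(4)[OF S lp(1)] in auto)
    also have "\<dots> = 0"
    proof -
      have z0: "indicator U (x, c) * (X (\<phi> (x, c)) \<bullet> conormal_term \<phi> (x, c)) = 0" for x
      proof (cases "(x,c) \<in> U")
        case True
        then have "\<phi> (x,c) \<notin> C" using c[of "(x,c)"] by auto
        then have "X (\<phi> (x,c)) = 0" by (rule C1_field_continuous(4)[OF X])
        then show ?thesis by simp
      qed simp
      show ?thesis unfolding z0 by simp
    qed
    finally show "(\<integral>x. divM DX x \<partial>\<mu>) = 0" .
  qed
qed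

text \<open>Each of the three patches leaves one boundary integral along the edge, and
  \<open>conormal_terms_cancel\<close> applies to their sum.\<close>

lemma edge_first_variation:
  assumes e: "e \<in> edges F" and p: "p \<in> e"
  shows "locally_stationary p"
proof -
  obtain T where T: "closed T" "foam_set F = \<Omega> \<inter> T" by (rule foam_set_closed_in)
  have "edge_point F e p" using foam e p by (auto simp: is_foam_def)
  then obtain W \<phi> U where W: "open W" "p \<in> W"
    and pt: "\<forall>i<3. open (U i) \<and> smooth_on (\<phi> i) (U i) \<and> immersion_on (\<phi> i) (U i) \<and>
           topological_embedding_on (\<phi> i) (U i \<inter> {(x, y). y \<ge> 0}) \<and>
           \<phi> i ` (U i \<inter> {(x, y). y = 0}) = e \<inter> W \<and>
           (\<exists>S\<in>faces F. local_param S (\<phi> i) (U i \<inter> {(x, y). y > 0}))"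
    and disj: "disjoint_family_on (\<lambda>i. \<phi> i ` (U i \<inter> {(x, y). y > 0})) {..<3::nat}"
    and cov: "foam_set F \<inter> W = (\<Union>i<3. \<phi> i ` (U i \<inter> {(x, y). y \<ge> 0}))"
    and ang: "\<forall>i<3. \<forall>j<3. i \<noteq> j \<longrightarrow>
           (\<forall>a b. (a, 0) \<in> U i \<and> (b, 0) \<in> U j \<and> \<phi> i (a, 0) = \<phi> j (b, 0) \<longrightarrow>
              vec_angle (conormal (\<phi> i) (a, 0)) (conormal (\<phi> j) (b, 0)) = 2 * pi / 3)"
    unfolding edge_point_def by auto
  define P where "P i = U i \<inter> {u :: plane. 0 < snd u}" for i
  define D where "D i = U i \<inter> {u :: plane. 0 \<le> snd u}" for i
  define B where "B i = U i \<inter> {u :: plane. snd u = 0}" for i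
  have DPB: "D i = P i \<union> B i" for i by (auto simp: D_def P_def B_def)
  have U: "open (U i)" "smooth_on (\<phi> i) (U i)" "immersion_on (\<phi> i) (U i)"
    "topological_embedding_on (\<phi> i) (U i \<inter> {(x, y). y \<ge> 0})" "\<phi> i ` (U i \<inter> {(x, y). y = 0}) = e \<inter> W"
    "\<exists>S\<in>faces F. local_param S (\<phi> i) (P i)" "topological_embedding_on (\<phi> i) (D i)" "\<phi> i ` B i = e \<inter> W" if "i < 3" for i
    using pt that by (auto simp: P_def D_def B_def half_plane_sets)
  have disj': "\<phi> i ` P i \<inter> \<phi> j ` P j = {}" if "i < 3" "j < 3" "i \<noteq> j" for i j
    using disj that by (simp add: disjoint_family_on_def P_def half_plane_sets)
  have cov': "foam_set F \<inter> W = (\<Union>i<3. \<phi> i ` D i)" using cov by (simp add: D_def half_plane_sets)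
  have PM: "\<phi> i ` P i \<subseteq> M" and Popen: "openin (top_of_set (foam_set F)) (\<phi> i ` P i)" if "i < 3" for i
    using U(6)[OF that] face_patch(2,3) by blast+
  have Me: "M \<inter> e = {}" using foam e by (auto simp: is_foam_def disjnt_def)
  have MF: "M \<subseteq> foam_set F" by (auto simp: foam_set_def)
  have Pe: "\<phi> i ` P i \<inter> \<phi> j ` B j = {}" if "i < 3" "j < 3" for i j
    using PM[OF that(1)] U(8)[OF that(2)] Me by blast
  \<comment> \<open>Removing the other two open patches from the foam near the edge leaves exactly
    this closed half-patch. It is therefore relatively closed, which gives the compactness in
    \<open>K\<close> below.\<close>
  have compl: "\<phi> i ` D i = foam_set F \<inter> W - (\<Union>j\<in>{..<3}-{i}. \<phi> j ` P j)" if i: "i < 3" for i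
  proof (intro equalityI subsetI)
    fix x assume x: "x \<in> \<phi> i ` D i"
    then have "x \<in> foam_set F \<inter> W" unfolding cov' using i by blast
    moreover have "x \<notin> \<phi> j ` P j" if "j < 3" "j \<noteq> i" for j
      using x disj'[OF i that(1)] Pe[OF that(1) i] that(2) unfolding DPB by blast
    ultimately show "x \<in> foam_set F \<inter> W - (\<Union>j\<in>{..<3}-{i}. \<phi> j ` P j)" by blast
  next
    fix x assume x: "x \<in> foam_set F \<inter> W - (\<Union>j\<in>{..<3}-{i}. \<phi> j ` P j)"
    then obtain j where j: "j < 3" "x \<in> \<phi> j ` D j" unfolding cov' by blast
    show "x \<in> \<phi> i ` D i"
    proof (cases "j = i")
      case False
      then have "x \<in> \<phi> j ` B j" using x j unfolding DPB by blast
      then have "x \<in> \<phi> i ` B i" using U(8) i j by blast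
      then show ?thesis unfolding DPB by blast
    qed (use j in simp)
  qed
  show ?thesis unfolding locally_stationary_def
  proof (intro exI conjI allI impI)
    show "open (W \<inter> \<Omega>)" using W \<Omega> by auto
    have "p \<in> foam_set F" using e p by (auto simp: foam_set_def)
    then show "p \<in> W \<inter> \<Omega>" using W T by auto
    fix X DX C assume X: "C1_field X DX C" and C: "C \<subseteq> W \<inter> \<Omega>"
    have cC: "compact C" using X by (simp add: C1_field_def)
    have K: "compact {u \<in> U i. 0 \<le> snd u \<and> \<phi> i u \<in> C}" if i: "i < 3" for i
    proof -
      have "openin (top_of_set (foam_set F)) (\<Union>j\<in>{..<3}-{i}. \<phi> j ` P j)"
        by (rule openin_Union) (use Popen in auto)
      then obtain O1 where O1: "open O1" "(\<Union>j\<in>{..<3}-{i}. \<phi> j ` P j) = foam_set F \<inter> O1" by (auto simp: openin_open)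
      have "C \<inter> \<phi> i ` D i = C \<inter> (T \<inter> - O1)" unfolding compl[OF i] O1(2) T(2) using C by auto
      then have "compact (C \<inter> \<phi> i ` D i)" using cC T O1 by (simp only:) (intro compact_Int_closed closed_Int, auto)
      moreover obtain \<psi> where "homeomorphism (D i) (\<phi> i ` D i) (\<phi> i) \<psi>"
        using U(7)[OF i] unfolding topological_embedding_on_def by blast
      ultimately have "compact {u \<in> D i. \<phi> i u \<in> C}" by (intro homeomorphism_preimage_compact)
      moreover have "{u \<in> U i. 0 \<le> snd u \<and> \<phi> i u \<in> C} = {u \<in> D i. \<phi> i u \<in> C}" by (auto simp: D_def)
      ultimately show ?thesis by simp
    qed
    have split: "divM DX x = (\<Sum>i<3. indicator (\<phi> i ` P i) x * divM DX x)" for x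
    proof (cases "x \<in> M \<and> x \<in> C")
      case True
      then have "x \<in> foam_set F \<inter> W" using MF C by blast
      then obtain i where i: "i < 3" "x \<in> \<phi> i ` D i" unfolding cov' by blast
      \<comment> \<open>A point of a face is on no edge, so it lies in the open part of its
        patch.\<close>
      then have xi: "x \<in> \<phi> i ` P i" using True Me U(8)[OF i(1)] unfolding DPB by blast
      have "(\<Sum>j<3. indicator (\<phi> j ` P j) x * divM DX x) = (\<Sum>j\<in>{i}. indicator (\<phi> j ` P j) x * divM DX x)"
      proof (rule sum.mono_neutral_right)
        show "\<forall>j\<in>{..<3} - {i}. indicator (\<phi> j ` P j) x * divM DX x = 0"
          using disj'[OF i(1)] xi by (auto simp: indicator_def)
      qed (use i in auto)
      then show ?thesis using xi by simp
    next
      case False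
      then have "divM DX x = 0" using divM_outside[OF X, of x] divM_off_M[of x DX] by blast
      then show ?thesis by simp
    qed
    have Pb: "\<phi> i ` P i \<in> sets borel" if i: "i < 3" for i
    proof -
      obtain S where "S \<in> faces F" "local_param S (\<phi> i) (P i)" using U(6)[OF i] by blast
      then have lp: "local_param M (\<phi> i) (P i)" by (rule face_patch(1))
      then show ?thesis by (intro local_param_image_borel[OF lp]) (auto simp: local_param_def)
    qed
    have "(\<integral>x. divM DX x \<partial>\<mu>) = (\<integral>x. (\<Sum>i<3. indicator (\<phi> i ` P i) x * divM DX x) \<partial>\<mu>)"
      by (subst split) (rule refl)
    also have "\<dots> = (\<Sum>i<3. \<integral>x. indicator (\<phi> i ` P i) x * divM DX x \<partial>\<mu>)"
    proof (rule Bochner_Integration.integral_sum)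
      fix i :: nat assume "i \<in> {..<3}"
      then have "\<phi> i ` P i \<in> sets \<mu>" using Pb sets_eq by auto
      from integrable_mult_indicator[OF this divM_integrable[OF X]]
      show "integrable \<mu> (\<lambda>x. indicator (\<phi> i ` P i) x * divM DX x)" by simp
    qed
    also have "\<dots> = (\<Sum>i<3. - (\<integral>x. indicator (U i) (x, 0) * (X (\<phi> i (x, 0)) \<bullet> conormal_term (\<phi> i) (x, 0)) \<partial>lborel))"
    proof (rule sum.cong[OF refl])
      fix i :: nat assume "i \<in> {..<3}"
      then have i: "i < 3" by simp
      obtain S where S: "S \<in> faces F" and lp: "local_param S (\<phi> i) (P i)" using U(6)[OF i] by blast
      have "(\<integral>x. indicator (\<phi> i ` P i) x * divM DX x \<partial>\<mu>)
        = (\<integral>u. indicator (U i \<inter> {u. 0 < snd u}) u * (norm (jac (\<phi> i) u) * tdiv (unit_normal (\<phi> i) u) (DX (\<phi> i u))) \<partial>lborel)"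
        using integral_div_patch[OF S lp X] by (simp add: P_def)
      also have "\<dots> = - (\<integral>x. indicator (U i) (x, 0) * (X (\<phi> i (x, 0)) \<bullet> conormal_term (\<phi> i) (x, 0)) \<partial>lborel)"
        by (rule patch_first_variation[OF U(1-3)[OF i] X K[OF i]]) (rule face_patch(4)[OF S lp], simp add: P_def)
      finally show "(\<integral>x. indicator (\<phi> i ` P i) x * divM DX x \<partial>\<mu>)
        = - (\<integral>x. indicator (U i) (x, 0) * (X (\<phi> i (x, 0)) \<bullet> conormal_term (\<phi> i) (x, 0)) \<partial>lborel)" .
    qed
    also have "\<dots> = 0"
    proof -
      have "(\<Sum>i<3. \<integral>x. indicator (U i) (x, 0) * (X (\<phi> i (x, 0)) \<bullet> conormal_term (\<phi> i) (x, 0)) \<partial>lborel) = 0"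
        by (rule conormal_terms_cancel[OF U(1-5) _ X K]) (use ang in blast)+
      then show ?thesis unfolding sum_negf by simp
    qed
    finally show "(\<integral>x. divM DX x \<partial>\<mu>) = 0" .
  qed
qed

theorem foam_first_variation:
  assumes X: "C1_field X DX C" and C: "C \<subseteq> \<Omega> - vertices F"
  shows "(\<integral>x. divM DX x \<partial>\<mu>) = 0"
proof (rule first_variation_local_to_global[OF _ X C])
  fix p assume p: "p \<in> \<Omega> - vertices F"
  show "locally_stationary p"
  proof (cases "p \<in> foam_set F")
    case True
    then show ?thesis using p face_first_variation edge_first_variation unfolding foam_set_def by blast
  qed (use p off_foam_first_variation in blast)
qed

end

section \<open>Monotonicity\<close>

text \<open>For 0 \<le> y \<le> 1 this is 1 - (1 - y^2)^2: a nondecreasing C^1 step from 0 to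
  1.\<close>

definition cutoff :: "real \<Rightarrow> real" where "cutoff y = 1 - sq_pos (1 - sq_pos y)"
definition cutoff' :: "real \<Rightarrow> real" where "cutoff' y = 2 * max 0 (1 - sq_pos y) * (2 * max 0 y)"

lemma sq_pos_continuous: "continuous_on UNIV sq_pos"
  unfolding sq_pos_def[abs_def] by (intro continuous_intros)

lemma cutoff_deriv: "(cutoff has_real_derivative cutoff' y) (at y)"
proof -
  have "((\<lambda>y. 1 - sq_pos y) has_real_derivative - (2 * max 0 y)) (at y)"
    by (rule DERIV_cong[OF DERIV_diff[OF DERIV_const sq_pos_deriv]]) simp
  from DERIV_chain'[OF this sq_pos_deriv]
  have "((\<lambda>y. sq_pos (1 - sq_pos y)) has_real_derivative 2 * max 0 (1 - sq_pos y) * - (2 * max 0 y)) (at y)" .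
  from DERIV_diff[OF DERIV_const this, of 1]
  show ?thesis unfolding cutoff_def[abs_def] cutoff'_def by simp
qed

lemma cutoff'_continuous: "continuous_on UNIV cutoff'"
  unfolding cutoff'_def[abs_def]
  by (intro continuous_intros continuous_on_subset[OF sq_pos_continuous]) auto

lemma cutoff_values: "y \<le> 0 \<Longrightarrow> cutoff y = 0" "y \<le> 0 \<Longrightarrow> cutoff' y = 0"
    "1 \<le> y \<Longrightarrow> cutoff y = 1" "1 \<le> y \<Longrightarrow> cutoff' y = 0" "cutoff' y \<ge> 0" "cutoff y \<ge> 0"
proof -
  show "y \<le> 0 \<Longrightarrow> cutoff y = 0" "y \<le> 0 \<Longrightarrow> cutoff' y = 0" "cutoff' y \<ge> 0"
    by (simp_all add: cutoff_def cutoff'_def sq_pos_def max_absorb1)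
  have 1: "sq_pos y \<ge> 1" if "1 \<le> y"
    using that power_mono[of 1 y 2] by (simp add: sq_pos_def)
  show "1 \<le> y \<Longrightarrow> cutoff y = 1" "1 \<le> y \<Longrightarrow> cutoff' y = 0"
    using 1 by (simp_all add: cutoff_def cutoff'_def sq_pos_def[of "1 - sq_pos y"] max_absorb1)
  have "0 \<le> sq_pos y" by (simp add: sq_pos_def)
  then have "(max 0 (1 - sq_pos y))\<^sup>2 \<le> 1\<^sup>2" by (intro power_mono) auto
  then show "cutoff y \<ge> 0" by (simp add: cutoff_def sq_pos_def[of "1 - sq_pos y"])
qed

text \<open>A C^1 approximation of the positive part of 1/max(s0, t) - 1/T: the derivative -1/t^2 is
  multiplied by a trapezoid \<open>c\<close> that is 1 on [s, T'] and 0 outside (s0, T). The bounds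
  \<open>- 1 / t \<le> Q' t * t\<close> and \<open>1 / t - 1 / T' \<le> Q t\<close> together give Q
  + t Q' \<ge> -1/T' on [s, T'].\<close>

lemma radial_profile:
  fixes s0 s T' T :: real
  assumes "0 < s0" "s0 < s" "s < T'" "T' < T"
  obtains Q Q' where "\<And>t. (Q has_real_derivative Q' t) (at t)" "continuous_on UNIV Q'"
    "\<And>t. T \<le> t \<Longrightarrow> Q t = 0" "\<And>t. T \<le> t \<Longrightarrow> Q' t = 0" "\<And>t. t \<le> s0 \<Longrightarrow> Q' t = 0" "\<And>t. Q' t \<le> 0" "\<And>t. Q t \<ge> 0"
    "\<And>t. 0 < t \<Longrightarrow> - 1 / t \<le> Q' t * t" "\<And>t. t \<le> s \<Longrightarrow> 1 / s - 1 / T' \<le> Q t"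
    "\<And>t. s \<le> t \<Longrightarrow> t \<le> T' \<Longrightarrow> 1 / t - 1 / T' \<le> Q t"
proof -
  define c where "c t = max 0 (min 1 (min ((t - s0) / (s - s0)) ((T - t) / (T - T'))))" for t
  \<comment> \<open>\<open>c t / t\<^sup>2\<close>, written so that it is visibly continuous at \<open>0\<close>\<close>
  define q where "q t = c t / (max s0 t)\<^sup>2" for t
  have c01: "0 \<le> c t" "c t \<le> 1" for t by (auto simp: c_def)
  have c0: "c t = 0" if "t \<le> s0 \<or> T \<le> t" for t
  proof -
    have "(t - s0) / (s - s0) \<le> 0 \<or> (T - t) / (T - T') \<le> 0"
      using that assms by (auto intro: divide_nonpos_pos)
    then show ?thesis unfolding c_def by linarith
  qed
  have c1: "c t = 1" if "s \<le> t" "t \<le> T'" for t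
  proof -
    have "1 \<le> (t - s0) / (s - s0)" "1 \<le> (T - t) / (T - T')" using that assms by auto
    then show ?thesis unfolding c_def by linarith
  qed
  have q_nonneg: "q t \<ge> 0" for t using c01 by (simp add: q_def)
  have contq: "continuous_on UNIV q"
    unfolding q_def[abs_def] c_def[abs_def] using assms by (intro continuous_intros) auto
  have "\<exists>G. \<forall>x. -\<infinity> < ereal x \<longrightarrow> ereal x < \<infinity> \<longrightarrow> (G has_vector_derivative q x) (at x)"
    by (rule einterval_antiderivative) (use contq in \<open>auto simp: continuous_on_eq_continuous_at\<close>)
  then obtain G where G: "\<And>x. (G has_real_derivative q x) (at x)"
    by (auto simp: has_real_derivative_iff_has_vector_derivative)
  define Q where "Q t = G T - G t" for t
  define Q' where "Q' t = - q t" for t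
  have Qd: "(Q has_real_derivative Q' t) (at t)" for t
    unfolding Q_def[abs_def] Q'_def by (rule DERIV_cong[OF DERIV_diff[OF DERIV_const G]]) simp
  have anti: "Q b \<le> Q a" if "a \<le> b" for a b
    by (rule DERIV_nonpos_imp_nonincreasing[OF that]) (use Qd q_nonneg in \<open>auto simp: Q'_def intro!: exI\<close>)
  have QT: "Q t = 0" if t: "T \<le> t" for t
  proof -
    have "Q T \<le> Q t"
    proof (rule DERIV_nonneg_imp_nondecreasing[OF t])
      fix x assume "T \<le> x" "x \<le> t"
      then show "\<exists>y. (Q has_real_derivative y) (at x) \<and> 0 \<le> y" using Qd[of x] c0[of x] by (auto simp: Q'_def q_def)
    qed
    moreover have "Q T = 0" by (simp add: Q_def)
    ultimately show ?thesis using anti[OF t] by simp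
  qed
  have Qnn: "Q t \<ge> 0" for t
    using anti[of t T] QT[of T] QT[of t] by (cases "t \<le> T") auto
  have Qmid: "1 / t - 1 / T' \<le> Q t" if t: "s \<le> t" "t \<le> T'" for t
  proof -
    have "Q T' - 1 / T' \<le> Q t - 1 / t"
    proof (rule DERIV_nonpos_imp_nonincreasing[OF t(2)])
      fix x assume x: "t \<le> x" "x \<le> T'"
      then have x0: "x > 0" "max s0 x = x" "c x = 1" using t assms c1[of x] by auto
      have "((\<lambda>x. Q x - 1 / x) has_real_derivative Q' x + 1 / x\<^sup>2) (at x)"
        using x0 Qd[of x] by (auto intro!: derivative_eq_intros simp: power2_eq_square)
      then show "\<exists>y. ((\<lambda>x. Q x - 1 / x) has_real_derivative y) (at x) \<and> y \<le> 0"
        using x0 by (intro exI[of _ "Q' x + 1 / x\<^sup>2"]) (simp add: Q'_def q_def)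
    qed
    then show ?thesis using Qnn[of T'] by linarith
  qed
  show ?thesis
  proof (rule that[of Q Q'])
    show "continuous_on UNIV Q'" unfolding Q'_def[abs_def] by (intro continuous_intros contq)
    show "Q' t = 0" if "T \<le> t" for t using c0[of t] that by (simp add: Q'_def q_def)
    show "Q' t = 0" if "t \<le> s0" for t using c0[of t] that by (simp add: Q'_def q_def)
    show "Q' t \<le> 0" for t using q_nonneg[of t] by (simp add: Q'_def)
    show "- 1 / t \<le> Q' t * t" if t: "0 < t" for t
    proof (cases "t \<le> s0")
      case True
      then show ?thesis using c0[of t] t by (simp add: Q'_def q_def)
    next
      case False
      then have "Q' t * t = - (c t / t)" using t by (simp add: Q'_def q_def power2_eq_square max_def)
      moreover have "c t / t \<le> 1 / t" using c01[of t] t by (intro divide_right_mono) auto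
      ultimately show ?thesis by simp
    qed
    show "1 / s - 1 / T' \<le> Q t" if "t \<le> s" for t using Qmid[of s] anti[OF that] assms by simp
  qed (use Qd QT Qnn Qmid in auto)
qed

section \<open>Radial test fields and the growth of area in balls\<close>

context minimal_foam_measure
begin

text \<open>Over the tangent plane the identity has trace 2 and h -> (w.h) w has trace |w|^2 -
  (w.n)^2, with w = x - v. Differentiating |x - v|^2 supplies the factor 2 of the second
  term.\<close>

lemma radial_field:
  fixes g g' :: "real \<Rightarrow> real" and v :: space
  defines "q \<equiv> \<lambda>x. (x - v) \<bullet> (x - v)"
  defines "DX \<equiv> \<lambda>x h. g (q x) *\<^sub>R h + (g' (q x) * (2 * ((x - v) \<bullet> h))) *\<^sub>R (x - v)"
  assumes g: "\<And>t. (g has_real_derivative g' t) (at t)" "continuous_on UNIV g'"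
    and C: "compact C" "\<And>x. x \<notin> C \<Longrightarrow> g (q x) = 0 \<and> g' (q x) = 0"
  shows "C1_field (\<lambda>x. g (q x) *\<^sub>R (x - v)) DX C"
    "x \<in> M \<Longrightarrow> divM DX x = 2 * (g (q x) + g' (q x) * (q x - ((x - v) \<bullet> n x)\<^sup>2))"
proof -
  have qd: "(q has_derivative (\<lambda>h. 2 * ((x - v) \<bullet> h))) (at x)" for x
    unfolding q_def by (auto intro!: derivative_eq_intros simp: inner_commute)
  have gq: "((\<lambda>x. g (q x)) has_derivative (\<lambda>h. g' (q x) * (2 * ((x - v) \<bullet> h)))) (at x)" for x
    using has_derivative_compose[OF qd g(1)[unfolded has_field_derivative_def]] .
  have cg: "continuous_on UNIV g" using g(1) by (intro DERIV_continuous_on) auto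
  have cq: "continuous_on UNIV q" unfolding q_def by (intro continuous_intros)
  show "C1_field (\<lambda>x. g (q x) *\<^sub>R (x - v)) DX C"
    unfolding C1_field_def
  proof (intro conjI allI impI C(1))
    fix x
    have "((\<lambda>x. g (q x) *\<^sub>R (x - v)) has_derivative (\<lambda>h. g (q x) *\<^sub>R (h - 0) + (g' (q x) * (2 * ((x - v) \<bullet> h))) *\<^sub>R (x - v))) (at x)"
      by (rule has_derivative_scaleR[OF gq has_derivative_diff[OF has_derivative_ident has_derivative_const]])
    then show "((\<lambda>x. g (q x) *\<^sub>R (x - v)) has_derivative DX x) (at x)" by (simp add: DX_def)
  next
    fix h
    show "continuous_on UNIV (\<lambda>x. DX x h)"
      unfolding DX_def
      by (intro continuous_intros continuous_on_compose2[OF cg cq] continuous_on_compose2[OF g(2) cq]) auto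
  next
    fix x assume "x \<notin> C"
    from C(2)[OF this] show "g (q x) *\<^sub>R (x - v) = 0" "DX x = (\<lambda>_. 0)" by (simp_all add: DX_def)
  qed
  assume x: "x \<in> M"
  then have n1: "n x \<bullet> n x = 1" using n_unit[OF x] by (simp add: dot_square_norm)
  define w where "w = x - v"
  define G where "G = g (q x)"
  define G' where "G' = g' (q x)"
  have qe: "q x = w $ 1 * w $ 1 + w $ 2 * w $ 2 + w $ 3 * w $ 3"
    by (simp add: q_def w_def inner_vec_def sum_3)
  have DXx: "DX x h = G *\<^sub>R h + (G' * (2 * (w \<bullet> h))) *\<^sub>R w" for h
    by (simp add: DX_def w_def G_def G'_def)
  have ax: "DX x (axis i 1) $ i = G + 2 * G' * (w $ i * w $ i)" for i
    unfolding DXx by (simp add: inner_axis)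
  have nn: "DX x (n x) \<bullet> n x = G + 2 * G' * (w \<bullet> n x)\<^sup>2"
    unfolding DXx using n1 by (simp add: inner_add_left power2_eq_square)
  have "tdiv (n x) (DX x) = 2 * (G + G' * (q x - (w \<bullet> n x)\<^sup>2))"
    unfolding tdiv_def ax nn qe by algebra
  then have "tdiv (n x) (DX x) = 2 * (g (q x) + g' (q x) * (q x - ((x - v) \<bullet> n x)\<^sup>2))"
    by (simp only: G_def G'_def w_def)
  then show "divM DX x = 2 * (g (q x) + g' (q x) * (q x - ((x - v) \<bullet> n x)\<^sup>2))" using x unfolding divM_def by simp
qed

text \<open>A lower bound for half the divergence is integrated: at least 1/s - k on the annulus, at
  least -k on the rest of the ball, where k is the bracket on the right. The parameters s0, s and T'
  are kept apart here to leave room for a C^1 profile.\<close>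

lemma monotonicity_annulus:
  fixes v :: space
  defines "q \<equiv> \<lambda>x. (x - v) \<bullet> (x - v)"
  assumes ball: "\<And>x. 0 < q x \<Longrightarrow> q x < r \<Longrightarrow> x \<in> \<Omega> - vertices F"
    and s: "0 < \<epsilon>" "2 * \<epsilon> < s0" "s0 < s" "s < T'" "T' < r"
  shows "measure \<mu> {x. 2 * \<epsilon> \<le> q x \<and> q x \<le> s0} / s \<le> (1 / T' + 1 / s0 - 1 / s) * measure \<mu> {x. q x < r}"
proof -
  interpret finite_measure \<mu> by (rule finite_measure)
  obtain T where T: "T' < T" "T < r" using dense s by blast
  obtain Q Q' where Q: "\<And>t. (Q has_real_derivative Q' t) (at t)" "continuous_on UNIV Q'"
    "\<And>t. T \<le> t \<Longrightarrow> Q t = 0" "\<And>t. T \<le> t \<Longrightarrow> Q' t = 0" "\<And>t. t \<le> s0 \<Longrightarrow> Q' t = 0" "\<And>t. Q' t \<le> 0" "\<And>t. Q t \<ge> 0"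
    "\<And>t. 0 < t \<Longrightarrow> - 1 / t \<le> Q' t * t" "\<And>t. t \<le> s \<Longrightarrow> 1 / s - 1 / T' \<le> Q t"
    "\<And>t. s \<le> t \<Longrightarrow> t \<le> T' \<Longrightarrow> 1 / t - 1 / T' \<le> Q t"
    by (rule radial_profile[of s0 s T' T]) (use s T in auto)
  define \<kappa> where "\<kappa> t = cutoff ((t - \<epsilon>) / \<epsilon>)" for t
  define \<kappa>' where "\<kappa>' t = cutoff' ((t - \<epsilon>) / \<epsilon>) * (1 / \<epsilon>)" for t
  have \<kappa>d: "(\<kappa> has_real_derivative \<kappa>' t) (at t)" for t
    unfolding \<kappa>_def[abs_def] \<kappa>'_def
    by (rule DERIV_chain'[OF _ cutoff_deriv]) (use s in \<open>auto intro!: derivative_eq_intros\<close>)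
  have \<kappa>: "\<kappa> t \<ge> 0" "\<kappa>' t \<ge> 0" for t using cutoff_values(5,6) s by (auto simp: \<kappa>_def \<kappa>'_def)
  have \<kappa>0: "\<kappa> t = 0" "\<kappa>' t = 0" if "t \<le> \<epsilon>" for t
  proof -
    have "(t - \<epsilon>) / \<epsilon> \<le> 0" using that s by (simp add: divide_nonpos_pos)
    then show "\<kappa> t = 0" "\<kappa>' t = 0" using cutoff_values(1,2) by (simp_all add: \<kappa>_def \<kappa>'_def)
  qed
  have \<kappa>1: "\<kappa> t = 1" if "2 * \<epsilon> \<le> t" for t
  proof -
    have "1 \<le> (t - \<epsilon>) / \<epsilon>" using that s by simp
    then show "\<kappa> t = 1" using cutoff_values(3) by (simp add: \<kappa>_def)
  qed
  define g where "g t = Q t * \<kappa> t" for t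
  define g' where "g' t = Q' t * \<kappa> t + \<kappa>' t * Q t" for t
  have gd: "(g has_real_derivative g' t) (at t)" for t
    unfolding g_def[abs_def] g'_def by (rule DERIV_mult[OF Q(1) \<kappa>d])
  have cg': "continuous_on UNIV g'"
  proof -
    have "continuous_on UNIV Q" "continuous_on UNIV \<kappa>" using Q(1) \<kappa>d by (auto intro: DERIV_continuous_on)
    moreover have "continuous_on UNIV \<kappa>'" unfolding \<kappa>'_def[abs_def]
      using s by (intro continuous_intros continuous_on_compose2[OF cutoff'_continuous]) auto
    ultimately show ?thesis unfolding g'_def[abs_def] by (intro continuous_intros Q(2))
  qed
  define C where "C = {x. \<epsilon> \<le> q x \<and> q x \<le> T}"
  have cq: "continuous_on UNIV q" unfolding q_def by (intro continuous_intros)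
  have qn: "q x = (norm (x - v))\<^sup>2" for x by (simp add: q_def power2_norm_eq_inner)
  have C: "compact C"
  proof -
    have "closed C" unfolding C_def by (intro closed_Collect_conj closed_Collect_le continuous_intros cq)
    moreover have "C \<subseteq> cball v (sqrt T)"
    proof
      fix x assume "x \<in> C"
      then have "(norm (x - v))\<^sup>2 \<le> T" by (simp add: C_def qn)
      then have "norm (x - v) \<le> sqrt T" by (rule real_le_rsqrt)
      then show "x \<in> cball v (sqrt T)" by (simp add: dist_norm norm_minus_commute)
    qed
    ultimately show ?thesis by (metis bounded_cball bounded_subset compact_eq_bounded_closed)
  qed
  have C0: "g (q x) = 0 \<and> g' (q x) = 0" if "x \<notin> C" for x
  proof -
    have "q x \<le> \<epsilon> \<or> T \<le> q x" using that by (auto simp: C_def)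
    then show ?thesis using \<kappa>0[of "q x"] Q(3,4)[of "q x"] by (auto simp: g_def g'_def)
  qed
  define DX where "DX = (\<lambda>x h. g (q x) *\<^sub>R h + (g' (q x) * (2 * ((x - v) \<bullet> h))) *\<^sub>R (x - v))"
  note rf = radial_field[OF gd cg' C C0[unfolded q_def]]
  have X: "C1_field (\<lambda>x. g (q x) *\<^sub>R (x - v)) DX C" unfolding DX_def q_def by (rule rf(1))
  have div: "divM DX x = 2 * (g (q x) + g' (q x) * (q x - ((x - v) \<bullet> n x)\<^sup>2))" if "x \<in> M" for x
    unfolding DX_def q_def by (rule rf(2)[OF _ that])
  have C\<Omega>: "C \<subseteq> \<Omega> - vertices F" using ball s T by (auto simp: C_def)
  have div0: "(\<integral>x. divM DX x \<partial>\<mu>) = 0" by (rule foam_first_variation[OF X C\<Omega>])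
  \<comment> \<open>1/T' is what survives in the limit. The loss 1/s0 - 1/s belongs to the zone
    between s0 and s, where t Q' is bounded below by -1/s0 but Q only by 1/s - 1/T'.\<close>
  define k where "k = 1 / T' + 1 / s0 - 1 / s"
  have pos: "0 < s0" "0 < s" "0 < T'" using s by auto
  have inv: "1 / s \<le> 1 / s0" "1 / T' \<le> 1 / s" using s by (auto intro!: divide_left_mono)
  have "1 / T' > 0" using pos by simp
  then have k0: "k \<ge> 0" using inv unfolding k_def by linarith
  define A where "A = {x. 2 * \<epsilon> \<le> q x \<and> q x \<le> s0}"
  define B where "B = {x. q x < r}"
  have bor: "A \<in> sets \<mu>" "B \<in> sets \<mu>"
    unfolding A_def B_def sets_eq
    by (intro borel_closed closed_Collect_conj closed_Collect_le borel_open open_Collect_less continuous_intros cq)+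
  have low: "indicator A x / s - k * indicator B x \<le> divM DX x / 2" if x: "x \<in> M" for x
  proof -
    \<comment> \<open>\<open>?p\<close> is the squared length of the tangential part of x -
      v.\<close>
    let ?t = "q x" and ?p = "q x - ((x - v) \<bullet> n x)\<^sup>2"
    have t0: "?t \<ge> 0" by (simp add: q_def)
    have "\<bar>(x - v) \<bullet> n x\<bar> \<le> norm (x - v) * norm (n x)" by (rule Cauchy_Schwarz_ineq2)
    then have "\<bar>(x - v) \<bullet> n x\<bar>\<^sup>2 \<le> (norm (x - v))\<^sup>2" using n_unit[OF x] by (intro power_mono) auto
    then have p: "0 \<le> ?p" "?p \<le> ?t" by (simp_all add: qn)
    have "g ?t + g' ?t * ?p = Q ?t * \<kappa> ?t + Q' ?t * \<kappa> ?t * ?p + \<kappa>' ?t * Q ?t * ?p"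
      by (simp add: g_def g'_def algebra_simps)
    moreover have "0 \<le> \<kappa>' ?t * Q ?t * ?p" using \<kappa> Q(7) p by simp
    moreover have "Q' ?t * ?t \<le> Q' ?t * \<kappa> ?t * ?p"
    proof (cases "?t \<le> s0")
      case False
      then have "\<kappa> ?t = 1" using \<kappa>1 s by simp
      then show ?thesis using mult_left_mono_neg[OF p(2) Q(6)[of ?t]] by simp
    qed (simp add: Q(5))
    ultimately have d: "Q ?t * \<kappa> ?t + Q' ?t * ?t \<le> divM DX x / 2" using div[OF x] by simp
    have "indicator A x / s - k * indicator B x \<le> Q ?t * \<kappa> ?t + Q' ?t * ?t"
    proof -
      \<comment> \<open>In order: inner cutoff, constant part of Q, transition from s0 to s, exact
        part, outer transition, outside the support.\<close>
      consider "?t < 2 * \<epsilon>" | "2 * \<epsilon> \<le> ?t" "?t \<le> s0" | "s0 < ?t" "?t \<le> s" | "s < ?t" "?t \<le> T'" | "T' < ?t" "?t < T" | "T \<le> ?t"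
        by linarith
      then show ?thesis
      proof cases
        case 1
        then have "indicator A x = (0::real)" "Q' ?t = 0" using s Q(5) by (auto simp: A_def)
        moreover have "0 \<le> Q ?t * \<kappa> ?t" using Q(7) \<kappa> by simp
        ultimately show ?thesis using k0 by (simp add: indicator_def)
      next
        case 2
        then have "indicator A x = (1::real)" "indicator B x = (1::real)" "Q' ?t = 0" "\<kappa> ?t = 1"
          using s Q(5) \<kappa>1 by (auto simp: A_def B_def)
        then show ?thesis using Q(9)[of ?t] 2 s inv by (simp add: k_def)
      next
        case 3
        then have i: "indicator A x = (0::real)" "indicator B x = (1::real)" "\<kappa> ?t = 1"
          using s \<kappa>1 by (auto simp: A_def B_def)
        have "1 / ?t \<le> 1 / s0" using 3 s by (intro divide_left_mono) auto
        then show ?thesis using i Q(8)[of ?t] Q(9)[of ?t] 3 s by (simp add: k_def)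
      next
        case 4
        then have i: "indicator A x = (0::real)" "indicator B x = (1::real)" "\<kappa> ?t = 1"
          using s \<kappa>1 by (auto simp: A_def B_def)
        then show ?thesis using Q(8)[of ?t] Q(10)[of ?t] 4 s inv by (simp add: k_def)
      next
        case 5
        then have i: "indicator A x = (0::real)" "indicator B x = (1::real)" "\<kappa> ?t = 1"
          using s T \<kappa>1 by (auto simp: A_def B_def)
        have "1 / ?t \<le> 1 / T'" using 5 s by (intro divide_left_mono) auto
        then show ?thesis using i Q(8)[of ?t] Q(7)[of ?t] 5 s inv by (simp add: k_def)
      next
        case 6
        then have "indicator A x = (0::real)" "Q ?t = 0" "Q' ?t = 0" using s T Q(3,4) by (auto simp: A_def)
        then show ?thesis using k0 by (simp add: indicator_def)
      qed
    qed
    with d show ?thesis by linarith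
  qed
  have AEM: "AE x in \<mu>. x \<in> M"
    by (rule AE_I[of _ _ "- M"]) (use off_M in \<open>auto simp: sets_eq\<close>)
  have "(\<integral>x. indicator A x / s - k * indicator B x \<partial>\<mu>) \<le> (\<integral>x. divM DX x / 2 \<partial>\<mu>)"
  proof (rule integral_mono_AE)
    show "integrable \<mu> (\<lambda>x. indicator A x / s - k * indicator B x)"
      using bor by (intro Bochner_Integration.integrable_diff integrable_divide integrable_mult_right integrable_real_indicator emeasure_finite) (auto simp: less_top[symmetric])
    show "integrable \<mu> (\<lambda>x. divM DX x / 2)" by (intro integrable_divide divM_integrable[OF X])
    show "AE x in \<mu>. indicator A x / s - k * indicator B x \<le> divM DX x / 2"
      using AEM by eventually_elim (rule low)
  qed
  also have "\<dots> = 0" using div0 by simp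
  also have "(\<integral>x. indicator A x / s - k * indicator B x \<partial>\<mu>) = measure \<mu> A / s - k * measure \<mu> B"
    using bor by (subst Bochner_Integration.integral_diff) (auto intro!: integrable_divide integrable_mult_right integrable_real_indicator simp: less_top[symmetric])
  finally show ?thesis by (simp add: A_def B_def k_def)
qed

text \<open>Three limits in \<open>monotonicity_annulus\<close>: the annuli exhaust the punctured
  ball, whose centre has measure 0 because it lies on no face; then T' tends to R^2, and last s
  tends to \<rho>^2.\<close>

theorem monotonicity:
  fixes v :: space
  assumes v: "v \<in> vertices F" and ball: "ball v R \<subseteq> \<Omega>" "ball v R \<inter> vertices F = {v}" and \<rho>: "0 < \<rho>" "\<rho> < R"
  shows "measure \<mu> (cball v \<rho>) / \<rho>\<^sup>2 \<le> measure \<mu> (ball v R) / R\<^sup>2"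
proof -
  interpret finite_measure \<mu> by (rule finite_measure)
  define q where "q x = (x - v) \<bullet> (x - v)" for x
  have qn: "q x = (dist v x)\<^sup>2" for x
    by (simp add: q_def dist_commute[of v x] dist_norm[of x v] power2_norm_eq_inner)
  have qball: "q x < R\<^sup>2 \<longleftrightarrow> x \<in> ball v R" "q x \<le> \<rho>\<^sup>2 \<longleftrightarrow> x \<in> cball v \<rho>" for x
    using \<rho> by (simp_all add: qn abs_le_square_iff[symmetric] flip: not_le)
  have B: "{x. q x < R\<^sup>2} = ball v R" using qball by auto
  have cq: "continuous_on UNIV q" unfolding q_def by (intro continuous_intros)
  define b where "b = measure \<mu> (ball v R)"
  define s0 where "s0 = \<rho>\<^sup>2"
  have s0: "0 < s0" "s0 < R\<^sup>2" using \<rho> by (auto simp: s0_def intro: power_strict_mono)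
  have bl: "x \<in> \<Omega> - vertices F" if "0 < q x" "q x < R\<^sup>2" for x
  proof -
    have "x \<in> ball v R" using that qball by simp
    moreover have "x \<noteq> v" using that by (auto simp: q_def)
    ultimately show ?thesis using ball by auto
  qed
  \<comment> \<open>With \<epsilon> = s0 / (4 (i + 1)) the squared inner radius 2 \<epsilon> is
    below s0 already for i = 0.\<close>
  define A where "A i = {x. 2 * (s0 / (4 * real (Suc i))) \<le> q x \<and> q x \<le> s0}" for i :: nat
  have Ab: "A i \<in> sets borel" for i
    unfolding A_def by (intro borel_closed closed_Collect_conj closed_Collect_le continuous_intros cq)
  have Ai: "measure \<mu> (A i) / s \<le> (1 / T' + 1 / s0 - 1 / s) * b" if "s0 < s" "s < T'" "T' < R\<^sup>2" for s T' i
    unfolding A_def b_def B[symmetric] q_def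
  proof (rule monotonicity_annulus)
    show "2 * (s0 / (4 * real (Suc i))) < s0" using s0 by (simp add: field_simps add_pos_nonneg)
    show "0 < s0 / (4 * real (Suc i))" using s0 by simp
  qed (use bl that in \<open>auto simp: q_def\<close>)
  have vM: "v \<notin> M" using v foam by (auto simp: is_foam_def disjnt_def)
  have vn: "{v} \<in> null_sets \<mu>"
  proof -
    have "emeasure \<mu> {v} \<le> emeasure \<mu> (- M)" by (rule emeasure_mono) (use vM sets_eq in auto)
    then show ?thesis using off_M sets_eq by (auto simp: null_sets_def)
  qed
  have "(\<Union>i. A i) = cball v \<rho> - {v}"
  proof (intro equalityI subsetI)
    fix x assume "x \<in> (\<Union>i. A i)"
    then obtain i where i: "2 * (s0 / (4 * real (Suc i))) \<le> q x" "q x \<le> s0" by (auto simp: A_def)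
    have "0 < 2 * (s0 / (4 * real (Suc i)))" using s0 by simp
    then have "0 < q x" using i by linarith
    then have "x \<noteq> v" by (auto simp: q_def)
    then show "x \<in> cball v \<rho> - {v}" using i qball(2) by (auto simp: s0_def)
  next
    fix x assume x: "x \<in> cball v \<rho> - {v}"
    then have q0: "q x > 0" "q x \<le> s0" using qball(2)[of x] by (auto simp: q_def s0_def)
    obtain i where "inverse (real (Suc i)) < 2 * q x / s0" using reals_Archimedean[of "2 * q x / s0"] q0 s0 by auto
    then have "2 * (s0 / (4 * real (Suc i))) \<le> q x" using s0 by (simp add: field_simps)
    then show "x \<in> (\<Union>i. A i)" using q0 by (auto simp: A_def)
  qed
  moreover have "incseq A"
  proof (rule incseq_SucI, rule subsetI)
    fix i x assume x: "x \<in> A i"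
    have "s0 / (4 * real (Suc (Suc i))) \<le> s0 / (4 * real (Suc i))" using s0 by (intro divide_left_mono) auto
    then show "x \<in> A (Suc i)" using x by (auto simp: A_def)
  qed
  ultimately have "(\<lambda>i. measure \<mu> (A i)) \<longlonglongrightarrow> measure \<mu> (cball v \<rho> - {v})"
    using finite_Lim_measure_incseq[of A] Ab sets_eq by auto
  moreover have "measure \<mu> (cball v \<rho> - {v}) = measure \<mu> (cball v \<rho>)"
    using measure_Diff_null_set[OF _ vn, of "cball v \<rho>"] sets_eq by auto
  ultimately have lim: "(\<lambda>i. measure \<mu> (A i)) \<longlonglongrightarrow> measure \<mu> (cball v \<rho>)" by simp
  define m where "m = measure \<mu> (cball v \<rho>)"
  have 1: "m / s \<le> (1 / T' + 1 / s0 - 1 / s) * b" if st: "s0 < s" "s < T'" "T' < R\<^sup>2" for s T'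
    unfolding m_def
    by (rule LIMSEQ_le_const2[OF tendsto_divide[OF lim tendsto_const]]) (use Ai[OF st] st s0 in auto)
  have 2: "m / s \<le> (1 / R\<^sup>2 + 1 / s0 - 1 / s) * b" if s: "s0 < s" "s < R\<^sup>2" for s
  proof (rule tendsto_lowerbound)
    show "((\<lambda>T'. (1 / T' + 1 / s0 - 1 / s) * b) \<longlongrightarrow> (1 / R\<^sup>2 + 1 / s0 - 1 / s) * b) (at_left (R\<^sup>2))"
      using s0 by (intro tendsto_intros) auto
    show "\<forall>\<^sub>F T' in at_left (R\<^sup>2). m / s \<le> (1 / T' + 1 / s0 - 1 / s) * b"
      using eventually_at_left_real[OF s(2)] by eventually_elim (use 1 s in auto)
  qed simp
  have "m / s0 \<le> (1 / R\<^sup>2 + 1 / s0 - 1 / s0) * b"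
  proof (rule tendsto_le)
    show "((\<lambda>s. (1 / R\<^sup>2 + 1 / s0 - 1 / s) * b) \<longlongrightarrow> (1 / R\<^sup>2 + 1 / s0 - 1 / s0) * b) (at_right s0)"
      using s0 by (intro tendsto_intros) auto
    show "((\<lambda>s. m / s) \<longlongrightarrow> m / s0) (at_right s0)" using s0 by (intro tendsto_intros) auto
    show "\<forall>\<^sub>F s in at_right s0. m / s \<le> (1 / R\<^sup>2 + 1 / s0 - 1 / s) * b"
      using eventually_at_right_real[OF s0(2)] by eventually_elim (use 2 in auto)
  qed simp
  then show ?thesis by (simp add: m_def b_def s0_def)
qed

end

section \<open>Density at a vertex\<close>

abbreviation tetra_angle :: real where "tetra_angle \<equiv> arccos (- (1 / 3))"
abbreviation tetra_sin :: real where "tetra_sin \<equiv> sqrt (8 / 9)"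

text \<open>The points (x, y) of the open quadrant for which x \<tau> + y \<tau>' has length below
  r, where \<tau>, \<tau>' are unit vectors with inner product -1/3. The image is a circular sector
  of angle arccos(-1/3), and the linear map scales area by \<open>tetra_sin\<close>, the sine of
  this angle.\<close>

definition sector :: "real \<Rightarrow> plane set" where
  "sector r = {u. 0 < fst u \<and> 0 < snd u \<and> (fst u)\<^sup>2 + (snd u)\<^sup>2 - 2 / 3 * fst u * snd u < r\<^sup>2}"

lemma sector_borel: "sector r \<in> sets borel"
  unfolding sector_def by (intro borel_open open_Collect_conj open_Collect_less continuous_intros)

text \<open>In the coordinates \<open>(x, t)\<close> with \<open>y = x t\<close> the \<open>x\<close>-integral is elementary and the \<open>t\<close>-integral is an arctangent.\<close>

lemma emeasure_sector:
  assumes r: "r > 0"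
  shows "emeasure lborel (sector r) = ennreal (r\<^sup>2 * tetra_angle / (2 * tetra_sin))"
proof -
  define p where "p t = 1 + t\<^sup>2 - 2 / 3 * t" for t :: real
  \<comment> \<open>Completing the square, with \<open>tetra_sin\<close> squared equal to 8/9 = 1 -
    (1/3)^2.\<close>
  have pc: "p t = tetra_sin\<^sup>2 + (t - 1/3)\<^sup>2" for t by (simp add: p_def power2_eq_square algebra_simps)
  have p0: "p t > 0" for t unfolding pc by (rule add_pos_nonneg) auto
  define f where "f x t = (if 0 < x \<and> 0 < t \<and> x\<^sup>2 * p t < r\<^sup>2 then ennreal x else 0)" for x t
  have pm[measurable]: "p \<in> borel_measurable borel" unfolding p_def[abs_def] by measurable
  have fm: "(\<lambda>(x,t). f x t) \<in> borel_measurable (lborel \<Otimes>\<^sub>M lborel)"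
    unfolding f_def by measurable
  note sector_borel[of r, measurable]
  have inner: "(\<integral>\<^sup>+y. indicator (sector r) (x, y) \<partial>lborel) = (\<integral>\<^sup>+t. f x t \<partial>lborel)" for x
  proof (cases "0 < x")
    case True
    have "(\<lambda>y. indicator (sector r) (x, y)) \<in> borel_measurable borel"
      using measurable_compose[OF measurable_Pair1'[of x borel borel] borel_measurable_indicator[of "sector r" "borel \<Otimes>\<^sub>M borel"]]
        sector_borel[of r] by (simp add: borel_prod)
    then have "(\<integral>\<^sup>+y. indicator (sector r) (x, y) \<partial>lborel) = \<bar>x\<bar> * (\<integral>\<^sup>+t. indicator (sector r) (x, 0 + x * t) \<partial>lborel)"
      using True by (intro nn_integral_real_affine) auto
    also have "\<dots> = (\<integral>\<^sup>+t. ennreal \<bar>x\<bar> * indicator (sector r) (x, 0 + x * t) \<partial>lborel)"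
    proof (rule nn_integral_cmult[symmetric])
      have "(\<lambda>t. x * t) \<in> borel_measurable borel" by measurable
      from measurable_compose[OF this \<open>(\<lambda>y. indicator (sector r) (x, y)) \<in> borel_measurable borel\<close>]
      show "(\<lambda>t. indicator (sector r) (x, 0 + x * t)) \<in> borel_measurable lborel" by simp
    qed
    also have "\<dots> = (\<integral>\<^sup>+t. f x t \<partial>lborel)"
    proof (rule nn_integral_cong)
      fix t
      have "x\<^sup>2 + (x * t)\<^sup>2 - 2 / 3 * x * (x * t) = x\<^sup>2 * p t" by (simp add: p_def power2_eq_square algebra_simps)
      then have "(x, 0 + x * t) \<in> sector r \<longleftrightarrow> 0 < t \<and> x\<^sup>2 * p t < r\<^sup>2"
        using True by (simp add: sector_def zero_less_mult_iff)
      then show "ennreal \<bar>x\<bar> * indicator (sector r) (x, 0 + x * t) = f x t"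
        using True by (simp add: f_def indicator_def)
    qed
    finally show ?thesis .
  qed (simp add: sector_def f_def)
  have outer: "(\<integral>\<^sup>+x. f x t \<partial>lborel) = ennreal (r\<^sup>2 / 2 / p t) * indicator {0<..} t" for t
  proof (cases "0 < t")
    case True
    define a where "a = r / sqrt (p t)"
    have a: "a > 0" "a\<^sup>2 = r\<^sup>2 / p t" using r p0[of t] by (auto simp: a_def power_divide)
    have "x\<^sup>2 * p t < r\<^sup>2 \<longleftrightarrow> x < a" if "x > 0" for x
    proof -
      have "x\<^sup>2 * p t < r\<^sup>2 \<longleftrightarrow> x\<^sup>2 < a\<^sup>2" using p0[of t] a(2) by (simp add: pos_less_divide_eq)
      also have "\<dots> \<longleftrightarrow> x < a" using a(1) that power2_less_imp_less[of x a] power_strict_mono[of x a 2] by auto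
      finally show ?thesis .
    qed
    then have "(\<integral>\<^sup>+x. f x t \<partial>lborel) = (\<integral>\<^sup>+x. ennreal x * indicator {0<..<a} x \<partial>lborel)"
      using True by (intro nn_integral_cong) (auto simp: f_def indicator_def)
    also have "\<dots> = ennreal ((a\<^sup>2 - 0\<^sup>2) / 2)"
      by (rule nn_integral_has_integral_lebesgue')
        (use ident_has_integral[of 0 a] a in \<open>auto simp: has_integral_Icc_iff_Ioo\<close>)
    also have "(a\<^sup>2 - 0\<^sup>2) / 2 = r\<^sup>2 / 2 / p t" by (simp add: a(2) mult.commute)
    finally show ?thesis using True by simp
  qed (simp add: f_def)
  define G where "G t = r\<^sup>2 / (2 * tetra_sin) * arctan ((t - 1/3) / tetra_sin)" for t
  have s0: "tetra_sin > 0" by simp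
  have Gd: "(G has_real_derivative r\<^sup>2 / 2 / p t) (at t)" for t
  proof -
    have "((\<lambda>t. arctan ((t - 1/3) / tetra_sin)) has_real_derivative (1 / tetra_sin) / (1 + ((t - 1/3) / tetra_sin)\<^sup>2)) (at t)"
    proof -
      have "((\<lambda>t. (t - 1/3) / w) has_real_derivative 1 / w) (at t)" for w :: real
        by (rule DERIV_cdivide) (auto intro!: derivative_eq_intros)
      from DERIV_chain'[OF this DERIV_arctan] show ?thesis
        by (rule DERIV_cong) (simp only: divide_inverse mult.commute mult_1_left)
    qed
    from DERIV_cmult[OF this, of "r\<^sup>2 / (2 * tetra_sin)"]
    have "(G has_real_derivative r\<^sup>2 / (2 * tetra_sin) * ((1 / tetra_sin) / (1 + ((t - 1/3) / tetra_sin)\<^sup>2))) (at t)"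
      by (simp only: G_def[abs_def])
    moreover have "r\<^sup>2 / (2 * tetra_sin) * ((1 / tetra_sin) / (1 + ((t - 1/3) / tetra_sin)\<^sup>2)) = r\<^sup>2 / 2 / p t"
    proof -
      have gen: "r\<^sup>2 / (2 * s) * ((1 / s) / (1 + (w / s)\<^sup>2)) = r\<^sup>2 / 2 / (s\<^sup>2 + w\<^sup>2)" if "s > 0" for s w :: real
      proof -
        have "s\<^sup>2 + w\<^sup>2 > 0" using that by (simp add: add_pos_nonneg)
        then have "1 + (w / s)\<^sup>2 = (s\<^sup>2 + w\<^sup>2) / s\<^sup>2" using that by (simp add: power_divide add_divide_distrib)
        then show ?thesis using that by (simp add: power2_eq_square)
      qed
      show ?thesis unfolding pc by (rule gen[OF s0])
    qed
    ultimately show ?thesis by (simp only:)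
  qed
  have limit: "(G \<longlongrightarrow> r\<^sup>2 / (2 * tetra_sin) * (pi / 2)) at_top"
  proof -
    have "filterlim (\<lambda>t. (t - 1/3) / w) at_top at_top" if "w > 0" for w :: real
    proof -
      have "filterlim (\<lambda>t. - (1/3) / w + 1 / w * t) at_top at_top"
        by (rule filterlim_tendsto_add_at_top[OF tendsto_const
              filterlim_tendsto_pos_mult_at_top[OF tendsto_const _ filterlim_ident]]) (use that in simp)
      then show ?thesis by (simp add: diff_divide_distrib)
    qed
    from this[OF s0] have "filterlim (\<lambda>t. (t - 1/3) / tetra_sin) at_top at_top" .
    from filterlim_compose[OF tendsto_arctan_at_top this]
    show ?thesis unfolding G_def[abs_def] by (intro tendsto_intros)
  qed
  \<comment> \<open>The lower limit t = 0 contributes the arctangent of -1/(3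
    \<open>tetra_sin\<close>), and pi/2 minus that is arccos(-1/3).\<close>
  have G0: "r\<^sup>2 / (2 * tetra_sin) * (pi / 2) - G 0 = r\<^sup>2 * tetra_angle / (2 * tetra_sin)"
  proof -
    have "tetra_angle = pi / 2 - arctan (- (1/3) / sqrt (1 - (- (1/3))\<^sup>2))" by (rule arccos_arctan) auto
    also have "1 - (- (1/3))\<^sup>2 = (8 / 9 :: real)" by (simp add: power2_eq_square)
    finally have th: "tetra_angle = pi / 2 - arctan (- (1/3) / tetra_sin)" .
    have "r\<^sup>2 / w * (pi / 2) - r\<^sup>2 / w * X = r\<^sup>2 * (pi / 2 - X) / w" for w X :: real
      by (simp add: right_diff_distrib diff_divide_distrib)
    then show ?thesis unfolding th G_def diff_0 .
  qed
  have "emeasure lborel (sector r) = (\<integral>\<^sup>+u. indicator (sector r) u \<partial>(lborel \<Otimes>\<^sub>M lborel))"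
    by (simp add: lborel_prod)
  also have "\<dots> = (\<integral>\<^sup>+x. \<integral>\<^sup>+y. indicator (sector r) (x, y) \<partial>lborel \<partial>lborel)"
    by (rule lborel.nn_integral_fst[symmetric]) (simp add: lborel_prod)
  also have "\<dots> = (\<integral>\<^sup>+x. \<integral>\<^sup>+t. f x t \<partial>lborel \<partial>lborel)" by (simp only: inner)
  also have "\<dots> = (\<integral>\<^sup>+t. \<integral>\<^sup>+x. f x t \<partial>lborel \<partial>lborel)"
    by (rule lborel_pair.Fubini'[OF fm, symmetric])
  also have "\<dots> = (\<integral>\<^sup>+t. ennreal (r\<^sup>2 / 2 / p t) * indicator {0<..} t \<partial>lborel)" by (simp only: outer)
  also have "\<dots> = (\<integral>\<^sup>+t. ennreal (r\<^sup>2 / 2 / p t) * indicator {0..} t \<partial>lborel)"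
    using AE_lborel_singleton[of "0::real"]
    by (intro nn_integral_cong_AE) (auto elim!: eventually_mono simp: indicator_def)
  also have "\<dots> = ennreal (r\<^sup>2 / (2 * tetra_sin) * (pi / 2) - G 0)"
    by (rule nn_integral_FTC_atLeast[OF _ Gd _ limit]) (use less_imp_le[OF p0] in simp_all)
  finally show ?thesis by (simp only: G0)
qed

text \<open>Near the corner \<phi> is close to its linearization L. So it takes the sector of radius
  \<rho>/(1 + \<eta>) into the ball of radius \<rho>, and the area density there stays above (1 -
  \<eta>) \<open>tetra_sin\<close>.\<close>

lemma corner_patch_area:
  fixes \<phi> :: "plane \<Rightarrow> space"
  assumes U: "open U" "(0, 0) \<in> U" and C1: "C_k 1 \<phi> U"
    and \<tau>: "norm (d_x \<phi> (0, 0)) = 1" "norm (d_y \<phi> (0, 0)) = 1" "d_x \<phi> (0, 0) \<bullet> d_y \<phi> (0, 0) = - (1 / 3)"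
    and \<eta>: "0 < \<eta>" "\<eta> < 1"
  shows "\<forall>\<^sub>F \<rho> in at_right 0. ennreal ((1 - \<eta>) / (1 + \<eta>)\<^sup>2 * (\<rho>\<^sup>2 * tetra_angle / 2))
     \<le> patch_area \<phi> (U \<inter> {(x, y). 0 < x \<and> 0 < y}) (cball (\<phi> (0, 0)) \<rho>)"
proof -
  define a where "a = d_x \<phi> (0, 0)"
  define b where "b = d_y \<phi> (0, 0)"
  have aa: "a \<bullet> a = 1" "b \<bullet> b = 1" "a \<bullet> b = - (1/3)" using \<tau> by (simp_all add: a_def b_def dot_square_norm)
  have diff: "\<phi> differentiable (at u)" if "u \<in> U" for u using C1 that by simp
  have "\<forall>h. C_k 0 (\<lambda>x. frechet_derivative \<phi> (at x) h) U" using C1 unfolding One_nat_def C_k.simps(2) by blast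
  then have cont: "continuous_on U (\<lambda>x. frechet_derivative \<phi> (at x) h)" for h unfolding C_k.simps(1) by blast
  have cJ: "continuous_on U (jac \<phi>)" unfolding jac_def d_x_def d_y_def by (intro continuous_on_cross cont)
  have J0: "norm (jac \<phi> (0,0)) = tetra_sin"
  proof -
    have "(norm (jac \<phi> (0,0)))\<^sup>2 = 8 / 9"
      using norm_cross_dot[of a b] \<tau> aa(3) by (simp add: jac_def a_def b_def power2_eq_square)
    then show ?thesis by (metis norm_ge_zero real_sqrt_unique)
  qed
  have d: "(\<phi> has_derivative (\<lambda>h. fst h *\<^sub>R a + snd h *\<^sub>R b)) (at (0,0))"
    using frechet_derivative_works[THEN iffD1, OF diff[OF U(2)]] frechet_derivative_plane[OF diff[OF U(2)]]
    by (simp add: a_def b_def has_derivative_eq_rhs fun_eq_iff)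
  define L where "L h = fst h *\<^sub>R a + snd h *\<^sub>R b" for h :: plane
  have LL: "(norm (L h))\<^sup>2 = (fst h)\<^sup>2 + (snd h)\<^sup>2 - 2 / 3 * fst h * snd h" for h
    unfolding power2_norm_eq_inner L_def
    using aa by (simp add: inner_add_left inner_add_right inner_commute[of b a] power2_eq_square algebra_simps)
  \<comment> \<open>The quadratic form x^2 + y^2 - (2/3) x y has smallest eigenvalue 2/3, which
    exceeds 1/4.\<close>
  have hL: "norm h \<le> 2 * norm (L h)" for h
  proof (rule power2_le_imp_le)
    have "(norm h)\<^sup>2 = (fst h)\<^sup>2 + (snd h)\<^sup>2" by (cases h) (simp add: norm_Pair)
    moreover have "(2 * norm (L h))\<^sup>2 = 4 * ((fst h)\<^sup>2 + (snd h)\<^sup>2 - 2 / 3 * fst h * snd h)"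
      by (simp add: power_mult_distrib LL)
    moreover have "0 \<le> (fst h)\<^sup>2 - 2 * fst h * snd h + (snd h)\<^sup>2" "0 \<le> (fst h)\<^sup>2" "0 \<le> (snd h)\<^sup>2"
      using zero_le_power2[of "fst h - snd h"] by (simp_all add: power2_diff)
    ultimately show "(norm h)\<^sup>2 \<le> (2 * norm (L h))\<^sup>2" by (simp only:) argo
  qed simp
  \<comment> \<open>The error is taken as \<eta>/2 because |h| \<le> 2 |L h| turns it into \<eta> |L
    h|.\<close>
  obtain \<delta>1 where \<delta>1: "\<delta>1 > 0" "\<And>u. norm (u - (0,0)) < \<delta>1 \<Longrightarrow> norm (\<phi> u - \<phi> (0,0) - L (u - (0,0))) \<le> \<eta> / 2 * norm (u - (0,0))"
    using d \<eta> unfolding has_derivative_at_alt L_def by (meson half_gt_zero)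
  obtain \<delta>2 where \<delta>2: "\<delta>2 > 0" "\<And>u. u \<in> U \<Longrightarrow> dist u (0,0) < \<delta>2 \<Longrightarrow> dist (jac \<phi> u) (jac \<phi> (0,0)) < \<eta> * tetra_sin"
  proof -
    have "\<eta> * tetra_sin > 0" using \<eta> by simp
    then show ?thesis using cJ[unfolded continuous_on_iff] U(2) that by blast
  qed
  obtain \<delta>3 where \<delta>3: "\<delta>3 > 0" "ball (0,0) \<delta>3 \<subseteq> U" using U openE by blast
  define \<rho>0 where "\<rho>0 = min \<delta>1 (min \<delta>2 \<delta>3) / 2"
  have \<rho>0: "\<rho>0 > 0" using \<delta>1 \<delta>2 \<delta>3 by (simp add: \<rho>0_def)
  show ?thesis
  proof (rule eventually_mono[OF eventually_at_right_real[OF \<rho>0]])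
    fix \<rho> assume \<rho>: "\<rho> \<in> {0<..<\<rho>0}"
    define r where "r = \<rho> / (1 + \<eta>)"
    have r: "0 < r" "r < \<rho>" using \<rho> \<eta> by (auto simp: r_def field_simps)
    let ?Q = "U \<inter> {(x, y). 0 < x \<and> 0 < y}"
    have pt: "ennreal ((1 - \<eta>) * tetra_sin) * indicator (sector r) u
      \<le> indicator (cball (\<phi> (0,0)) \<rho>) (\<phi> u) * ennreal (norm (jac \<phi> u)) * indicator ?Q u" for u
    proof (cases "u \<in> sector r")
      case True
      then have u: "0 < fst u" "0 < snd u" "(norm (L u))\<^sup>2 < r\<^sup>2" by (auto simp: sector_def LL)
      have Lr: "norm (L u) < r" using power2_less_imp_less[OF u(3)] r by simp
      have nu: "norm u < min \<delta>1 (min \<delta>2 \<delta>3)"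
        using hL[of u] Lr r \<rho> by (simp add: \<rho>0_def)
      have uz: "u - (0,0) = u" by (cases u) simp
      have uU: "u \<in> U" using \<delta>3 nu by (force simp: dist_norm zero_prod_def[symmetric])
      have "norm (\<phi> u - \<phi> (0,0)) \<le> norm (\<phi> u - \<phi> (0,0) - L u) + norm (L u)"
        using norm_triangle_ineq[of "\<phi> u - \<phi> (0,0) - L u" "L u"] by simp
      also have "\<dots> \<le> \<eta> / 2 * (2 * norm (L u)) + norm (L u)"
        using \<delta>1(2)[of u] nu hL[of u] \<eta> unfolding uz
        by (intro add_right_mono) (meson half_gt_zero less_imp_le min_less_iff_conj mult_left_mono order_trans)
      also have "\<dots> = (1 + \<eta>) * norm (L u)" by (simp add: algebra_simps)
      also have "\<dots> \<le> (1 + \<eta>) * r" using Lr \<eta> by (intro mult_left_mono) auto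
      also have "\<dots> = \<rho>" using \<eta> by (simp add: r_def)
      finally have inb: "\<phi> u \<in> cball (\<phi> (0,0)) \<rho>" by (simp add: dist_norm norm_minus_commute)
      have "dist u (0,0) < \<delta>2" using nu uz by (simp add: dist_norm)
      then have "norm (jac \<phi> u - jac \<phi> (0,0)) < \<eta> * tetra_sin" using \<delta>2(2)[OF uU] by (simp add: dist_norm)
      moreover have "norm (jac \<phi> (0,0)) \<le> norm (jac \<phi> u) + norm (jac \<phi> u - jac \<phi> (0,0))"
        using norm_triangle_ineq4[of "jac \<phi> u" "jac \<phi> u - jac \<phi> (0,0)"] by simp
      ultimately have "(1 - \<eta>) * tetra_sin \<le> norm (jac \<phi> u)" unfolding J0 by (simp add: algebra_simps)
      moreover have "u \<in> ?Q" using uU u by (cases u) simp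
      ultimately show ?thesis using True inb by (simp add: ennreal_leI)
    qed simp
    have "ennreal ((1 - \<eta>) / (1 + \<eta>)\<^sup>2 * (\<rho>\<^sup>2 * tetra_angle / 2)) = ennreal ((1 - \<eta>) * tetra_sin) * ennreal (r\<^sup>2 * tetra_angle / (2 * tetra_sin))"
    proof -
      have th: "tetra_angle \<ge> 0" by (rule arccos_lbound) auto
      have gen: "(1 - \<eta>) / (1 + \<eta>)\<^sup>2 * (\<rho>\<^sup>2 * th / 2) = ((1 - \<eta>) * s) * (r\<^sup>2 * th / (2 * s))" if "s > 0" for s th :: real
        using that \<eta> by (simp add: r_def power_divide)
      have "(1 - \<eta>) / (1 + \<eta>)\<^sup>2 * (\<rho>\<^sup>2 * tetra_angle / 2) = ((1 - \<eta>) * tetra_sin) * (r\<^sup>2 * tetra_angle / (2 * tetra_sin))"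
        by (rule gen) simp
      then show ?thesis using \<eta> by (simp only:) (rule ennreal_mult', simp)
    qed
    also have "\<dots> = (\<integral>\<^sup>+u. ennreal ((1 - \<eta>) * tetra_sin) * indicator (sector r) u \<partial>lborel)"
      unfolding emeasure_sector[OF r(1), symmetric]
      by (rule nn_integral_cmult_indicator[symmetric]) (use sector_borel in simp)
    also have "\<dots> \<le> patch_area \<phi> ?Q (cball (\<phi> (0,0)) \<rho>)"
      unfolding patch_area_def by (rule nn_integral_mono) (rule pt)
    finally show "ennreal ((1 - \<eta>) / (1 + \<eta>)\<^sup>2 * (\<rho>\<^sup>2 * tetra_angle / 2)) \<le> patch_area \<phi> ?Q (cball (\<phi> (0,0)) \<rho>)" .
  qed
qed

section \<open>Summing the corners at a vertex and passing to the limit\<close>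

lemma card_pairs: "card {(i :: nat, j). i < j \<and> j < 4} = 6" "finite {(i :: nat, j). i < j \<and> j < 4}"
proof -
  have "{(i :: nat, j). i < j \<and> j < 4} = {(0,1),(0,2),(0,3),(1,2),(1,3),(2,3)}"
    by (auto simp: numeral_eq_Suc less_Suc_eq)
  then show "card {(i :: nat, j). i < j \<and> j < 4} = 6" "finite {(i :: nat, j). i < j \<and> j < 4}" by simp_all
qed

context minimal_foam_measure
begin

text \<open>The six corner patches are charts with disjoint images, one for each pair of edge germs,
  and \<open>corner_patch_area\<close> bounds each of them from below in the same small
  ball.\<close>

lemma vertex_density_lower:
  assumes v: "v \<in> vertices F" and \<eta>: "0 < \<eta>" "\<eta> < 1"
  shows "\<forall>\<^sub>F \<rho> in at_right 0. (1 - \<eta>) / (1 + \<eta>)\<^sup>2 * (3 * tetra_angle * \<rho>\<^sup>2) \<le> measure \<mu> (cball v \<rho>)"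
proof -
  interpret finite_measure \<mu> by (rule finite_measure)
  let ?I = "{(i :: nat, j). i < j \<and> j < 4}"
  let ?q = "{(x :: real, y :: real). 0 < x \<and> 0 < y}"
  have "vertex_point F v" using foam v by (auto simp: is_foam_def)
  then obtain W and \<phi> :: "nat \<Rightarrow> nat \<Rightarrow> plane \<Rightarrow> space" and U and \<Gamma> :: "nat \<Rightarrow> space set" and \<tau> :: "nat \<Rightarrow> space" where
    "open W" "v \<in> W"
    and \<tau>: "\<forall>i<4. norm (\<tau> i) = 1 \<and> (\<exists>e\<in>edges F. \<Gamma> i \<subseteq> e)"
      "\<forall>i<4. \<forall>j<4. i \<noteq> j \<longrightarrow> vec_angle (\<tau> i) (\<tau> j) = arccos (- (1 / 3))"
    and P: "\<forall>j<4. \<forall>i<j. open (U i j) \<and> C_k 1 (\<phi> i j) (U i j) \<and> immersion_on (\<phi> i j) (U i j) \<and>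
           topological_embedding_on (\<phi> i j) (U i j \<inter> {(x, y). x \<ge> 0 \<and> y \<ge> 0}) \<and>
           (0, 0) \<in> U i j \<and> \<phi> i j (0, 0) = v \<and>
           d_x (\<phi> i j) (0, 0) = \<tau> i \<and> d_y (\<phi> i j) (0, 0) = \<tau> j \<and>
           \<phi> i j ` (U i j \<inter> {(x, y). x > 0 \<and> y = 0}) = \<Gamma> i \<and>
           \<phi> i j ` (U i j \<inter> {(x, y). x = 0 \<and> y > 0}) = \<Gamma> j \<and>
           (\<exists>S\<in>faces F. local_param S (\<phi> i j) (U i j \<inter> ?q))"
    and disj: "disjoint_family_on (\<lambda>(i, j). \<phi> i j ` (U i j \<inter> ?q)) ?I"
    unfolding vertex_point_def by (elim exE conjE) (rule that; assumption)
  define Q where "Q k = (case k of (i, j) \<Rightarrow> U i j \<inter> ?q)" for k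
  define \<Phi> where "\<Phi> k = (case k of (i, j) \<Rightarrow> \<phi> i j)" for k
  define A where "A = (1 - \<eta>) / (1 + \<eta>)\<^sup>2"
  have A0: "A \<ge> 0" using \<eta> by (simp add: A_def)
  have ev: "\<forall>\<^sub>F \<rho> in at_right 0. ennreal (A * (\<rho>\<^sup>2 * tetra_angle / 2)) \<le> patch_area (\<Phi> k) (Q k) (cball v \<rho>)" if k: "k \<in> ?I" for k
  proof -
    obtain i j where ij: "k = (i, j)" "i < j" "j < 4" using k by auto
    then have P': "open (U i j)" "C_k 1 (\<phi> i j) (U i j)" "(0, 0) \<in> U i j" "\<phi> i j (0, 0) = v"
           "d_x (\<phi> i j) (0, 0) = \<tau> i" "d_y (\<phi> i j) (0, 0) = \<tau> j"
      using P[rule_format, OF ij(3,2)] by blast+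
    have n: "norm (\<tau> i) = 1" "norm (\<tau> j) = 1" using \<tau>(1) ij by auto
    have "vec_angle (\<tau> i) (\<tau> j) = arccos (- (1 / 3))" using \<tau>(2) ij by auto
    then have "\<tau> i \<bullet> \<tau> j = cos (arccos (- (1/3)))" using cos_vec_angle[of "\<tau> i" "\<tau> j"] n by force
    then have "\<tau> i \<bullet> \<tau> j = - (1/3)" by (subst (asm) cos_arccos) auto
    then show ?thesis
      using corner_patch_area[OF P'(1,3,2) _ _ _ \<eta>] n unfolding P'(4-6)
      by (simp only: ij(1) Q_def \<Phi>_def A_def prod.case)
  qed
  have lp: "local_param M (\<Phi> k) (Q k)" if k: "k \<in> ?I" for k
  proof -
    obtain i j where ij: "k = (i, j)" "i < j" "j < 4" using k by auto
    obtain S where "S \<in> faces F" "local_param S (\<phi> i j) (U i j \<inter> ?q)"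
      using P[rule_format, OF ij(3,2)] by blast
    then show ?thesis using face_patch(1) by (simp add: ij(1) Q_def \<Phi>_def)
  qed
  have disj': "disjoint_family_on (\<lambda>k. \<Phi> k ` Q k) ?I"
  proof -
    have "(\<lambda>k. \<Phi> k ` Q k) = (\<lambda>(i, j). \<phi> i j ` (U i j \<inter> ?q))" by (rule ext) (simp add: Q_def \<Phi>_def split_beta)
    then show ?thesis using disj by (simp only:)
  qed
  have "\<forall>\<^sub>F \<rho> in at_right 0. \<forall>k\<in>?I. ennreal (A * (\<rho>\<^sup>2 * tetra_angle / 2)) \<le> patch_area (\<Phi> k) (Q k) (cball v \<rho>)"
    by (rule eventually_ball_finite[OF card_pairs(2)]) (use ev in blast)
  then show ?thesis
  proof eventually_elim
    fix \<rho> :: real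
    assume k: "\<forall>k\<in>?I. ennreal (A * (\<rho>\<^sup>2 * tetra_angle / 2)) \<le> patch_area (\<Phi> k) (Q k) (cball v \<rho>)"
    have th: "tetra_angle \<ge> 0" by (rule arccos_lbound) auto
    have Qb: "\<Phi> k ` Q k \<in> sets borel" if "k \<in> ?I" for k
      using lp[OF that] by (intro local_param_image_borel[OF lp[OF that]]) (auto simp: local_param_def)
    have "ennreal (A * (3 * tetra_angle * \<rho>\<^sup>2)) = (\<Sum>k\<in>?I. ennreal (A * (\<rho>\<^sup>2 * tetra_angle / 2)))"
      using A0 th by (simp only: sum_constant card_pairs) (simp add: ennreal_mult'[symmetric] ennreal_of_nat_eq_real_of_nat algebra_simps flip: ennreal_numeral)
    also have "\<dots> \<le> (\<Sum>k\<in>?I. emeasure \<mu> (cball v \<rho> \<inter> \<Phi> k ` Q k))"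
    proof (rule sum_mono)
      fix i assume i: "i \<in> ?I"
      have "emeasure \<mu> (cball v \<rho> \<inter> \<Phi> i ` Q i) = patch_area (\<Phi> i) (Q i) (cball v \<rho>)"
        by (rule patch[OF lp[OF i]]) simp
      then show "ennreal (A * (\<rho>\<^sup>2 * tetra_angle / 2)) \<le> emeasure \<mu> (cball v \<rho> \<inter> \<Phi> i ` Q i)"
        using bspec[OF k i] by (simp only:)
    qed
    also have "\<dots> = emeasure \<mu> (\<Union>k\<in>?I. cball v \<rho> \<inter> \<Phi> k ` Q k)"
    proof (rule sum_emeasure)
      show "(\<lambda>k. cball v \<rho> \<inter> \<Phi> k ` Q k) ` ?I \<subseteq> sets \<mu>"
        unfolding sets_eq by (intro image_subsetI sets.Int Qb) auto
      show "disjoint_family_on (\<lambda>k. cball v \<rho> \<inter> \<Phi> k ` Q k) ?I"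
        using disj' unfolding disjoint_family_on_def by blast
    qed (rule card_pairs)
    also have "\<dots> \<le> emeasure \<mu> (cball v \<rho>)" by (rule emeasure_mono) (auto simp: sets_eq)
    also have "\<dots> = ennreal (measure \<mu> (cball v \<rho>))" by (rule emeasure_eq_measure)
    finally show "(1 - \<eta>) / (1 + \<eta>)\<^sup>2 * (3 * tetra_angle * \<rho>\<^sup>2) \<le> measure \<mu> (cball v \<rho>)"
      by (simp add: A_def ennreal_le_iff)
  qed
qed

text \<open>Monotonicity compares radius R with radii \<rho> tending to 0, where the density bound
  holds up to the factor (1 - \<eta>)/(1 + \<eta>)^2; then \<eta> tends to 0.\<close>

theorem vertex_ball_area:
  assumes v: "v \<in> vertices F" and ball: "ball v R \<subseteq> \<Omega>" "ball v R \<inter> vertices F = {v}" and R: "0 < R"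
  shows "3 * tetra_angle * R\<^sup>2 \<le> measure \<mu> (ball v R)"
proof -
  define m where "m = measure \<mu> (ball v R) / R\<^sup>2"
  have 1: "(1 - \<eta>) / (1 + \<eta>)\<^sup>2 * (3 * tetra_angle) \<le> m" if \<eta>: "0 < \<eta>" "\<eta> < 1" for \<eta>
  proof -
    \<comment> \<open>The inequality itself does not mention \<rho>; one admissible \<rho> proves
      it, and the filter is nontrivial.\<close>
    have "\<forall>\<^sub>F \<rho> in at_right (0::real). (1 - \<eta>) / (1 + \<eta>)\<^sup>2 * (3 * tetra_angle) \<le> m"
    proof (rule eventually_mono[OF eventually_conj[OF vertex_density_lower[OF v \<eta>] eventually_at_right_real[OF R]]])
      fix \<rho> assume "(1 - \<eta>) / (1 + \<eta>)\<^sup>2 * (3 * tetra_angle * \<rho>\<^sup>2) \<le> measure \<mu> (cball v \<rho>) \<and> \<rho> \<in> {0<..<R}"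
      then have \<rho>: "(1 - \<eta>) / (1 + \<eta>)\<^sup>2 * (3 * tetra_angle * \<rho>\<^sup>2) \<le> measure \<mu> (cball v \<rho>)" "\<rho> \<in> {0<..<R}" by auto
      have "(1 - \<eta>) / (1 + \<eta>)\<^sup>2 * (3 * tetra_angle) \<le> measure \<mu> (cball v \<rho>) / \<rho>\<^sup>2"
        using \<rho> by (simp add: pos_le_divide_eq mult.assoc)
      also have "\<dots> \<le> m" unfolding m_def by (rule monotonicity[OF v ball]) (use \<rho> in auto)
      finally show "(1 - \<eta>) / (1 + \<eta>)\<^sup>2 * (3 * tetra_angle) \<le> m" .
    qed
    then show ?thesis by (simp add: trivial_limit_at_right_real)
  qed
  have "(1 - 0) / (1 + 0)\<^sup>2 * (3 * tetra_angle) \<le> m"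
  proof (rule tendsto_upperbound)
    show "((\<lambda>\<eta>. (1 - \<eta>) / (1 + \<eta>)\<^sup>2 * (3 * tetra_angle)) \<longlongrightarrow> (1 - 0) / (1 + 0)\<^sup>2 * (3 * tetra_angle)) (at_right 0)"
      by (intro tendsto_intros) auto
    show "\<forall>\<^sub>F \<eta> in at_right 0. (1 - \<eta>) / (1 + \<eta>)\<^sup>2 * (3 * tetra_angle) \<le> m"
    proof (rule eventually_mono[OF eventually_at_right_real[of 0 1]])
      show "(1 - \<eta>) / (1 + \<eta>)\<^sup>2 * (3 * tetra_angle) \<le> m" if "\<eta> \<in> {0<..<1}" for \<eta>
        using that by (intro 1) auto
    qed simp
  qed simp
  then show ?thesis using R by (simp add: m_def pos_le_divide_eq)
qed

end

section \<open>The pressure inequality\<close>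

text \<open>Each face comes with its own normal field. The faces are disjoint, so these fields form
  one function on the union; they are relatively open, so it is continuous there.\<close>

lemma minimal_foam_measure_exists:
  assumes \<Omega>: "open \<Omega>" and foam: "minimal_foam \<Omega> F" and area: "foam_area F < \<infinity>"
  obtains n \<mu> where "minimal_foam_measure F n \<mu> \<Omega>" "emeasure \<mu> UNIV \<le> foam_area F"
proof -
  have isf: "is_foam \<Omega> F" and H: "\<And>S. S \<in> faces F \<Longrightarrow> constant_mean_curvature S 0"
    using foam by (auto simp: minimal_foam_def)
  let ?M = "\<Union> (faces F)"
  have S: "openin (top_of_set (foam_set F)) S" "embedded_surface S" if "S \<in> faces F" for S
    using isf that by (auto simp: is_foam_def)
  have oM: "openin (top_of_set ?M) S" if "S \<in> faces F" for S
    by (rule openin_subset_trans[OF S(1)[OF that]]) (use that in \<open>auto simp: foam_set_def\<close>)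
  have "embedded_surface ?M"
    unfolding embedded_surface_def
  proof
    fix p assume "p \<in> ?M"
    then obtain T where T: "T \<in> faces F" "p \<in> T" by blast
    then obtain \<phi> U where "local_param T \<phi> U" "p \<in> \<phi> ` U" using S(2)[OF T(1)] unfolding embedded_surface_def by blast
    then show "\<exists>\<phi> U. local_param ?M \<phi> U \<and> p \<in> \<phi> ` U"
      using openin_trans[OF _ oM[OF T(1)]] unfolding local_param_def by blast
  qed
  then obtain \<mu> where \<mu>: "sets \<mu> = sets borel" "emeasure \<mu> UNIV \<le> surface_area ?M" "?M \<in> sets borel" "emeasure \<mu> (- ?M) = 0"
    "\<And>\<phi> U B. local_param ?M \<phi> U \<Longrightarrow> B \<in> sets borel \<Longrightarrow> emeasure \<mu> (B \<inter> \<phi> ` U) = patch_area \<phi> U B"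
    by (rule area_measure_exists) blast
  have "\<forall>S\<in>faces F. \<exists>n. unit_normal_field S n \<and> (\<forall>p\<in>S. has_mean_curvature S n p 0)"
    using H unfolding constant_mean_curvature_def by blast
  from bchoice[OF this] obtain N where N0: "\<forall>S\<in>faces F. unit_normal_field S (N S) \<and> (\<forall>p\<in>S. has_mean_curvature S (N S) p 0)" ..
  have N: "unit_normal_field S (N S) \<and> (\<forall>p\<in>S. has_mean_curvature S (N S) p 0)" if "S \<in> faces F" for S
    using N0 that by (rule bspec)
  define n where "n p = N (SOME S. S \<in> faces F \<and> p \<in> S) p" for p
  have nN: "n p = N S p" if "S \<in> faces F" "p \<in> S" for S p
  proof -
    have "(SOME S. S \<in> faces F \<and> p \<in> S) \<in> faces F \<and> p \<in> (SOME S. S \<in> faces F \<and> p \<in> S)"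
      by (rule someI[of _ S]) (use that in blast)
    moreover have "pairwise disjnt (faces F)" using isf by (simp add: is_foam_def)
    ultimately have "(SOME S. S \<in> faces F \<and> p \<in> S) = S"
      using that by (elim conjE) (rule ccontr, drule (3) pairwiseD, auto simp: disjnt_iff)
    then show ?thesis by (simp add: n_def)
  qed
  have nS: "unit_normal_field T n \<and> (\<forall>p\<in>T. has_mean_curvature T n p 0)" if T: "T \<in> faces F" for T
  proof -
    have "continuous_on T n"
      by (rule continuous_on_eq[of _ "N T"]) (use N[OF T] nN[OF T] in \<open>auto simp: unit_normal_field_def\<close>)
    moreover have "\<phi> u \<in> T" if "local_param T \<phi> U" "u \<in> U" for \<phi> U u
      using that openin_imp_subset unfolding local_param_def by blast
    ultimately have "unit_normal_field T n"
      using N[OF T] nN[OF T] unfolding unit_normal_field_def by simp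
    moreover have "has_mean_curvature T n p 0" if "p \<in> T" for p
      using N[OF T] that unfolding has_mean_curvature_def nN[OF T that] by blast
    ultimately show ?thesis by blast
  qed
  have "continuous_on ?M n"
    unfolding continuous_on_eq_continuous_within
  proof
    fix p assume "p \<in> ?M"
    then obtain T where T: "T \<in> faces F" "p \<in> T" by blast
    obtain O1 where O1: "open O1" "T = ?M \<inter> O1" using oM[OF T(1)] unfolding openin_open by blast
    have "at p within T = at p within ?M"
      by (rule at_within_nhd[OF _ O1(1)]) (use T O1 in auto)
    moreover have "continuous (at p within T) n"
      using nS[OF T(1)] T(2) by (auto simp: unit_normal_field_def continuous_on_eq_continuous_within)
    ultimately show "continuous (at p within ?M) n" by (simp only:)
  qed
  show ?thesis
  proof (rule that)
    show "minimal_foam_measure F n \<mu> \<Omega>"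
    proof
      show "emeasure \<mu> UNIV < \<infinity>" using \<mu>(2) area by (auto simp: foam_area_def)
      show "norm (n x) = 1" if "x \<in> ?M" for x using that nS by (auto simp: unit_normal_field_def)
    qed (use \<mu> \<open>continuous_on ?M n\<close> nS \<Omega> isf in blast)+
    show "emeasure \<mu> UNIV \<le> foam_area F" using \<mu>(2) by (simp add: foam_area_def)
  qed
qed

theorem foam_area_lower_bound:
  assumes \<Omega>: "open \<Omega>" and foam: "minimal_foam \<Omega> F" and area: "foam_area F < \<infinity>"
    and V: "finite (vertices F)" "card (vertices F) \<noteq> 1"
    and inside: "\<forall>v\<in>vertices F. ball v (min_vertex_dist F / 2) \<subseteq> \<Omega>"
  shows "real (card (vertices F)) * A_0 (min_vertex_dist F) \<le> enn2real (foam_area F)"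
\<comment> \<open>Without vertices the left side is 0, whatever the value of \<open>Min\<close> on
  the empty set. Otherwise there are at least two vertices, so the minimum is attained and
  positive.\<close>
proof (cases "vertices F = {}")
  case False
  obtain n \<mu> where loc: "minimal_foam_measure F n \<mu> \<Omega>" and le: "emeasure \<mu> UNIV \<le> foam_area F"
    by (rule minimal_foam_measure_exists[OF \<Omega> foam area])
  interpret minimal_foam_measure F n \<mu> \<Omega> by (rule loc)
  interpret finite_measure \<mu> by (rule finite_measure)
  let ?V = "vertices F"
  define d where "d = min_vertex_dist F"
  let ?D = "{dist v w | v w. v \<in> ?V \<and> w \<in> ?V \<and> v \<noteq> w}"
  have Df: "finite ?D"
  proof (rule finite_subset)
    show "?D \<subseteq> (\<lambda>(v, w). dist v w) ` (?V \<times> ?V)" by auto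
  qed (use V in simp)
  have "\<exists>v w. v \<in> ?V \<and> w \<in> ?V \<and> v \<noteq> w"
  proof (rule ccontr)
    assume "\<not> ?thesis"
    then obtain v where "?V = {v}" using False by blast
    then show False using V by simp
  qed
  then have Dne: "?D \<noteq> {}" by blast
  have "d \<in> ?D" unfolding d_def min_vertex_dist_def by (rule Min_in[OF Df Dne])
  then have d0: "d > 0" by auto
  have dmin: "d \<le> dist v w" if "v \<in> ?V" "w \<in> ?V" "v \<noteq> w" for v w
    unfolding d_def min_vertex_dist_def by (rule Min_le[OF Df]) (use that in blast)
  have ball: "3 * tetra_angle * (d / 2)\<^sup>2 \<le> measure \<mu> (ball v (d / 2))" if v: "v \<in> ?V" for v
  proof (rule vertex_ball_area[OF v])
    show "ball v (d / 2) \<subseteq> \<Omega>" using inside v by (simp add: d_def)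
    show "ball v (d / 2) \<inter> ?V = {v}"
    proof (intro equalityI subsetI)
      fix w assume w: "w \<in> ball v (d / 2) \<inter> ?V"
      then have "dist v w < d / 2" "w \<in> ?V" by auto
      then show "w \<in> {v}" using dmin[OF v, of w] d0 by (cases "v = w") auto
    qed (use d0 v in simp)
  qed (use d0 in simp)
  \<comment> \<open>The pi in the denominator of \<open>theta_v\<close> cancels the one in
    \<open>A_0\<close>.\<close>
  have "real (card ?V) * A_0 d = (\<Sum>v\<in>?V. 3 * tetra_angle * (d / 2)\<^sup>2)"
    by (simp add: A_0_def theta_v_def)
  also have "\<dots> \<le> (\<Sum>v\<in>?V. measure \<mu> (ball v (d / 2)))" by (rule sum_mono) (rule ball)
  also have "\<dots> = measure \<mu> (\<Union>v\<in>?V. ball v (d / 2))"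
  proof (rule finite_measure_finite_Union[symmetric, OF V(1)])
    show "(\<lambda>v. ball v (d / 2)) ` ?V \<subseteq> sets \<mu>"
      unfolding sets_eq by (intro image_subsetI borel_open open_ball)
    show "disjoint_family_on (\<lambda>v. ball v (d / 2)) ?V"
      unfolding disjoint_family_on_def
    proof (intro ballI impI)
      fix v w assume vw: "v \<in> ?V" "w \<in> ?V" "v \<noteq> w"
      have "d \<le> dist v w" by (rule dmin[OF vw])
      then show "ball v (d / 2) \<inter> ball w (d / 2) = {}" by (intro disjoint_ballI) simp
    qed
  qed
  also have "\<dots> \<le> measure \<mu> UNIV" by (rule finite_measure_mono) (auto simp: sets_eq)
  also have "\<dots> \<le> enn2real (foam_area F)"
    unfolding measure_def by (rule enn2real_mono[OF le]) (use area in simp)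
  finally show ?thesis by (simp add: d_def)
qed simp

theorem mainTheorem6:
  fixes \<Omega> :: "(real ^ 3) set" and F :: foam and p_int p_ext \<sigma> :: real
  assumes region: "open \<Omega>" "connected \<Omega>" "\<Omega> \<noteq> {}" "emeasure lborel \<Omega> < \<infinity>"
    and foam: "minimal_foam \<Omega> F"
    and area: "foam_area F < \<infinity>"
    and vertices: "finite (vertices F)" "card (vertices F) \<noteq> 1"
    and inside: "\<forall>v\<in>vertices F. ball v (min_vertex_dist F / 2) \<subseteq> \<Omega>"
    and tension: "\<sigma> > 0"
    and equilibrium: "p_int - p_ext = 3 / 2 * \<sigma> * (enn2real (foam_area F) / measure lborel \<Omega>)"
  shows "p_int \<ge> p_ext + 3 / 2 * \<sigma> * vertex_density \<Omega> F * A_0 (min_vertex_dist F)"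
proof -
  \<comment> \<open>Divided by the volume, the area bound compares the vertex density with the
    quotient in the equilibrium law.\<close>
  have "real (card (vertices F)) * A_0 (min_vertex_dist F) / measure lborel \<Omega> \<le> enn2real (foam_area F) / measure lborel \<Omega>"
    by (rule divide_right_mono[OF foam_area_lower_bound[OF region(1) foam area vertices inside]]) simp
  then have "3 / 2 * \<sigma> * (vertex_density \<Omega> F * A_0 (min_vertex_dist F)) \<le> 3 / 2 * \<sigma> * (enn2real (foam_area F) / measure lborel \<Omega>)"
    using tension by (intro mult_left_mono) (simp_all add: vertex_density_def)
  then show ?thesis using equilibrium by (simp add: mult.assoc)
qed

end
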